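(* Let $H^t(m,n)$, $H^c(m,n)$ and $H^f(m,n)$ be the hexagonal lattices with toroidal, cylindrical and free boundary conditions (defined in the context). Then the iterated limits $$\lim_{m\to\infty}\lim_{n\to\infty}\frac{LEL(H^t(m,n))}{2(m+1)(n+1)},\quad \lim_{m\to\infty}\lim_{n\to\infty}\frac{LEL(H^c(m,n))}{2(m+1)(n+1)},\quad \lim_{m\to\infty}\lim_{n\to\infty}\frac{LEL(H^f(m,n))}{2(m+1)(n+1)}$$ are all equal, and their common value is $$\frac{1}{8\pi^2}\int_0^{2\pi}\!\!\int_0^{2\pi}\Big(\sqrt{3+\sqrt{3+2\cos x+2\cos y+2\cos(x+y)}}+\sqrt{3-\sqrt{3+2\cos x+2\cos y+2\cos(x+y)}}\Big)\,dx\,dy\approx 1.6437 .$$ Equivalently, $LEL(H^t(m,n))$, $LEL(H^c(m,n))$ and $LEL(H^f(m,n))$ are all asymptotically $\approx 3.2874\,(m+1)(n+1)$ as $m,n\to\infty$.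
   Context: All graphs are finite, simple and undirected. For a graph $G$ on $N$ vertices with Laplacian matrix $L(G)=D(G)-A(G)$ and Laplacian eigenvalues $\mu_1\ge\cdots\ge\mu_N$, $LEL(G)=\sum_{i=1}^{N-1}\sqrt{\mu_i}$. For integers $m,n\ge 1$, the toroidal hexagonal (honeycomb) lattice $H^t(m,n)$ has vertex set $\{(i,j,s): i\in\mathbb{Z}_{m+1},\ j\in\mathbb{Z}_{n+1},\ s\in\{0,1\}\}$ (so $2(m+1)(n+1)$ vertices, each of degree 3), where each $(i,j,0)$ is adjacent to $(i,j,1)$, $(i+1,j,1)$ and $(i,j+1,1)$ (indices modulo $m+1$ and $n+1$ respectively); its Laplacian eigenvalues are $3\pm\sqrt{3+2\cos\frac{2\pi i}{m+1}+2\cos\frac{2\pi j}{n+1}+2\cos(\frac{2\pi i}{m+1}+\frac{2\pi j}{n+1})}$, $0\le i\le m$, $0\le j\le n$. The cylindrical hexagonal lattice $H^c(m,n)$ is the spanning subgraph of $H^t(m,n)$ obtained by deleting the $n+1$ wrap-around edges $(m,j,0)(0,j,1)$, $0\le j\le n$; the free hexagonal lattice $H^f(m,n)$ is obtained from $H^c(m,n)$ by further deleting the $m+1$ wrap-around edges $(i,n,0)(i,0,1)$, $0\le i\le m$. (This coordinate description is a concrete realization of the lattices, which the paper defines via a figure.)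
   Formalization: The printed decimals 1.6437 and 3.2874 are not accurate (the integral is about 1.6357, twice it about 3.2714); "≈" is proved only as within 0.01 of 1.6437 and within 0.02 of 3.2874, and the asymptotics use the exact constant. *)

theory Defs
  imports
    "HOL-Analysis.Henstock_Kurzweil_Integration"
    "HOL-Library.Landau_Symbols"
    "HOL-Computational_Algebra.Polynomial_Factorial"
    "Jordan_Normal_Form.Char_Poly"
begin

section \<open>Graphs and their Laplacian spectrum\<close>

text \<open>A graph is a vertex set together with a set of edges; an edge is a two-element set.\<close>

type_synonym 'a sgraph = "'a set \<times> 'a set set"

definition simple_graph :: "'a sgraph \<Rightarrow> bool" where
  "simple_graph G \<longleftrightarrow> finite (fst G) \<and>
     (\<forall>e\<in>snd G. \<exists>u\<in>fst G. \<exists>v\<in>fst G. u \<noteq> v \<and> e = {u, v})"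

definition vertex_degree :: "'a sgraph \<Rightarrow> 'a \<Rightarrow> nat" where
  "vertex_degree G v = card {e \<in> snd G. v \<in> e}"

text \<open>Matrices are indexed by natural numbers, so the vertices have to be listed in some order.
  A different order conjugates the matrices below by a permutation matrix, which does not affect
  the characteristic polynomial.\<close>

definition vertex_list :: "'a sgraph \<Rightarrow> 'a list" where
  "vertex_list G = (SOME vs. distinct vs \<and> set vs = fst G)"

definition degree_matrix :: "'a sgraph \<Rightarrow> real mat" where
  "degree_matrix G = Matrix.mat (card (fst G)) (card (fst G))
     (\<lambda>(k, l). if k = l then real (vertex_degree G (vertex_list G ! k)) else 0)"

definition adjacency_matrix :: "'a sgraph \<Rightarrow> real mat" where
  "adjacency_matrix G = Matrix.mat (card (fst G)) (card (fst G))
     (\<lambda>(k, l). if {vertex_list G ! k, vertex_list G ! l} \<in> snd G then 1 else 0)"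

definition laplacian_matrix :: "'a sgraph \<Rightarrow> real mat" where
  "laplacian_matrix G = degree_matrix G - adjacency_matrix G"

text \<open>The Laplacian eigenvalues in non-increasing order, repeated according to their multiplicity.
  The Laplacian matrix of a simple graph is real symmetric, so its characteristic polynomial has
  as many real roots as the graph has vertices.\<close>

definition laplacian_eigenvalues :: "'a sgraph \<Rightarrow> real list" where
  "laplacian_eigenvalues G =
     rev (sorted_list_of_multiset (proots (char_poly (laplacian_matrix G))))"

text \<open>The index \<open>i - 1\<close> is due to list positions starting at 0.\<close>

definition LEL :: "'a sgraph \<Rightarrow> real" where
  "LEL G = (\<Sum>i = 1..card (fst G) - 1. sqrt (laplacian_eigenvalues G ! (i - 1)))"


section \<open>Hexagonal lattices\<close>

text \<open>The residue classes modulo \<open>m + 1\<close> and \<open>n + 1\<close> are represented by \<open>{0..m}\<close> and \<open>{0..n}\<close>.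
  The lattices are only meant for \<open>m, n \<ge> 1\<close>.\<close>

type_synonym hex_vertex = "nat \<times> nat \<times> nat"

definition hex_vertices :: "nat \<Rightarrow> nat \<Rightarrow> hex_vertex set" where
  "hex_vertices m n = {0..m} \<times> {0..n} \<times> {0, 1}"

definition hex_toroidal :: "nat \<Rightarrow> nat \<Rightarrow> hex_vertex sgraph" where
  "hex_toroidal m n = (hex_vertices m n,
     (\<Union>i\<in>{0..m}. \<Union>j\<in>{0..n}.
        {{(i, j, 0), (i, j, 1)},
         {(i, j, 0), ((i + 1) mod (m + 1), j, 1)},
         {(i, j, 0), (i, (j + 1) mod (n + 1), 1)}}))"

definition hex_cylindrical :: "nat \<Rightarrow> nat \<Rightarrow> hex_vertex sgraph" where
  "hex_cylindrical m n = (hex_vertices m n,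
     snd (hex_toroidal m n) - {{(m, j, 0), (0, j, 1)} |j. j \<in> {0..n}})"

definition hex_free :: "nat \<Rightarrow> nat \<Rightarrow> hex_vertex sgraph" where
  "hex_free m n = (hex_vertices m n,
     snd (hex_cylindrical m n) - {{(i, n, 0), (i, 0, 1)} |i. i \<in> {0..m}})"

lemma card_hex_vertices: "card (hex_vertices m n) = 2 * (m + 1) * (n + 1)"
  by (simp add: hex_vertices_def card_cartesian_product)

lemma simple_graph_hex_toroidal: "simple_graph (hex_toroidal m n)"
  by (auto simp: simple_graph_def hex_toroidal_def hex_vertices_def doubleton_eq_iff
      less_Suc_eq_le[symmetric])

lemma simple_graph_hex_cylindrical: "simple_graph (hex_cylindrical m n)"
  using simple_graph_hex_toroidal[of m n]
  by (auto simp: simple_graph_def hex_cylindrical_def hex_toroidal_def)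

lemma simple_graph_hex_free: "simple_graph (hex_free m n)"
  using simple_graph_hex_cylindrical[of m n]
  by (auto simp: simple_graph_def hex_free_def hex_cylindrical_def)


section \<open>The limit\<close>

text \<open>\<open>lim m. lim n. f m n = c\<close>: the inner limit exists for every \<open>m \<ge> 1\<close>.\<close>

definition has_iterated_limit :: "(nat \<Rightarrow> nat \<Rightarrow> real) \<Rightarrow> real \<Rightarrow> bool" where
  "has_iterated_limit f c \<longleftrightarrow>
     (\<exists>g. (\<forall>m\<ge>1. (\<lambda>n. f m n) \<longlonglongrightarrow> g m) \<and> g \<longlonglongrightarrow> c)"

text \<open>Numerically this constant is \<open>1.63570\<close> (and twice it is \<open>3.27139\<close>). The decimal values 1.6437 and
  3.2874 found in the literature are about half a percent too large.\<close>

definition hex_constant :: real where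
  "hex_constant = 1 / (8 * pi\<^sup>2) *
     integral {0..2 * pi} (\<lambda>y. integral {0..2 * pi} (\<lambda>x.
       sqrt (3 + sqrt (3 + 2 * cos x + 2 * cos y + 2 * cos (x + y))) +
       sqrt (3 - sqrt (3 + 2 * cos x + 2 * cos y + 2 * cos (x + y)))))"

end

theory Submission
  imports
    Defs
    "HOL-Analysis.Weierstrass_Theorems"
    "Jordan_Normal_Form.Schur_Decomposition"
begin

text \<open>The spectra are compared through their moments. All Laplacian eigenvalues lie in \<open>[0, 6]\<close>, where
  the square root is a uniform limit of polynomials, so the mean of the square roots of the
  eigenvalues is controlled by the normalised traces of the powers of the Laplacian. These traces
  depend on few edges only to a small extent: removing \<open>c\<close> edges changes the trace of the \<open>k\<close>-th
  power by at most a constant depending on \<open>k\<close> times \<open>c\<close>, which makes the boundary conditions irrelevant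
  when both \<open>m\<close> and \<open>n\<close> grow, and makes the free and the cylindrical lattice equivalent when only \<open>n\<close>
  grows. A discrete Fourier transform in the cyclic coordinates turns the traces into Riemann
  sums; for the toroidal lattice two transforms leave a \<open>2 \<times> 2\<close> matrix with eigenvalues
  \<open>3 \<plusminus> sqrt (hex_rho x y)\<close>, for the cylindrical lattice one transform suffices for the existence of the
  inner limit.

  For the numerical value put \<open>w = sqrt (9 - hex_rho x y)\<close>, so that the integrand is \<open>sqrt (6 + 2 * w)\<close>.
  It is bounded below by a quadratic polynomial in \<open>w\<close>, and \<open>w\<close> by a polynomial of degree 8 in \<open>w\<^sup>2\<close>,
  whose integral is known because the moments of \<open>hex_rho\<close> are integers. Tangents of the square
  root give the upper bound.\<close>


section \<open>Eigenvalues and traces of real symmetric matrices\<close>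

text \<open>The square root is not Lipschitz at \<open>0\<close>, and only the toroidal lattice gets
  an explicit spectrum here, so comparing eigenvalues one by one is not a direct way to transfer its
  limit. With moments no individual eigenvalue is ever compared; the price is that no rate of
  convergence comes out. The iterated limits need more than the joint limit. Cutting the torus into
  the cylinder removes \<open>n + 1\<close> edges among \<open>2 * (m + 1) * (n + 1)\<close>
  vertices, a proportion of order \<open>1 / m\<close> that does not shrink while \<open>m\<close>
  is fixed. Hence the inner limit on the cylinder needs an argument of its own, and it is obtained
  as a Cauchy property without naming its value. The joint limit then identifies the outer limit and
  also yields the asymptotic equivalences. The numerical claim is tight on one side only: the
  constant, about \<open>1.6357\<close>, lies about \<open>0.002\<close> above
  \<open>1.6437 - 0.01\<close>, so the lower bound has to be accurate, while crude estimates are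
  enough for the upper one.\<close>

lemma proots_prod_linear: "proots (\<Prod>a\<leftarrow>es. [:- a, 1:] :: 'a::idom poly) = mset es"
proof (induction es)
  case (Cons a es)
  have "(\<Prod>a\<leftarrow>es. [:- a, 1:] :: 'a poly) \<noteq> 0"
    by (auto simp: prod_list_zero_iff)
  then show ?case
    using Cons by (simp add: proots_mult del: mult_pCons_left)
qed simp

text \<open>The Hermitian form of \<open>A\<close> at an eigenvector \<open>v\<close> is
  \<open>a\<close> times the squared norm of \<open>v\<close>, and it is its own conjugate because
  \<open>A\<close> is real and symmetric.\<close>

lemma real_symmetric_eigenvalue_real:
  fixes A :: "real mat"
  assumes A: "A \<in> carrier_mat n n"
    and sym: "\<And>i j. i < n \<Longrightarrow> j < n \<Longrightarrow> A $$ (i, j) = A $$ (j, i)"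
    and ev: "eigenvalue (map_mat complex_of_real A) a"
  shows "a \<in> \<real>"
proof -
  define C where "C = map_mat complex_of_real A"
  have C: "C \<in> carrier_mat n n" using A by (simp add: C_def)
  from ev obtain v where v: "v \<in> carrier_vec n" "v \<noteq> 0\<^sub>v n" and Cv: "C *\<^sub>v v = a \<cdot>\<^sub>v v"
    using C by (auto simp: eigenvalue_def eigenvector_def C_def)
  define S where "S = (\<Sum>i<n. (cmod (vec_index v i))\<^sup>2)"
  have "S \<noteq> 0"
  proof
    assume "S = 0"
    then have "\<And>i. i < n \<Longrightarrow> vec_index v i = 0"
      by (auto simp: S_def sum_nonneg_eq_0_iff)
    then have "v = 0\<^sub>v n" using v(1) by (intro eq_vecI) auto
    with v(2) show False by simp
  qed
  have row: "(\<Sum>j<n. of_real (A $$ (i, j)) * vec_index v j) = a * vec_index v i" if "i < n" for i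
  proof -
    have "vec_index (C *\<^sub>v v) i = (\<Sum>j<n. of_real (A $$ (i, j)) * vec_index v j)"
      using that v(1) A by (auto simp: C_def scalar_prod_def lessThan_atLeast0 intro!: sum.cong)
    then show ?thesis using that v(1) by (simp add: Cv)
  qed
  define T where "T = (\<Sum>i<n. \<Sum>j<n. cnj (vec_index v i) * of_real (A $$ (i, j)) * vec_index v j)"
  have "T = (\<Sum>i<n. cnj (vec_index v i) * (a * vec_index v i))"
    unfolding T_def by (intro sum.cong refl) (simp add: row[symmetric] sum_distrib_left mult.assoc)
  also have "\<dots> = a * of_real S"
    unfolding S_def of_real_sum sum_distrib_left
    by (intro sum.cong refl) (metis complex_norm_square mult.commute mult.left_commute)
  finally have 1: "T = a * of_real S" .
  have "cnj T = (\<Sum>i<n. \<Sum>j<n. cnj (vec_index v j) * of_real (A $$ (j, i)) * vec_index v i)"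
    unfolding T_def cnj_sum by (intro sum.cong refl) (simp add: sym mult_ac)
  also have "\<dots> = T"
    unfolding T_def by (rule sum.swap)
  finally have "cnj a * of_real S = a * of_real S"
    using 1 by (metis complex_cnj_complex_of_real complex_cnj_mult)
  then have "cnj a = a" using \<open>S \<noteq> 0\<close> by simp
  then show ?thesis by (simp add: Reals_cnj_iff)
qed

text \<open>Over the complex numbers the characteristic polynomial splits. Its roots are eigenvalues
  and therefore real, and the factorisation descends to the reals because
  \<open>map_poly complex_of_real\<close> is injective.\<close>

lemma real_symmetric_char_poly_splits:
  fixes A :: "real mat"
  assumes A: "A \<in> carrier_mat n n"
    and sym: "\<And>i j. i < n \<Longrightarrow> j < n \<Longrightarrow> A $$ (i, j) = A $$ (j, i)"
  shows "\<exists>es. char_poly A = (\<Prod>a\<leftarrow>es. [:- a, 1:]) \<and> length es = n"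
proof -
  define C where "C = map_mat complex_of_real A"
  have C: "C \<in> carrier_mat n n" using A by (simp add: C_def)
  obtain as where as: "char_poly C = (\<Prod>a\<leftarrow>as. [:- a, 1:])" "length as = n"
    using char_poly_factorized[OF C] by blast
  have real: "complex_of_real (Re a) = a" if "a \<in> set as" for a
  proof -
    have "poly (char_poly C) a = 0"
      using that unfolding as(1) poly_prod_list prod_list_zero_iff by force
    then have "eigenvalue C a" by (simp add: eigenvalue_root_char_poly[OF C])
    then have "a \<in> \<real>" using real_symmetric_eigenvalue_real[OF A sym] by (simp add: C_def)
    then show ?thesis by (simp add: complex_is_Real_iff complex_eq_iff)
  qed
  interpret h: map_poly_comm_ring_hom complex_of_real ..
  define es where "es = map Re as"
  have map_prod: "map_poly complex_of_real (\<Prod>a\<leftarrow>xs. [:- a, 1:]) = (\<Prod>a\<leftarrow>map complex_of_real xs. [:- a, 1:])"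
    for xs
    by (induction xs) (simp_all add: h.hom_mult del: mult_pCons_left mult_pCons_right)
  have "map_poly complex_of_real (char_poly A) = char_poly C"
    unfolding C_def by (rule of_real_hom.char_poly_hom[OF A, symmetric])
  also have "\<dots> = (\<Prod>a\<leftarrow>map complex_of_real es. [:- a, 1:])"
    using real unfolding as(1) es_def by (auto intro!: arg_cong[of _ _ prod_list])
  also have "\<dots> = map_poly complex_of_real (\<Prod>a\<leftarrow>es. [:- a, 1:])"
    by (rule map_prod[symmetric])
  finally have "map_poly complex_of_real (char_poly A) = map_poly complex_of_real (\<Prod>a\<leftarrow>es. [:- a, 1:])" .
  then have "char_poly A = (\<Prod>a\<leftarrow>es. [:- a, 1:])"
    by (simp add: poly_eq_iff coeff_map_poly)
  with as(2) show ?thesis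
    by (intro exI[of _ es]) (simp add: es_def)
qed

definition trace_mat :: "'a::comm_ring_1 mat \<Rightarrow> 'a" where
  "trace_mat A = (\<Sum>i<dim_row A. A $$ (i, i))"

lemma trace_mat_mult_comm:
  assumes "A \<in> carrier_mat n m" "B \<in> carrier_mat m n"
  shows "trace_mat (A * B) = trace_mat (B * A)"
proof -
  have "trace_mat (A * B) = (\<Sum>i<n. \<Sum>j<m. A $$ (i, j) * B $$ (j, i))"
    using assms by (auto simp: trace_mat_def scalar_prod_def lessThan_atLeast0 intro!: sum.cong)
  also have "\<dots> = (\<Sum>j<m. \<Sum>i<n. B $$ (j, i) * A $$ (i, j))"
    by (subst sum.swap) (simp add: mult.commute)
  also have "\<dots> = trace_mat (B * A)"
    using assms by (auto simp: trace_mat_def scalar_prod_def lessThan_atLeast0 intro!: sum.cong)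
  finally show ?thesis .
qed

lemma upper_triangular_mult_diag:
  fixes A B :: "'a::comm_ring_1 mat"
  assumes "A \<in> carrier_mat n n" "B \<in> carrier_mat n n" "upper_triangular A" "upper_triangular B"
  shows "upper_triangular (A * B)" "\<And>i. i < n \<Longrightarrow> (A * B) $$ (i, i) = A $$ (i, i) * B $$ (i, i)"
proof -
  have prod: "(A * B) $$ (i, j) = (\<Sum>k\<in>{0..<n}. A $$ (i, k) * B $$ (k, j))" if "i < n" "j < n" for i j
    using that assms by (auto simp: scalar_prod_def intro!: sum.cong)
  show "upper_triangular (A * B)"
  proof (rule upper_triangularI)
    fix i j assume ij: "j < i" "i < dim_row (A * B)"
    have "A $$ (i, k) * B $$ (k, j) = 0" if "k < n" for k
    proof (cases "k < i")
      case True
      then show ?thesis using assms ij by (simp add: upper_triangularD)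
    next
      case False
      then show ?thesis using assms ij that by (simp add: upper_triangularD[of B j k])
    qed
    then show "(A * B) $$ (i, j) = 0"
      using ij assms(1) by (subst prod) auto
  qed
  show "(A * B) $$ (i, i) = A $$ (i, i) * B $$ (i, i)" if i: "i < n" for i
  proof -
    have "A $$ (i, k) * B $$ (k, i) = 0" if "k < n" "k \<noteq> i" for k
    proof (cases "k < i")
      case True
      then show ?thesis using assms i by (simp add: upper_triangularD)
    next
      case False
      then show ?thesis using assms that by (simp add: upper_triangularD[of B i k])
    qed
    then have "(\<Sum>k\<in>{0..<n}. A $$ (i, k) * B $$ (k, i)) = (\<Sum>k\<in>{i}. A $$ (i, k) * B $$ (k, i))"
      using i by (intro sum.mono_neutral_right) auto
    then show ?thesis using i by (simp add: prod)
  qed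
qed

lemma upper_triangular_pow_diag:
  fixes A :: "'a::comm_ring_1 mat"
  assumes "A \<in> carrier_mat n n" "upper_triangular A"
  shows "upper_triangular (A ^\<^sub>m k) \<and> (\<forall>i<n. (A ^\<^sub>m k) $$ (i, i) = (A $$ (i, i)) ^ k)"
proof (induction k)
  case 0
  then show ?case using assms(1) by auto
next
  case (Suc k)
  have "A ^\<^sub>m k \<in> carrier_mat n n" using assms(1) by simp
  from upper_triangular_mult_diag[OF this assms(1) _ assms(2)] Suc show ?case
    by (simp add: mult.commute)
qed

text \<open>Triangularisation is enough: since the characteristic polynomial splits,
  \<open>A\<close> is similar to an upper triangular matrix with diagonal \<open>es\<close>. Powers
  keep this shape and act entrywise on the diagonal, and the trace is invariant under
  similarity.\<close>

lemma sum_proots_power_eq_trace: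
  fixes A :: "real mat"
  assumes A: "A \<in> carrier_mat n n"
    and es: "char_poly A = (\<Prod>a\<leftarrow>es. [:- a, 1:])"
  shows "(\<Sum>e\<leftarrow>es. e ^ k) = trace_mat (A ^\<^sub>m k)"
proof -
  obtain B P Q where "schur_decomposition A es = (B, P, Q)"
    by (metis prod_cases3)
  from schur_decomposition[OF A es this]
  have wit: "similar_mat_wit A B P Q" and tri: "upper_triangular B" and dg: "diag_mat B = es"
    by auto
  from similar_mat_witD2[OF A wit] have
    QP: "Q * P = 1\<^sub>m n" and car: "B \<in> carrier_mat n n" "P \<in> carrier_mat n n" "Q \<in> carrier_mat n n"
    by auto
  have Bk: "B ^\<^sub>m k \<in> carrier_mat n n" using car by simp
  have "trace_mat (A ^\<^sub>m k) = trace_mat ((P * B ^\<^sub>m k) * Q)"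
    using similar_mat_wit_pow_id[OF wit] by simp
  also have "\<dots> = trace_mat (Q * (P * B ^\<^sub>m k))"
    using car Bk by (intro trace_mat_mult_comm[of _ n n]) auto
  also have "Q * (P * B ^\<^sub>m k) = B ^\<^sub>m k"
    using car Bk QP by (simp add: assoc_mult_mat[of Q n n P n "B ^\<^sub>m k" n, symmetric])
  also have "trace_mat (B ^\<^sub>m k) = (\<Sum>i<n. (B $$ (i, i)) ^ k)"
    using upper_triangular_pow_diag[OF car(1) tri, of k] Bk by (auto simp: trace_mat_def)
  also have "\<dots> = (\<Sum>e\<leftarrow>diag_mat B. e ^ k)"
    using car by (simp add: diag_mat_def comp_def interv_sum_list_conv_sum_set_nat lessThan_atLeast0)
  finally show ?thesis by (simp add: dg)
qed

text \<open>Read the eigenvector equation in the row \<open>i\<close> where the entry of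
  \<open>v\<close> is largest in absolute value and divide by that entry. The lemma serves to
  confine Laplacian spectra to an interval that depends on the maximal degree only.\<close>

lemma eigenvalue_gershgorin:
  fixes A :: "real mat"
  assumes A: "A \<in> carrier_mat n n" and ev: "eigenvalue A e"
  obtains i where "i < n" "\<bar>e - A $$ (i, i)\<bar> \<le> (\<Sum>j\<in>{..<n} - {i}. \<bar>A $$ (i, j)\<bar>)"
proof -
  from ev obtain v where v: "v \<in> carrier_vec n" "v \<noteq> 0\<^sub>v n" and Av: "A *\<^sub>v v = e \<cdot>\<^sub>v v"
    using A by (auto simp: eigenvalue_def eigenvector_def)
  have "\<exists>j<n. vec_index v j \<noteq> 0"
    using v by (metis carrier_vecD eq_vecI index_zero_vec(1) index_zero_vec(2))
  then obtain j0 where j0: "j0 < n" "vec_index v j0 \<noteq> 0" by blast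
  define a where "a = Max ((\<lambda>j. \<bar>vec_index v j\<bar>) ` {..<n})"
  have "a \<in> (\<lambda>j. \<bar>vec_index v j\<bar>) ` {..<n}"
    unfolding a_def using j0 by (intro Max_in) auto
  moreover have "\<bar>vec_index v j\<bar> \<le> a" if "j < n" for j
    unfolding a_def using that by (intro Max_ge) auto
  ultimately obtain i where i: "i < n" and mx: "\<And>j. j < n \<Longrightarrow> \<bar>vec_index v j\<bar> \<le> \<bar>vec_index v i\<bar>"
    by blast
  have pos: "\<bar>vec_index v i\<bar> > 0" using mx[OF j0(1)] j0(2) by linarith
  have "e * vec_index v i = (\<Sum>j<n. A $$ (i, j) * vec_index v j)"
  proof -
    have "vec_index (A *\<^sub>v v) i = (\<Sum>j<n. A $$ (i, j) * vec_index v j)"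
      using i v(1) A by (auto simp: scalar_prod_def lessThan_atLeast0 intro!: sum.cong)
    then show ?thesis using i v(1) by (simp add: Av)
  qed
  also have "\<dots> = A $$ (i, i) * vec_index v i + (\<Sum>j\<in>{..<n} - {i}. A $$ (i, j) * vec_index v j)"
    using i by (simp add: sum.remove[of _ i])
  finally have "(e - A $$ (i, i)) * vec_index v i = (\<Sum>j\<in>{..<n} - {i}. A $$ (i, j) * vec_index v j)"
    by (simp add: algebra_simps)
  then have "\<bar>e - A $$ (i, i)\<bar> * \<bar>vec_index v i\<bar> \<le> (\<Sum>j\<in>{..<n} - {i}. \<bar>A $$ (i, j) * vec_index v j\<bar>)"
    by (metis abs_mult sum_abs)
  also have "\<dots> \<le> (\<Sum>j\<in>{..<n} - {i}. \<bar>A $$ (i, j)\<bar> * \<bar>vec_index v i\<bar>)"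
    by (intro sum_mono) (auto simp: abs_mult intro!: mult_left_mono mx)
  also have "\<dots> = (\<Sum>j\<in>{..<n} - {i}. \<bar>A $$ (i, j)\<bar>) * \<bar>vec_index v i\<bar>"
    by (simp add: sum_distrib_right)
  finally have "\<bar>e - A $$ (i, i)\<bar> \<le> (\<Sum>j\<in>{..<n} - {i}. \<bar>A $$ (i, j)\<bar>)"
    using pos by simp
  with i show ?thesis by (rule that)
qed

section \<open>Powers of kernels\<close>

text \<open>Matrix powers over an arbitrary index set, so that vertices keep their coordinates and
  need no numbering. The entries lie in any commutative ring because real Laplacians and their
  complex Fourier symbols are treated alike.\<close>

primrec ker_pow :: "'v set \<Rightarrow> ('v \<Rightarrow> 'v \<Rightarrow> 'a::comm_ring_1) \<Rightarrow> nat \<Rightarrow> 'v \<Rightarrow> 'v \<Rightarrow> 'a" where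
  "ker_pow V K 0 u v = of_bool (u = v)"
| "ker_pow V K (Suc k) u v = (\<Sum>w\<in>V. ker_pow V K k u w * K w v)"

definition ker_trace :: "'v set \<Rightarrow> ('v \<Rightarrow> 'v \<Rightarrow> 'a::comm_ring_1) \<Rightarrow> nat \<Rightarrow> 'a" where
  "ker_trace V K k = (\<Sum>v\<in>V. ker_pow V K k v v)"

lemma ker_pow_bij:
  assumes "bij_betw \<phi> V W"
    and "\<And>u v. u \<in> V \<Longrightarrow> v \<in> V \<Longrightarrow> K' (\<phi> u) (\<phi> v) = K u v"
    and "u \<in> V" "v \<in> V"
  shows "ker_pow W K' k (\<phi> u) (\<phi> v) = ker_pow V K k u v"
  using assms(4)
proof (induction k arbitrary: v)
  case 0
  then show ?case
    using assms(1,3) by (auto simp: bij_betw_def inj_on_eq_iff)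
next
  case (Suc k)
  have "ker_pow W K' (Suc k) (\<phi> u) (\<phi> v) = (\<Sum>w\<in>V. ker_pow W K' k (\<phi> u) (\<phi> w) * K' (\<phi> w) (\<phi> v))"
    by (simp add: sum.reindex_bij_betw[OF assms(1), symmetric])
  also have "\<dots> = ker_pow V K (Suc k) u v"
    using Suc assms by simp
  finally show ?case .
qed

lemma ker_trace_bij:
  assumes "bij_betw \<phi> V W"
    and "\<And>u v. u \<in> V \<Longrightarrow> v \<in> V \<Longrightarrow> K' (\<phi> u) (\<phi> v) = K u v"
  shows "ker_trace W K' k = ker_trace V K k"
  unfolding ker_trace_def sum.reindex_bij_betw[OF assms(1), symmetric]
  by (intro sum.cong refl ker_pow_bij[OF assms(1)] assms(2))

lemma ker_trace_of_real:
  "ker_trace V (\<lambda>u v. of_real (K u v)) k = (of_real (ker_trace V K k) :: 'a::{real_algebra_1,comm_ring_1})"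
proof -
  have "ker_pow V (\<lambda>u v. of_real (K u v)) k u v = (of_real (ker_pow V K k u v) :: 'a)" for u v
    by (induction k arbitrary: v) simp_all
  then show ?thesis by (simp add: ker_trace_def)
qed

lemma mat_pow_eq_ker_pow:
  assumes "i < n" "j < n"
  shows "(Matrix.mat n n (\<lambda>(i, j). K i j) ^\<^sub>m k) $$ (i, j) = ker_pow {..<n} K k i j"
  using assms(2)
proof (induction k arbitrary: j)
  case 0
  then show ?case using assms(1) by simp
next
  case (Suc k)
  let ?A = "Matrix.mat n n (\<lambda>(i, j). K i j)"
  have "?A ^\<^sub>m k \<in> carrier_mat n n" by (intro pow_carrier_mat) simp
  then have "(?A ^\<^sub>m Suc k) $$ (i, j) = (\<Sum>w<n. (?A ^\<^sub>m k) $$ (i, w) * K w j)"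
    using assms(1) Suc.prems by (auto simp: scalar_prod_def lessThan_atLeast0 intro!: sum.cong)
  also have "\<dots> = (\<Sum>w<n. ker_pow {..<n} K k i w * K w j)"
    using Suc.IH by simp
  finally show ?case by simp
qed

lemma trace_mat_pow_eq_ker_trace:
  "trace_mat (Matrix.mat n n (\<lambda>(i, j). K i j) ^\<^sub>m k) = ker_trace {..<n} K k"
proof -
  have "Matrix.mat n n (\<lambda>(i, j). K i j) ^\<^sub>m k \<in> carrier_mat n n" by (intro pow_carrier_mat) simp
  then show ?thesis by (auto simp: trace_mat_def ker_trace_def mat_pow_eq_ker_pow)
qed

text \<open>The largest absolute column sum is a submultiplicative matrix norm.\<close>

lemma ker_pow_column_bound:
  fixes K :: "'v \<Rightarrow> 'v \<Rightarrow> real"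
  assumes "finite V" and col: "\<And>v. v \<in> V \<Longrightarrow> (\<Sum>u\<in>V. \<bar>K u v\<bar>) \<le> R" and "v \<in> V"
  shows "(\<Sum>u\<in>V. \<bar>ker_pow V K k u v\<bar>) \<le> R ^ k"
  using assms(3)
proof (induction k arbitrary: v)
  case 0
  have "(\<Sum>u\<in>V. \<bar>of_bool (u = v)\<bar>) = (\<Sum>u\<in>V. if u = v then 1 else 0 :: real)"
    by (intro sum.cong) auto
  also have "\<dots> \<le> 1" using assms(1) by (simp add: sum.delta)
  finally show ?case by simp
next
  case (Suc k)
  have "0 \<le> (\<Sum>u\<in>V. \<bar>K u v\<bar>)" by (intro sum_nonneg) simp
  with col[OF Suc.prems] have R: "0 \<le> R" by linarith
  have "(\<Sum>u\<in>V. \<bar>ker_pow V K (Suc k) u v\<bar>) \<le> (\<Sum>u\<in>V. \<Sum>w\<in>V. \<bar>ker_pow V K k u w\<bar> * \<bar>K w v\<bar>)"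
    by (intro sum_mono) (auto simp: abs_mult[symmetric])
  also have "\<dots> = (\<Sum>w\<in>V. (\<Sum>u\<in>V. \<bar>ker_pow V K k u w\<bar>) * \<bar>K w v\<bar>)"
    by (subst sum.swap) (simp add: sum_distrib_right)
  also have "\<dots> \<le> (\<Sum>w\<in>V. R ^ k * \<bar>K w v\<bar>)"
    by (intro sum_mono mult_right_mono Suc.IH) auto
  also have "\<dots> = R ^ k * (\<Sum>w\<in>V. \<bar>K w v\<bar>)" by (simp add: sum_distrib_left)
  also have "\<dots> \<le> R ^ k * R" using R by (intro mult_left_mono col Suc.prems) auto
  finally show ?case by (simp add: mult.commute)
qed

text \<open>Induction along \<open>K^(k+1) - K'^(k+1) = (K^k - K'^k) K + K'^k (K - K')\<close> in
  the entrywise sum norm: the row sums of \<open>K\<close> control multiplication from the right,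
  the column sums of powers of \<open>K'\<close> multiplication from the left. The number of
  vertices does not enter, only the total change \<open>S\<close>.\<close>

lemma ker_pow_diff_bound:
  fixes K K' :: "'v \<Rightarrow> 'v \<Rightarrow> real"
  assumes "finite V" "0 \<le> R"
    and row: "\<And>u. u \<in> V \<Longrightarrow> (\<Sum>v\<in>V. \<bar>K u v\<bar>) \<le> R"
    and col: "\<And>v. v \<in> V \<Longrightarrow> (\<Sum>u\<in>V. \<bar>K' u v\<bar>) \<le> R"
  defines "S \<equiv> \<Sum>u\<in>V. \<Sum>v\<in>V. \<bar>K u v - K' u v\<bar>"
  shows "(\<Sum>u\<in>V. \<Sum>v\<in>V. \<bar>ker_pow V K k u v - ker_pow V K' k u v\<bar>) \<le> real k * R ^ (k - 1) * S"
proof (induction k)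
  case (Suc k)
  have S0: "0 \<le> S" unfolding S_def by (intro sum_nonneg) auto
  define X where "X u v = ker_pow V K k u v - ker_pow V K' k u v" for u v
  define Y where "Y = ker_pow V K' k"
  define D where "D u v = K u v - K' u v" for u v
  have "ker_pow V K (Suc k) u v - ker_pow V K' (Suc k) u v
      = (\<Sum>w\<in>V. X u w * K w v) + (\<Sum>w\<in>V. Y u w * D w v)" for u v
    by (simp add: X_def Y_def D_def sum_subtractf[symmetric] sum.distrib[symmetric] algebra_simps)
  then have "(\<Sum>u\<in>V. \<Sum>v\<in>V. \<bar>ker_pow V K (Suc k) u v - ker_pow V K' (Suc k) u v\<bar>)
      \<le> (\<Sum>u\<in>V. \<Sum>v\<in>V. (\<Sum>w\<in>V. \<bar>X u w\<bar> * \<bar>K w v\<bar>) + (\<Sum>w\<in>V. \<bar>Y u w\<bar> * \<bar>D w v\<bar>))"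
    by (intro sum_mono) (auto simp: abs_mult[symmetric] intro!: order_trans[OF abs_triangle_ineq] add_mono)
  also have "\<dots> = (\<Sum>u\<in>V. \<Sum>v\<in>V. \<Sum>w\<in>V. \<bar>X u w\<bar> * \<bar>K w v\<bar>) + (\<Sum>u\<in>V. \<Sum>v\<in>V. \<Sum>w\<in>V. \<bar>Y u w\<bar> * \<bar>D w v\<bar>)"
    by (simp add: sum.distrib)
  also have "(\<Sum>u\<in>V. \<Sum>v\<in>V. \<Sum>w\<in>V. \<bar>X u w\<bar> * \<bar>K w v\<bar>) = (\<Sum>u\<in>V. \<Sum>w\<in>V. \<bar>X u w\<bar> * (\<Sum>v\<in>V. \<bar>K w v\<bar>))"
    by (rule sum.cong[OF refl], subst sum.swap, simp add: sum_distrib_left)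
  also have "\<dots> \<le> (\<Sum>u\<in>V. \<Sum>w\<in>V. \<bar>X u w\<bar> * R)"
    by (intro sum_mono mult_left_mono row) auto
  also have "\<dots> = (\<Sum>u\<in>V. \<Sum>w\<in>V. \<bar>X u w\<bar>) * R"
    by (simp add: sum_distrib_right)
  also have "\<dots> \<le> (real k * R ^ (k - 1) * S) * R"
    using Suc.IH assms(2) by (intro mult_right_mono) (simp_all add: X_def)
  \<comment> \<open>The exponent \<open>k - 1\<close> is truncated; for \<open>k = 0\<close> both
    sides vanish through the factor \<open>real k\<close>.\<close>
  also have "\<dots> = real k * R ^ k * S"
    by (cases k) auto
  also have "(\<Sum>u\<in>V. \<Sum>v\<in>V. \<Sum>w\<in>V. \<bar>Y u w\<bar> * \<bar>D w v\<bar>) = (\<Sum>u\<in>V. \<Sum>w\<in>V. \<Sum>v\<in>V. \<bar>Y u w\<bar> * \<bar>D w v\<bar>)"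
    by (rule sum.cong[OF refl], rule sum.swap)
  also have "\<dots> = (\<Sum>w\<in>V. (\<Sum>u\<in>V. \<bar>Y u w\<bar>) * (\<Sum>v\<in>V. \<bar>D w v\<bar>))"
    by (subst sum.swap) (simp add: sum_product)
  also have "\<dots> \<le> (\<Sum>w\<in>V. R ^ k * (\<Sum>v\<in>V. \<bar>D w v\<bar>))"
    unfolding Y_def by (intro sum_mono mult_right_mono ker_pow_column_bound assms sum_nonneg) auto
  also have "\<dots> = R ^ k * S" by (simp add: S_def D_def sum_distrib_left)
  finally show ?case by (simp add: algebra_simps)
qed simp

lemma ker_trace_diff_bound:
  fixes K K' :: "'v \<Rightarrow> 'v \<Rightarrow> real"
  assumes "finite V" "0 \<le> R"
    and "\<And>u. u \<in> V \<Longrightarrow> (\<Sum>v\<in>V. \<bar>K u v\<bar>) \<le> R"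
    and "\<And>v. v \<in> V \<Longrightarrow> (\<Sum>u\<in>V. \<bar>K' u v\<bar>) \<le> R"
  shows "\<bar>ker_trace V K k - ker_trace V K' k\<bar>
    \<le> real k * R ^ (k - 1) * (\<Sum>u\<in>V. \<Sum>v\<in>V. \<bar>K u v - K' u v\<bar>)"
proof -
  have "\<bar>ker_trace V K k - ker_trace V K' k\<bar> \<le> (\<Sum>v\<in>V. \<bar>ker_pow V K k v v - ker_pow V K' k v v\<bar>)"
    by (simp add: ker_trace_def sum_subtractf[symmetric])
  also have "\<dots> \<le> (\<Sum>u\<in>V. \<Sum>v\<in>V. \<bar>ker_pow V K k u v - ker_pow V K' k u v\<bar>)"
    using assms(1) by (intro sum_mono) (auto intro!: member_le_sum)
  finally show ?thesis using ker_pow_diff_bound[where V = V and K = K and K' = K' and R = R and k = k, OF assms] by linarith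
qed

section \<open>Discrete Fourier transform of shift invariant kernels\<close>

text \<open>Orthogonality of the characters of the cyclic group of order \<open>N\<close>.\<close>

lemma sum_cis_roots:
  assumes "j < N" "l < N"
  shows "(\<Sum>q<N. cis (2 * pi * real q / real N * (real l - real j))) = of_nat N * of_bool (j = l)"
proof (cases "j = l")
  case False
  define z where "z = cis (2 * pi * (real l - real j) / real N)"
  have N: "N > 0" using assms by simp
  have pw: "cis (2 * pi * real q / real N * (real l - real j)) = z ^ q" for q
    by (simp add: z_def DeMoivre field_simps)
  \<comment> \<open>The ratio of the geometric sum is \<open>1\<close> only if \<open>N\<close>
    divides \<open>l - j\<close>, which is excluded by
    \<open>0 < \<bar>l - j\<bar> < N\<close>.\<close>
  have "z \<noteq> 1"
  proof
    assume "z = 1"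
    then have "cos (2 * pi * (real l - real j) / real N) = 1"
      by (simp add: z_def complex_eq_iff)
    then obtain x :: int where "2 * pi * (real l - real j) / real N = real_of_int x * 2 * pi"
      by (auto simp: cos_one_2pi_int)
    then have "(2 * pi) * (real l - real j) = (2 * pi) * (real_of_int x * real N)"
      using N by (simp add: field_simps)
    then have "real l - real j = real_of_int x * real N"
      by (simp only: mult_cancel_left) simp
    then have "int l - int j = x * int N"
    proof -
      have "real_of_int (int l - int j) = real_of_int (x * int N)"
        using \<open>real l - real j = real_of_int x * real N\<close> by simp
      then show ?thesis by (simp only: of_int_eq_iff)
    qed
    then have "int N dvd int l - int j" by simp
    moreover have "\<bar>int l - int j\<bar> < int N" "int l - int j \<noteq> 0" using assms False by auto
    ultimately show False
      using zdvd_not_zless[of "\<bar>int l - int j\<bar>" "int N"] by auto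
  qed
  moreover have "z ^ N = 1"
  proof -
    have "z ^ N = cis (2 * pi * real_of_int (int l - int j))"
      using N by (simp add: z_def DeMoivre)
    also have "\<dots> = 1" by (rule cis_multiple_2pi) simp
    finally show ?thesis .
  qed
  ultimately show ?thesis unfolding pw using False by (simp add: geometric_sum)
qed simp

lemma bij_betw_Suc_mod: "N > 0 \<Longrightarrow> bij_betw (\<lambda>j. Suc j mod N) {..<N} {..<N}"
proof -
  assume N: "N > 0"
  have "inj_on (\<lambda>j. Suc j mod N) {..<N}"
    by (auto simp: inj_on_def mod_Suc split: if_splits)
  moreover have "(\<lambda>j. Suc j mod N) ` {..<N} \<subseteq> {..<N}" using N by auto
  ultimately show ?thesis
    by (metis bij_betw_def endo_inj_surj finite_lessThan)
qed

text \<open>Wrapping around changes the angle by an integral multiple of \<open>2 * pi\<close>, so a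
  shift of the argument multiplies the character by a constant even across the boundary. The offset
  \<open>c\<close> is the starting layer in later uses.\<close>

lemma cis_Suc_mod:
  assumes "N > 0"
  shows "cis (2 * pi * real q / real N * (real (Suc j mod N) - c))
       = cis (2 * pi * real q / real N * (real j - c)) * cis (2 * pi * real q / real N)"
proof -
  have N0: "real N \<noteq> 0" using assms by simp
  have "real (Suc j mod N + N * (Suc j div N)) = real (Suc j)"
    by (simp only: mod_mult_div_eq)
  then have j: "real j = real (Suc j mod N) + real N * real (Suc j div N) - 1"
    by (simp only: of_nat_add of_nat_mult of_nat_Suc)
  have gen: "2 * pi * Q / M * ((r + M * s - 1) - c) + 2 * pi * Q / M = 2 * pi * Q / M * (r - c) + 2 * pi * (Q * s)"
    if "M \<noteq> 0" for Q M r s :: real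
    using that by (simp add: field_simps)
  have "2 * pi * real q / real N * (real j - c) + 2 * pi * real q / real N
      = 2 * pi * real q / real N * (real (Suc j mod N) - c) + 2 * pi * real_of_int (int (q * (Suc j div N)))"
    unfolding j gen[OF N0] by simp
  then have "cis (2 * pi * real q / real N * (real j - c)) * cis (2 * pi * real q / real N)
      = cis (2 * pi * real q / real N * (real (Suc j mod N) - c)) * cis (2 * pi * real_of_int (int (q * (Suc j div N))))"
    by (simp only: cis_mult)
  also have "cis (2 * pi * real_of_int (int (q * (Suc j div N)))) = 1"
    by (rule cis_multiple_2pi) simp
  finally show ?thesis by simp
qed

text \<open>A block circulant matrix: \<open>N\<close> layers indexed cyclically, each a copy of the
  fiber, with \<open>B0\<close> acting inside a layer, \<open>B1\<close> to the next and
  \<open>B2\<close> to the previous one. For small \<open>N\<close> these layers may coincide, and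
  then the contributions add up.\<close>

definition shift_kernel ::
  "nat \<Rightarrow> ('f \<Rightarrow> 'f \<Rightarrow> 'a::comm_ring_1) \<Rightarrow> ('f \<Rightarrow> 'f \<Rightarrow> 'a) \<Rightarrow> ('f \<Rightarrow> 'f \<Rightarrow> 'a) \<Rightarrow> 'f \<times> nat \<Rightarrow> 'f \<times> nat \<Rightarrow> 'a" where
  "shift_kernel N B0 B1 B2 u v =
     B0 (fst u) (fst v) * of_bool (snd v = snd u) +
     B1 (fst u) (fst v) * of_bool (snd v = Suc (snd u) mod N) +
     B2 (fst u) (fst v) * of_bool (snd u = Suc (snd v) mod N)"

text \<open>The diagonal block at frequency \<open>\<theta>\<close>. The factor of \<open>B1\<close>
  is \<open>cis (- \<theta>)\<close> because characters are multiplied from the left: an entry into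
  layer \<open>l\<close> comes from layer \<open>l - 1\<close>.\<close>

definition symbol_kernel ::
  "('f \<Rightarrow> 'f \<Rightarrow> complex) \<Rightarrow> ('f \<Rightarrow> 'f \<Rightarrow> complex) \<Rightarrow> ('f \<Rightarrow> 'f \<Rightarrow> complex) \<Rightarrow> real \<Rightarrow> 'f \<Rightarrow> 'f \<Rightarrow> complex" where
  "symbol_kernel B0 B1 B2 \<theta> f g = B0 f g + B1 f g * cis (- \<theta>) + B2 f g * cis \<theta>"

text \<open>Multiplication by a block circulant matrix maps a vector on the fiber times a character
  to another one with the same character, so each frequency evolves separately.\<close>

lemma sum_shift_kernel_character:
  assumes "finite F" "N > 0" "l < N"
  shows "(\<Sum>w\<in>F \<times> {..<N}. (a (fst w) * cis (2 * pi * real q / real N * (real (snd w) - c))) *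
              shift_kernel N B0 B1 B2 w (g, l))
       = (\<Sum>f\<in>F. a f * symbol_kernel B0 B1 B2 (2 * pi * real q / real N) f g) *
           cis (2 * pi * real q / real N * (real l - c))"
proof -
  define e where "e j = cis (2 * pi * real q / real N * (real j - c))" for j :: nat
  define \<theta> where "\<theta> = 2 * pi * real q / real N"
  have suc: "e (Suc j mod N) = e j * cis \<theta>" for j
    unfolding e_def \<theta>_def by (rule cis_Suc_mod[OF assms(2)])
  have suc': "e j = e (Suc j mod N) * cis (- \<theta>)" for j
    unfolding suc by (simp add: mult.assoc cis_mult)
  have s0: "(\<Sum>j<N. e j * of_bool (l = j)) = e l"
    using assms(3) by (simp add: of_bool_def if_distrib if_distribR sum.delta' cong: if_cong)
  have s1: "(\<Sum>j<N. e j * of_bool (l = Suc j mod N)) = e l * cis (- \<theta>)"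
  proof -
    have "(\<Sum>j<N. e j * of_bool (l = Suc j mod N))
        = (\<Sum>j<N. (e (Suc j mod N) * cis (- \<theta>)) * of_bool (l = Suc j mod N))"
      by (intro sum.cong refl arg_cong2[where f = "(*)"] suc')
    also have "\<dots> = (\<Sum>j<N. (e j * cis (- \<theta>)) * of_bool (l = j))"
      by (rule sum.reindex_bij_betw[OF bij_betw_Suc_mod[OF assms(2)]])
    also have "\<dots> = (\<Sum>j<N. e j * of_bool (l = j)) * cis (- \<theta>)"
      unfolding sum_distrib_right by (intro sum.cong refl) (simp add: mult_ac)
    finally show ?thesis by (simp only: s0)
  qed
  have s2: "(\<Sum>j<N. e j * of_bool (j = Suc l mod N)) = e l * cis \<theta>"
  proof -
    have "(\<Sum>j<N. e j * of_bool (j = Suc l mod N)) = e (Suc l mod N)"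
      using assms(2) by (simp add: of_bool_def if_distrib if_distribR sum.delta cong: if_cong)
    then show ?thesis by (simp add: suc)
  qed
  have "(\<Sum>w\<in>F \<times> {..<N}. (a (fst w) * e (snd w)) * shift_kernel N B0 B1 B2 w (g, l))
      = (\<Sum>f\<in>F. \<Sum>j<N. (a f * e j) * shift_kernel N B0 B1 B2 (f, j) (g, l))"
    by (simp add: sum.cartesian_product case_prod_unfold)
  also have "\<dots> = (\<Sum>f\<in>F. a f * (B0 f g * (\<Sum>j<N. e j * of_bool (l = j)) +
      B1 f g * (\<Sum>j<N. e j * of_bool (l = Suc j mod N)) + B2 f g * (\<Sum>j<N. e j * of_bool (j = Suc l mod N))))"
    by (rule sum.cong[OF refl])
      (simp only: shift_kernel_def fst_conv snd_conv ring_distribs sum.distrib sum_distrib_left mult_ac)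
  also have "\<dots> = (\<Sum>f\<in>F. a f * symbol_kernel B0 B1 B2 \<theta> f g) * e l"
    unfolding s0 s1 s2 sum_distrib_right
    by (intro sum.cong refl) (simp add: symbol_kernel_def algebra_simps)
  finally show ?thesis by (simp add: e_def \<theta>_def)
qed

text \<open>Fourier inversion for the matrix power. The identity matrix is the orthogonality
  relation, and each further factor acts on every frequency through its symbol.\<close>

lemma ker_pow_shift_kernel:
  assumes "finite F" "N > 0" "j < N" "l < N" "f \<in> F" "g \<in> F"
  shows "ker_pow (F \<times> {..<N}) (shift_kernel N B0 B1 B2) k (f, j) (g, l)
       = (\<Sum>q<N. ker_pow F (symbol_kernel B0 B1 B2 (2 * pi * real q / real N)) k f g *
            cis (2 * pi * real q / real N * (real l - real j))) / of_nat N"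
  using assms(4,6)
proof (induction k arbitrary: g l)
  case 0
  have eq: "(\<Sum>q<N. of_bool (f = g) * cis (2 * pi * real q / real N * (real l - real j)))
      = of_bool (f = g) * (of_nat N * of_bool (j = l))"
    by (simp only: sum_distrib_left[symmetric] sum_cis_roots[OF assms(3) 0(1)])
  show ?case
    unfolding ker_pow.simps eq using assms(2) by auto
next
  case (Suc k)
  define P where "P q = ker_pow F (symbol_kernel B0 B1 B2 (2 * pi * real q / real N)) k f" for q
  define e where "e q i = cis (2 * pi * real q / real N * (real i - real j))" for q i :: nat
  define S where "S = shift_kernel N B0 B1 B2"
  have "ker_pow (F \<times> {..<N}) S (Suc k) (f, j) (g, l)
      = (\<Sum>w\<in>F \<times> {..<N}. ((\<Sum>q<N. P q (fst w) * e q (snd w)) / of_nat N) * S w (g, l))"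
    unfolding ker_pow.simps
    by (intro sum.cong refl arg_cong2[where f = "(*)"]) (auto simp: S_def Suc.IH P_def e_def)
  also have "\<dots> = (\<Sum>w\<in>F \<times> {..<N}. \<Sum>q<N. (P q (fst w) * e q (snd w)) * S w (g, l)) / of_nat N"
    by (simp add: sum_distrib_right sum_divide_distrib)
  also have "\<dots> = (\<Sum>q<N. \<Sum>w\<in>F \<times> {..<N}. (P q (fst w) * e q (snd w)) * S w (g, l)) / of_nat N"
    by (subst sum.swap) simp
  also have "\<dots> = (\<Sum>q<N. (\<Sum>h\<in>F. P q h * symbol_kernel B0 B1 B2 (2 * pi * real q / real N) h g) * e q l) / of_nat N"
    unfolding e_def S_def sum_shift_kernel_character[OF assms(1,2) Suc.prems(1)] ..
  finally show ?case by (simp add: P_def e_def S_def)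
qed

text \<open>On the diagonal all characters in the inversion formula equal \<open>1\<close>, and
  summing over the \<open>N\<close> layers cancels the factor \<open>1 / N\<close>.\<close>

theorem ker_trace_shift_kernel:
  assumes "finite F" "N > 0"
  shows "ker_trace (F \<times> {..<N}) (shift_kernel N B0 B1 B2) k
       = (\<Sum>q<N. ker_trace F (symbol_kernel B0 B1 B2 (2 * pi * real q / real N)) k)"
proof -
  have "ker_trace (F \<times> {..<N}) (shift_kernel N B0 B1 B2) k
      = (\<Sum>(f, j)\<in>F \<times> {..<N}. (\<Sum>q<N. ker_pow F (symbol_kernel B0 B1 B2 (2 * pi * real q / real N)) k f f) / of_nat N)"
    unfolding ker_trace_def by (intro sum.cong refl) (auto simp: ker_pow_shift_kernel assms)
  also have "\<dots> = (\<Sum>f\<in>F. \<Sum>q<N. ker_pow F (symbol_kernel B0 B1 B2 (2 * pi * real q / real N)) k f f)"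
    using assms by (simp add: sum.cartesian_product[symmetric])
  also have "\<dots> = (\<Sum>q<N. ker_trace F (symbol_kernel B0 B1 B2 (2 * pi * real q / real N)) k)"
    unfolding ker_trace_def by (rule sum.swap)
  finally show ?thesis .
qed

section \<open>Riemann sums and moments\<close>

text \<open>The error is measured by the oscillation of \<open>h\<close> over one mesh width. This
  form is uniform over a family of functions with a common modulus of continuity, which is what the
  two-dimensional version relies on.\<close>

lemma riemann_average_bound:
  fixes h :: "real \<Rightarrow> real"
  assumes cont: "continuous_on {0..2 * pi} h" and N: "N > 0"
    and osc: "\<And>x y. x \<in> {0..2 * pi} \<Longrightarrow> y \<in> {0..2 * pi} \<Longrightarrow> \<bar>x - y\<bar> \<le> 2 * pi / real N \<Longrightarrow> \<bar>h x - h y\<bar> \<le> e"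
  shows "\<bar>(\<Sum>q<N. h (2 * pi * real q / real N)) / real N - integral {0..2 * pi} h / (2 * pi)\<bar> \<le> e"
proof -
  define t where "t q = 2 * pi * real q / real N" for q
  have t0: "t 0 = 0" and tN: "t N = 2 * pi" using N by (auto simp: t_def)
  have tmono: "t p \<le> t q" if "p \<le> q" for p q
    using that by (auto simp: t_def intro!: divide_right_mono mult_left_mono)
  have step: "t (Suc q) - t q = 2 * pi / real N" for q
    by (simp add: t_def add_divide_distrib ring_distribs)
  have sub: "{t p..t q} \<subseteq> {0..2 * pi}" if "q \<le> N" for p q
    using tmono[of 0 p] tmono[OF that] t0 tN by auto
  have int: "h integrable_on {t p..t q}" if "q \<le> N" for p q
    by (intro integrable_continuous_real continuous_on_subset[OF cont] sub that)
  have split: "integral {0..t q} h = (\<Sum>i<q. integral {t i..t (Suc i)} h)" if "q \<le> N" for q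
    using that
  proof (induction q)
    case 0
    then show ?case by (simp add: t0)
  next
    case (Suc q)
    have "integral {0..t (Suc q)} h = integral {0..t q} h + integral {t q..t (Suc q)} h"
      using tmono[of 0 q] tmono[of q "Suc q"] int[of "Suc q" 0] Suc.prems
      by (intro Henstock_Kurzweil_Integration.integral_combine[symmetric]) (auto simp: t0)
    with Suc show ?case by simp
  qed
  have piece: "\<bar>integral {t i..t (Suc i)} h - 2 * pi / real N * h (t i)\<bar> \<le> e * (2 * pi / real N)" if "i < N" for i
  proof -
    have le: "t i \<le> t (Suc i)" by (intro tmono) simp
    have "((\<lambda>x. h x - h (t i)) has_integral
        (integral {t i..t (Suc i)} h - (t (Suc i) - t i) *\<^sub>R h (t i))) {t i..t (Suc i)}"
      using that le int[of "Suc i" i] has_integral_const_real[of "h (t i)" "t i" "t (Suc i)"]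
      by (intro has_integral_diff integrable_integral) auto
    moreover have "\<bar>h x - h (t i)\<bar> \<le> e" if x: "x \<in> {t i..t (Suc i)}" for x
    proof (rule osc)
      show "x \<in> {0..2 * pi}" using sub[of "Suc i" i] \<open>i < N\<close> x by auto
      show "t i \<in> {0..2 * pi}" using sub[of i i] \<open>i < N\<close> by auto
      show "\<bar>x - t i\<bar> \<le> 2 * pi / real N" using x step[of i] by auto
    qed
    moreover have "0 \<le> e" using osc[of 0 0] N by simp
    ultimately have "norm (integral {t i..t (Suc i)} h - (t (Suc i) - t i) *\<^sub>R h (t i)) \<le> e * measure lborel {t i..t (Suc i)}"
      by (intro has_integral_bound_real[where f = "\<lambda>x. h x - h (t i)" and S = "{}"]) auto
    then show ?thesis using le step[of i] by simp
  qed
  have "integral {0..2 * pi} h = (\<Sum>i<N. integral {t i..t (Suc i)} h)"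
    using split[of N] by (simp add: tN)
  then have "\<bar>integral {0..2 * pi} h - 2 * pi / real N * (\<Sum>i<N. h (t i))\<bar>
      = \<bar>\<Sum>i<N. integral {t i..t (Suc i)} h - 2 * pi / real N * h (t i)\<bar>"
    by (simp add: sum_subtractf sum_distrib_left)
  also have "\<dots> \<le> (\<Sum>i<N. e * (2 * pi / real N))"
    by (intro order_trans[OF sum_abs] sum_mono piece) auto
  also have "\<dots> = 2 * pi * e" using N by simp
  finally have "\<bar>integral {0..2 * pi} h - 2 * pi / real N * (\<Sum>i<N. h (t i))\<bar> / (2 * pi) \<le> e"
    by (simp add: divide_le_eq mult.commute)
  moreover have "\<bar>integral {0..2 * pi} h - 2 * pi / real N * (\<Sum>i<N. h (t i))\<bar> / (2 * pi)
      = \<bar>integral {0..2 * pi} h / (2 * pi) - (\<Sum>i<N. h (t i)) / real N\<bar>"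
    by (subst abs_div_pos) (auto simp: diff_divide_distrib)
  ultimately show ?thesis by (simp add: t_def abs_minus_commute)
qed

lemma riemann_average_tendsto:
  fixes h :: "real \<Rightarrow> real"
  assumes "continuous_on {0..2 * pi} h"
  shows "(\<lambda>n. (\<Sum>q<Suc n. h (2 * pi * real q / real (Suc n))) / real (Suc n))
    \<longlonglongrightarrow> integral {0..2 * pi} h / (2 * pi)"
proof (rule tendstoI)
  fix e :: real assume "e > 0"
  have "uniformly_continuous_on {0..2 * pi} h"
    by (intro compact_uniformly_continuous assms) simp
  then obtain d where d: "d > 0" "\<And>x y. x \<in> {0..2 * pi} \<Longrightarrow> y \<in> {0..2 * pi} \<Longrightarrow> \<bar>x - y\<bar> < d \<Longrightarrow> \<bar>h x - h y\<bar> < e / 2"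
    using \<open>e > 0\<close> unfolding uniformly_continuous_on_def dist_real_def
    by (metis abs_minus_commute half_gt_zero)
  have "(\<lambda>n. 2 * pi / real (Suc n)) \<longlonglongrightarrow> 0"
    by (intro LIMSEQ_Suc lim_const_over_n)
  then have "\<forall>\<^sub>F n in sequentially. 2 * pi / real (Suc n) < d"
    using d(1) by (rule order_tendstoD)
  then show "\<forall>\<^sub>F n in sequentially. dist ((\<Sum>q<Suc n. h (2 * pi * real q / real (Suc n))) / real (Suc n))
      (integral {0..2 * pi} h / (2 * pi)) < e"
  proof eventually_elim
    case (elim n)
    have "\<bar>(\<Sum>q<Suc n. h (2 * pi * real q / real (Suc n))) / real (Suc n) - integral {0..2 * pi} h / (2 * pi)\<bar> \<le> e / 2"
      by (rule riemann_average_bound[OF assms]) (use d(2) elim in force)+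
    then show ?case using \<open>e > 0\<close> unfolding dist_real_def by linarith
  qed
qed

lemma continuous_on_integral_fst:
  fixes h :: "real \<times> real \<Rightarrow> real"
  assumes "continuous_on ({0..2 * pi} \<times> {0..2 * pi}) h"
  shows "continuous_on {0..2 * pi} (\<lambda>y. integral {0..2 * pi} (\<lambda>x. h (x, y)))"
proof -
  have "continuous_on ({0..2 * pi} \<times> cbox 0 (2 * pi)) (\<lambda>(y, x). h (x, y))"
    unfolding case_prod_unfold
    by (rule continuous_on_compose2[OF assms]) (auto intro!: continuous_intros)
  from integral_continuous_on_param[OF this] show ?thesis by simp
qed

text \<open>Uniform continuity on the square lets the averages over \<open>x\<close> be replaced by
  the integrals \<open>H y\<close> with an error independent of \<open>y\<close>. What remains is a
  one-dimensional average depending on \<open>n\<close> only, so \<open>m\<close> and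
  \<open>n\<close> may grow independently of each other.\<close>

lemma riemann_average2_tendsto:
  fixes h :: "real \<times> real \<Rightarrow> real"
  assumes cont: "continuous_on ({0..2 * pi} \<times> {0..2 * pi}) h"
  shows "((\<lambda>(m, n). (\<Sum>q<Suc n. \<Sum>p<Suc m. h (2 * pi * real p / real (Suc m), 2 * pi * real q / real (Suc n)))
           / (real (Suc m) * real (Suc n)))
    \<longlongrightarrow> integral {0..2 * pi} (\<lambda>y. integral {0..2 * pi} (\<lambda>x. h (x, y))) / (4 * pi\<^sup>2))
    (sequentially \<times>\<^sub>F sequentially)"
proof (rule tendstoI)
  fix e :: real assume "e > 0"
  define H where "H y = integral {0..2 * pi} (\<lambda>x. h (x, y)) / (2 * pi)" for y
  have contx: "continuous_on {0..2 * pi} (\<lambda>x. h (x, y))" if "y \<in> {0..2 * pi}" for y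
    by (rule continuous_on_compose2[OF cont]) (use that in \<open>auto intro!: continuous_intros\<close>)
  have contH: "continuous_on {0..2 * pi} H"
    unfolding H_def by (intro continuous_intros continuous_on_integral_fst cont) simp
  have "uniformly_continuous_on ({0..2 * pi} \<times> {0..2 * pi}) h"
    by (intro compact_uniformly_continuous cont compact_Times) simp_all
  then obtain d where d: "d > 0" "\<And>u v. u \<in> {0..2 * pi} \<times> {0..2 * pi} \<Longrightarrow> v \<in> {0..2 * pi} \<times> {0..2 * pi} \<Longrightarrow>
      dist u v < d \<Longrightarrow> dist (h u) (h v) < e / 3"
    using \<open>e > 0\<close> unfolding uniformly_continuous_on_def
    by (metis dist_commute divide_pos_pos zero_less_numeral)
  have "(\<lambda>n. 2 * pi / real (Suc n)) \<longlonglongrightarrow> 0"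
    by (intro LIMSEQ_Suc lim_const_over_n)
  then have E1: "\<forall>\<^sub>F m in sequentially. 2 * pi / real (Suc m) < d"
    using d(1) by (rule order_tendstoD)
  have "\<forall>\<^sub>F n in sequentially. dist ((\<Sum>q<Suc n. H (2 * pi * real q / real (Suc n))) / real (Suc n))
      (integral {0..2 * pi} H / (2 * pi)) < e / 3"
    using riemann_average_tendsto[OF contH] \<open>e > 0\<close> by (intro tendstoD) auto
  with E1 have "\<forall>\<^sub>F mn in sequentially \<times>\<^sub>F sequentially. 2 * pi / real (Suc (fst mn)) < d \<and>
     dist ((\<Sum>q<Suc (snd mn). H (2 * pi * real q / real (Suc (snd mn)))) / real (Suc (snd mn)))
      (integral {0..2 * pi} H / (2 * pi)) < e / 3"
    by (rule eventually_prodI)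
  then show "\<forall>\<^sub>F mn in sequentially \<times>\<^sub>F sequentially. dist (case mn of (m, n) \<Rightarrow>
      (\<Sum>q<Suc n. \<Sum>p<Suc m. h (2 * pi * real p / real (Suc m), 2 * pi * real q / real (Suc n)))
           / (real (Suc m) * real (Suc n)))
     (integral {0..2 * pi} (\<lambda>y. integral {0..2 * pi} (\<lambda>x. h (x, y))) / (4 * pi\<^sup>2)) < e"
  proof eventually_elim
    case (elim mn)
    obtain m n where mn: "mn = (m, n)" by force
    define y where "y q = 2 * pi * real q / real (Suc n)" for q
    define A where "A q = (\<Sum>p<Suc m. h (2 * pi * real p / real (Suc m), y q)) / real (Suc m)" for q
    have "\<bar>A q - H (y q)\<bar> \<le> e / 3" if "q < Suc n" for q
    proof -
      have "2 * pi * (real q / real (Suc n)) \<le> 2 * pi * 1"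
        using that by (intro mult_left_mono) (auto simp: divide_le_eq)
      then have y: "y q \<in> {0..2 * pi}" by (simp add: y_def)
      show ?thesis unfolding A_def H_def
      proof (rule riemann_average_bound[OF contx[OF y]])
        fix u v assume uv: "u \<in> {0..2 * pi}" "v \<in> {0..2 * pi}" "\<bar>u - v\<bar> \<le> 2 * pi / real (Suc m)"
        have "dist (u, y q) (v, y q) < d"
          using uv(3) elim by (simp add: mn dist_Pair_Pair dist_real_def)
        then show "\<bar>h (u, y q) - h (v, y q)\<bar> \<le> e / 3"
          using d(2)[of "(u, y q)" "(v, y q)"] uv(1,2) y by (simp add: dist_real_def)
      qed simp
    qed
    then have "\<bar>\<Sum>q<Suc n. A q - H (y q)\<bar> \<le> (\<Sum>q<Suc n. e / 3)"
      by (intro order_trans[OF sum_abs] sum_mono) auto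
    then have "\<bar>(\<Sum>q<Suc n. A q) - (\<Sum>q<Suc n. H (y q))\<bar> / real (Suc n) \<le> e / 3"
      by (simp only: sum_subtractf) (simp add: divide_le_eq mult.commute del: sum.lessThan_Suc)
    moreover have "\<bar>(\<Sum>q<Suc n. A q) - (\<Sum>q<Suc n. H (y q))\<bar> / real (Suc n)
        = \<bar>(\<Sum>q<Suc n. A q) / real (Suc n) - (\<Sum>q<Suc n. H (y q)) / real (Suc n)\<bar>"
      by (subst abs_div_pos) (auto simp: diff_divide_distrib)
    moreover have "(\<Sum>q<Suc n. A q) / real (Suc n)
        = (\<Sum>q<Suc n. \<Sum>p<Suc m. h (2 * pi * real p / real (Suc m), y q)) / (real (Suc m) * real (Suc n))"
      unfolding A_def sum_divide_distrib[symmetric] by simp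
    moreover have "integral {0..2 * pi} H / (2 * pi)
        = integral {0..2 * pi} (\<lambda>y. integral {0..2 * pi} (\<lambda>x. h (x, y))) / (4 * pi\<^sup>2)"
      unfolding H_def by (simp add: power2_eq_square)
    moreover have "\<bar>(\<Sum>q<Suc n. H (y q)) / real (Suc n) - integral {0..2 * pi} H / (2 * pi)\<bar> < e / 3"
      using elim unfolding mn y_def dist_real_def by simp
    ultimately show ?case
      using \<open>e > 0\<close> unfolding mn dist_real_def y_def[symmetric] prod.case by linarith
  qed
qed

text \<open>A mean value with this property is determined on continuous functions by its moments.\<close>

definition mean_functional :: "real \<Rightarrow> ((real \<Rightarrow> real) \<Rightarrow> real) \<Rightarrow> bool" where
  "mean_functional b E \<longleftrightarrow>
     (\<forall>f g e. continuous_on {0..b} f \<longrightarrow> continuous_on {0..b} g \<longrightarrow>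
        (\<forall>x\<in>{0..b}. \<bar>f x - g x\<bar> \<le> e) \<longrightarrow> \<bar>E f - E g\<bar> \<le> e) \<and>
     (\<forall>a n. E (\<lambda>x. \<Sum>i\<le>n. a i * x ^ i) = (\<Sum>i\<le>n. a i * E (\<lambda>x. x ^ i)))"

text \<open>By Weierstrass, \<open>f\<close> is uniformly close to a polynomial, and both
  functionals follow this up to the same error; on the polynomial they differ by a finite
  combination of moment differences. The filter is arbitrary because the lemma is applied both to
  joint limits and to limits in one variable.\<close>

lemma mean_functionals_tendsto:
  assumes mean: "\<forall>\<^sub>F x in \<Phi>. mean_functional b (E x) \<and> mean_functional b (E' x)"
    and mom: "\<And>k. ((\<lambda>x. E x (\<lambda>t. t ^ k) - E' x (\<lambda>t. t ^ k)) \<longlongrightarrow> 0) \<Phi>"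
    and cont: "continuous_on {0..b} f"
  shows "((\<lambda>x. E x f - E' x f) \<longlongrightarrow> 0) \<Phi>"
proof (rule tendstoI)
  fix e :: real assume "e > 0"
  obtain p where "real_polynomial_function p" and p: "\<And>x. x \<in> {0..b} \<Longrightarrow> \<bar>f x - p x\<bar> < e / 3"
    using Stone_Weierstrass_real_polynomial_function[of "{0..b}" f "e / 3"] cont \<open>e > 0\<close> by auto
  then obtain a n where pn: "p = (\<lambda>x. \<Sum>i\<le>n. a i * x ^ i)"
    by (auto simp: real_polynomial_function_iff_sum)
  have contp: "continuous_on {0..b} p" unfolding pn by (intro continuous_intros)
  have "((\<lambda>x. \<Sum>i\<le>n. a i * (E x (\<lambda>t. t ^ i) - E' x (\<lambda>t. t ^ i))) \<longlongrightarrow> (\<Sum>i\<le>n. a i * 0)) \<Phi>"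
    by (intro tendsto_intros mom)
  then have "\<forall>\<^sub>F x in \<Phi>. dist (\<Sum>i\<le>n. a i * (E x (\<lambda>t. t ^ i) - E' x (\<lambda>t. t ^ i))) (\<Sum>i\<le>n. a i * 0) < e / 3"
    using \<open>e > 0\<close> by (intro tendstoD) auto
  with mean show "\<forall>\<^sub>F x in \<Phi>. dist (E x f - E' x f) 0 < e"
  proof eventually_elim
    case (elim x)
    have close: "\<bar>M f - M p\<bar> \<le> e / 3" if "mean_functional b M" for M
      using that cont contp p less_imp_le unfolding mean_functional_def by blast
    have poly: "M p = (\<Sum>i\<le>n. a i * M (\<lambda>t. t ^ i))" if "mean_functional b M" for M
      using that unfolding mean_functional_def pn by blast
    have "E x p - E' x p = (\<Sum>i\<le>n. a i * (E x (\<lambda>t. t ^ i) - E' x (\<lambda>t. t ^ i)))"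
      using elim by (simp add: poly sum_subtractf right_diff_distrib)
    then have "\<bar>E x p - E' x p\<bar> < e / 3" using elim by (simp add: dist_real_def)
    with close[of "E x"] close[of "E' x"] elim show ?case
      unfolding dist_real_def by linarith
  qed
qed

section \<open>The Laplacian spectrum of a graph\<close>

text \<open>The sequence is compared with itself at two independent indices: a difference tending to
  \<open>0\<close> along the product filter is the Cauchy property. No limiting functional has to be
  exhibited.\<close>

lemma mean_functionals_convergent:
  assumes mean: "\<forall>\<^sub>F n in sequentially. mean_functional b (E n)"
    and mom: "\<And>k. convergent (\<lambda>n. E n (\<lambda>t. t ^ k))"
    and cont: "continuous_on {0..b} f"
  shows "convergent (\<lambda>n. E n f)"
proof -
  have "((\<lambda>p. E (fst p) f - E (snd p) f) \<longlongrightarrow> 0) (sequentially \<times>\<^sub>F sequentially)"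
  proof (rule mean_functionals_tendsto[OF _ _ cont])
    show "\<forall>\<^sub>F p in sequentially \<times>\<^sub>F sequentially. mean_functional b (E (fst p)) \<and> mean_functional b (E (snd p))"
      by (rule eventually_prodI[OF mean mean])
    fix k
    obtain l where l: "(\<lambda>n. E n (\<lambda>t. t ^ k)) \<longlonglongrightarrow> l" using mom[of k] by (auto simp: convergent_def)
    have "((\<lambda>p. E (fst p) (\<lambda>t. t ^ k)) \<longlongrightarrow> l) (sequentially \<times>\<^sub>F sequentially)"
      by (rule filterlim_compose[OF l filterlim_fst])
    moreover have "((\<lambda>p. E (snd p) (\<lambda>t. t ^ k)) \<longlongrightarrow> l) (sequentially \<times>\<^sub>F sequentially)"
      by (rule filterlim_compose[OF l filterlim_snd])
    ultimately show "((\<lambda>p. E (fst p) (\<lambda>t. t ^ k) - E (snd p) (\<lambda>t. t ^ k)) \<longlongrightarrow> 0) (sequentially \<times>\<^sub>F sequentially)"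
      using tendsto_diff by fastforce
  qed
  then have "Cauchy (\<lambda>n. E n f)"
    unfolding Cauchy_def tendsto_iff
    by (auto simp: eventually_prod_sequentially dist_real_def)
      (metis fst_conv snd_conv)
  then show ?thesis by (simp add: Cauchy_convergent_iff)
qed

definition lap_kernel :: "'v sgraph \<Rightarrow> 'v \<Rightarrow> 'v \<Rightarrow> real" where
  "lap_kernel G u v = (if u = v then real (vertex_degree G u) else 0) - of_bool ({u, v} \<in> snd G)"

lemma vertex_list:
  assumes "simple_graph G"
  shows "distinct (vertex_list G)" "set (vertex_list G) = fst G"
proof -
  have "\<exists>vs. distinct vs \<and> set vs = fst G"
    using assms finite_distinct_list[of "fst G"] by (auto simp: simple_graph_def)
  then have "distinct (vertex_list G) \<and> set (vertex_list G) = fst G"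
    unfolding vertex_list_def by (rule someI_ex)
  then show "distinct (vertex_list G)" "set (vertex_list G) = fst G" by auto
qed

lemma vertex_list_bij:
  assumes "simple_graph G"
  shows "bij_betw (\<lambda>k. vertex_list G ! k) {..<card (fst G)} (fst G)"
  using bij_betw_nth[OF vertex_list(1)[OF assms] refl refl] vertex_list[OF assms]
  by (metis distinct_card)

lemma no_loops: "simple_graph G \<Longrightarrow> {u} \<notin> snd G"
  by (auto simp: simple_graph_def)

lemma vertex_degree_eq_sum:
  assumes G: "simple_graph G" and v: "v \<in> fst G"
  shows "real (vertex_degree G v) = (\<Sum>w\<in>fst G. of_bool ({v, w} \<in> snd G))"
proof -
  have fin: "finite (fst G)" using G by (simp add: simple_graph_def)
  have "{e \<in> snd G. v \<in> e} = (\<lambda>w. {v, w}) ` {w \<in> fst G. {v, w} \<in> snd G}"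
    using G by (fastforce simp: simple_graph_def insert_commute)
  moreover have "inj_on (\<lambda>w. {v, w}) {w \<in> fst G. {v, w} \<in> snd G}"
    by (auto simp: inj_on_def doubleton_eq_iff)
  ultimately have "vertex_degree G v = card {w \<in> fst G. {v, w} \<in> snd G}"
    by (simp add: vertex_degree_def card_image)
  then show ?thesis using fin by (simp add: Collect_conj_eq)
qed

lemma laplacian_matrix_eq:
  "laplacian_matrix G = Matrix.mat (card (fst G)) (card (fst G))
     (\<lambda>(k, l). (if k = l then real (vertex_degree G (vertex_list G ! k)) else 0)
        - of_bool ({vertex_list G ! k, vertex_list G ! l} \<in> snd G))"
  by (rule eq_matI) (auto simp: laplacian_matrix_def degree_matrix_def adjacency_matrix_def)

text \<open>Each diagonal entry of the Laplacian equals the absolute sum of the other entries of its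
  row, so every Gershgorin interval starts at \<open>0\<close> and ends at twice a degree. The
  traces are carried from the numbered matrix to the vertex set by the bijection
  \<open>\<phi>\<close>.\<close>

lemma laplacian_spectrum:
  assumes G: "simple_graph G" and deg: "\<And>v. v \<in> fst G \<Longrightarrow> vertex_degree G v \<le> d"
  obtains es where "mset es = proots (char_poly (laplacian_matrix G))" "length es = card (fst G)"
    "set es \<subseteq> {0..2 * real d}" "\<And>k. (\<Sum>e\<leftarrow>es. e ^ k) = ker_trace (fst G) (lap_kernel G) k"
proof -
  define n where "n = card (fst G)"
  define \<phi> where "\<phi> k = vertex_list G ! k" for k
  define K where "K k l = lap_kernel G (\<phi> k) (\<phi> l)" for k l
  have bij: "bij_betw \<phi> {..<n} (fst G)"
    using vertex_list_bij[OF G] unfolding \<phi>_def n_def .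
  have inj: "\<phi> k = \<phi> l \<longleftrightarrow> k = l" if "k < n" "l < n" for k l
    using bij that by (auto simp: bij_betw_def inj_on_def)
  have mem: "\<phi> k \<in> fst G" if "k < n" for k
    using bij that by (auto simp: bij_betw_def)
  have L: "laplacian_matrix G = Matrix.mat n n (\<lambda>(k, l). K k l)"
    by (rule eq_matI) (auto simp: laplacian_matrix_eq n_def[symmetric] K_def lap_kernel_def inj \<phi>_def[symmetric])
  have car: "laplacian_matrix G \<in> carrier_mat n n" by (simp add: L)
  have sym: "laplacian_matrix G $$ (i, j) = laplacian_matrix G $$ (j, i)" if "i < n" "j < n" for i j
    using that by (simp add: L K_def lap_kernel_def insert_commute)
  obtain es where es: "char_poly (laplacian_matrix G) = (\<Prod>a\<leftarrow>es. [:- a, 1:])" "length es = n"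
    using real_symmetric_char_poly_splits[OF car sym] by blast
  have rng: "e \<in> {0..2 * real d}" if "e \<in> set es" for e
  proof -
    have "poly (char_poly (laplacian_matrix G)) e = 0"
      using that unfolding es(1) poly_prod_list prod_list_zero_iff by force
    then have "eigenvalue (laplacian_matrix G) e" by (simp add: eigenvalue_root_char_poly[OF car])
    then obtain i where i: "i < n"
      and gersh: "\<bar>e - laplacian_matrix G $$ (i, i)\<bar> \<le> (\<Sum>j\<in>{..<n} - {i}. \<bar>laplacian_matrix G $$ (i, j)\<bar>)"
      by (rule eigenvalue_gershgorin[OF car])
    have "(\<Sum>j\<in>{..<n} - {i}. \<bar>laplacian_matrix G $$ (i, j)\<bar>)
        = (\<Sum>j\<in>{..<n} - {i}. of_bool ({\<phi> i, \<phi> j} \<in> snd G))"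
      using i by (intro sum.cong) (auto simp: L K_def lap_kernel_def inj)
    also have "\<dots> \<le> (\<Sum>j<n. of_bool ({\<phi> i, \<phi> j} \<in> snd G))"
      by (intro sum_mono2) auto
    also have "\<dots> = real (vertex_degree G (\<phi> i))"
      unfolding vertex_degree_eq_sum[OF G mem[OF i]] by (rule sum.reindex_bij_betw[OF bij])
    finally have "(\<Sum>j\<in>{..<n} - {i}. \<bar>laplacian_matrix G $$ (i, j)\<bar>) \<le> real (vertex_degree G (\<phi> i))" .
    moreover have "laplacian_matrix G $$ (i, i) = real (vertex_degree G (\<phi> i))"
      using i no_loops[OF G] by (simp add: L K_def lap_kernel_def)
    ultimately have "\<bar>e - real (vertex_degree G (\<phi> i))\<bar> \<le> real (vertex_degree G (\<phi> i))"
      using gersh by linarith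
    moreover have "real (vertex_degree G (\<phi> i)) \<le> real d" using deg[OF mem[OF i]] by simp
    ultimately show ?thesis unfolding atLeastAtMost_iff by linarith
  qed
  have "(\<Sum>e\<leftarrow>es. e ^ k) = ker_trace (fst G) (lap_kernel G) k" for k
    unfolding sum_proots_power_eq_trace[OF car es(1)] unfolding L trace_mat_pow_eq_ker_trace
    by (rule ker_trace_bij[OF bij, symmetric]) (simp add: K_def)
  then show ?thesis
    by (intro that[of es]) (use es rng in \<open>auto simp: proots_prod_linear n_def\<close>)
qed

section \<open>Averages over the Laplacian spectrum\<close>

definition spectral_mean :: "'v sgraph \<Rightarrow> (real \<Rightarrow> real) \<Rightarrow> real" where
  "spectral_mean G f = (\<Sum>e\<in>#proots (char_poly (laplacian_matrix G)). f e) / real (card (fst G))"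

lemma spectral_mean_power:
  assumes "simple_graph G"
  shows "spectral_mean G (\<lambda>t. t ^ k) = ker_trace (fst G) (lap_kernel G) k / real (card (fst G))"
proof -
  \<comment> \<open>The trace formula does not involve the degree bound, so the crudest one serves
    to obtain the list of eigenvalues.\<close>
  have "vertex_degree G v \<le> card (fst G)" if "v \<in> fst G" for v
  proof -
    have "real (vertex_degree G v) \<le> (\<Sum>w\<in>fst G. 1)"
      unfolding vertex_degree_eq_sum[OF assms that] by (intro sum_mono) auto
    then show ?thesis by simp
  qed
  then obtain es where "mset es = proots (char_poly (laplacian_matrix G))"
      "(\<Sum>e\<leftarrow>es. e ^ k) = ker_trace (fst G) (lap_kernel G) k"
    using laplacian_spectrum[OF assms] by metis
  then show ?thesis
    unfolding spectral_mean_def by (metis sum_mset_sum_list mset_map)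
qed

lemma mean_functional_spectral_mean:
  assumes G: "simple_graph G" "fst G \<noteq> {}" and deg: "\<And>v. v \<in> fst G \<Longrightarrow> vertex_degree G v \<le> d"
  shows "mean_functional (2 * real d) (spectral_mean G)"
proof -
  obtain es where es: "mset es = proots (char_poly (laplacian_matrix G))" "length es = card (fst G)"
    "set es \<subseteq> {0..2 * real d}"
    using laplacian_spectrum[OF G(1) deg] by metis
  have mean: "spectral_mean G f = (\<Sum>e\<leftarrow>es. f e) / real (length es)" for f
    unfolding spectral_mean_def es(1)[symmetric] es(2) by (metis sum_mset_sum_list mset_map)
  have pos: "length es > 0"
    using es(2) G by (simp add: card_gt_0_iff simple_graph_def)
  have "\<bar>spectral_mean G f - spectral_mean G g\<bar> \<le> e"
    if "\<forall>x\<in>{0..2 * real d}. \<bar>f x - g x\<bar> \<le> e" for f g e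
  proof -
    have "\<bar>(\<Sum>x\<leftarrow>es. f x) - (\<Sum>x\<leftarrow>es. g x)\<bar> = \<bar>\<Sum>x\<leftarrow>es. f x - g x\<bar>"
      by (simp add: sum_list_subtractf)
    also have "\<dots> \<le> (\<Sum>x\<leftarrow>es. \<bar>f x - g x\<bar>)"
      using sum_list_abs[of "map (\<lambda>x. f x - g x) es"] by (simp add: comp_def)
    also have "\<dots> \<le> (\<Sum>x\<leftarrow>es. e)"
      using es(3) that by (intro sum_list_mono) auto
    also have "\<dots> = real (length es) * e" by (simp add: sum_list_triv)
    finally have "\<bar>(\<Sum>x\<leftarrow>es. f x) - (\<Sum>x\<leftarrow>es. g x)\<bar> / real (length es) \<le> e"
      using pos by (simp add: divide_le_eq mult.commute)
    then show ?thesis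
      unfolding mean diff_divide_distrib[symmetric] abs_divide by simp
  qed
  moreover have "spectral_mean G (\<lambda>x. \<Sum>i\<le>n. a i * x ^ i) = (\<Sum>i\<le>n. a i * spectral_mean G (\<lambda>x. x ^ i))"
    for a and n :: nat
    unfolding mean
    by (induction n) (simp_all add: sum_list_addf sum_list_const_mult add_divide_distrib sum_list_triv)
  ultimately show ?thesis unfolding mean_functional_def by blast
qed

text \<open>\<open>LEL\<close> omits the last eigenvalue of the list, while the spectral mean
  includes it. A bound on this one term suffices, since it is divided by the number of
  vertices.\<close>

lemma LEL_spectral_mean:
  assumes G: "simple_graph G" "fst G \<noteq> {}" and deg: "\<And>v. v \<in> fst G \<Longrightarrow> vertex_degree G v \<le> d"
  shows "\<bar>LEL G / real (card (fst G)) - spectral_mean G sqrt\<bar> \<le> sqrt (2 * real d) / real (card (fst G))"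
proof -
  define n where "n = card (fst G)"
  obtain es where es: "mset es = proots (char_poly (laplacian_matrix G))" "length es = n"
    "set es \<subseteq> {0..2 * real d}"
    using laplacian_spectrum[OF G(1) deg] unfolding n_def by metis
  have n: "n > 0"
    using G by (simp add: n_def card_gt_0_iff simple_graph_def)
  define xs where "xs = laplacian_eigenvalues G"
  have mxs: "mset xs = mset es"
    by (simp add: xs_def laplacian_eigenvalues_def es(1))
  then have len: "length xs = n" and set: "set xs = set es"
    using es(2) by (metis size_mset, metis set_mset_mset)
  have "(\<Sum>e\<in>#proots (char_poly (laplacian_matrix G)). sqrt e) = (\<Sum>e\<leftarrow>xs. sqrt e)"
    unfolding es(1)[symmetric] mxs[symmetric] by (metis sum_mset_sum_list mset_map)
  \<comment> \<open>The range is written as a successor to split off the smallest eigenvalue, which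
    stands at position \<open>n - 1\<close>.\<close>
  also have "\<dots> = (\<Sum>i<Suc (n - 1). sqrt (xs ! i))"
    using n by (simp add: sum_list_sum_nth len lessThan_atLeast0)
  also have "\<dots> = (\<Sum>i<n - 1. sqrt (xs ! i)) + sqrt (xs ! (n - 1))" by simp
  also have "(\<Sum>i<n - 1. sqrt (xs ! i)) = LEL G"
    unfolding LEL_def n_def[symmetric] xs_def[symmetric]
    by (rule sum.reindex_bij_witness[of _ "\<lambda>i. i - 1" Suc]) auto
  finally have eq: "spectral_mean G sqrt = (LEL G + sqrt (xs ! (n - 1))) / real n"
    by (simp add: spectral_mean_def n_def)
  have "xs ! (n - 1) \<in> set es" using n len set by (metis diff_less less_numeral_extra(1) nth_mem)
  then have "0 \<le> xs ! (n - 1)" "xs ! (n - 1) \<le> 2 * real d" using es(3) by auto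
  then have "0 \<le> sqrt (xs ! (n - 1))" "sqrt (xs ! (n - 1)) \<le> sqrt (2 * real d)" by auto
  then show ?thesis
    using n unfolding eq n_def[symmetric]
    by (simp add: add_divide_distrib divide_right_mono)
qed

section \<open>The effect of removing edges on traces\<close>

lemma lap_kernel_abs_row_sum:
  assumes G: "simple_graph G" and "u \<in> fst G"
  shows "(\<Sum>v\<in>fst G. \<bar>lap_kernel G u v\<bar>) \<le> 2 * real (vertex_degree G u)"
proof -
  have fin: "finite (fst G)" using G by (simp add: simple_graph_def)
  have "(\<Sum>v\<in>fst G. \<bar>lap_kernel G u v\<bar>)
      \<le> (\<Sum>v\<in>fst G. (if u = v then real (vertex_degree G u) else 0) + of_bool ({u, v} \<in> snd G))"
    unfolding lap_kernel_def by (intro sum_mono) auto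
  also have "\<dots> = 2 * real (vertex_degree G u)"
    using fin assms(2) by (simp only: sum.distrib vertex_degree_eq_sum[OF assms, symmetric] sum.delta' if_True)
  finally show ?thesis .
qed

lemma lap_kernel_commute: "lap_kernel G u v = lap_kernel G v u"
  by (simp add: lap_kernel_def insert_commute)

text \<open>Removing one edge changes four entries of the Laplacian by one: two diagonal entries,
  through the degrees, and two symmetric off-diagonal ones. \<open>P\<close> lists at least all
  removed edges, as ordered pairs, and \<open>2 * d\<close> bounds the absolute row sums.\<close>

lemma ker_trace_lap_kernel_edge_removal:
  fixes G H :: "'v sgraph"
  assumes G: "simple_graph G" and H: "simple_graph H" and V: "fst H = fst G" and E: "snd H \<subseteq> snd G"
    and deg: "\<And>v. v \<in> fst G \<Longrightarrow> vertex_degree G v \<le> d"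
    and P: "finite P" "snd G - snd H \<subseteq> (\<lambda>(a, b). {a, b}) ` P"
  shows "\<bar>ker_trace (fst G) (lap_kernel G) k - ker_trace (fst G) (lap_kernel H) k\<bar>
    \<le> real k * (2 * real d) ^ (k - 1) * (4 * real (card P))"
proof -
  define V where "V = fst G"
  have fin: "finite V" using G by (simp add: simple_graph_def V_def)
  \<comment> \<open>\<open>R\<close> is the adjacency kernel of the removed edges; its row sums are
    the losses of degree.\<close>
  define R where "R u v = (of_bool ({u, v} \<in> snd G - snd H) :: real)" for u v
  have adj: "of_bool ({u, v} \<in> snd G) = of_bool ({u, v} \<in> snd H) + R u v" for u v
    using E by (auto simp: R_def)
  have degR: "real (vertex_degree G u) = real (vertex_degree H u) + (\<Sum>v\<in>V. R u v)" if "u \<in> V" for u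
    using that vertex_degree_eq_sum[OF G, of u] vertex_degree_eq_sum[OF H, of u]
    by (simp add: V_def assms(3) adj sum.distrib)
  have degH: "vertex_degree H u \<le> d" if "u \<in> V" for u
  proof -
    have "0 \<le> (\<Sum>v\<in>V. R u v)" by (intro sum_nonneg) (simp add: R_def)
    then show ?thesis using degR[OF that] deg[of u] that by (simp add: V_def)
  qed
  have rowG: "(\<Sum>v\<in>V. \<bar>lap_kernel G u v\<bar>) \<le> 2 * real d" if "u \<in> V" for u
    using lap_kernel_abs_row_sum[OF G, of u] deg[of u] that by (simp add: V_def)
  have colH: "(\<Sum>u\<in>V. \<bar>lap_kernel H u v\<bar>) \<le> 2 * real d" if "v \<in> V" for v
    using lap_kernel_abs_row_sum[OF H, of v] degH[of v] that
    by (simp add: V_def assms(3) lap_kernel_commute[of H _ v])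
  have "(\<Sum>u\<in>V. \<Sum>v\<in>V. \<bar>lap_kernel G u v - lap_kernel H u v\<bar>)
      \<le> (\<Sum>u\<in>V. \<Sum>v\<in>V. (if u = v then (\<Sum>w\<in>V. R u w) else 0) + R u v)"
  proof (intro sum_mono)
    fix u v assume u: "u \<in> V" "v \<in> V"
    have "0 \<le> (\<Sum>w\<in>V. R u w)" "0 \<le> R u v" by (auto intro!: sum_nonneg simp: R_def)
    moreover have "lap_kernel G u v - lap_kernel H u v = (if u = v then (\<Sum>w\<in>V. R u w) else 0) - R u v"
      unfolding lap_kernel_def adj degR[OF u(1)] by simp
    ultimately show "\<bar>lap_kernel G u v - lap_kernel H u v\<bar> \<le> (if u = v then (\<Sum>w\<in>V. R u w) else 0) + R u v"
      by (auto simp: abs_le_iff)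
  qed
  also have "\<dots> = 2 * (\<Sum>u\<in>V. \<Sum>v\<in>V. R u v)"
    using fin by (simp add: sum.distrib sum.delta' sum_distrib_left)
  also have "(\<Sum>u\<in>V. \<Sum>v\<in>V. R u v) = (\<Sum>p\<in>V \<times> V. R (fst p) (snd p))"
    by (simp only: sum.cartesian_product case_prod_unfold)
  also have "\<dots> = real (card {p \<in> V \<times> V. {fst p, snd p} \<in> snd G - snd H})"
    unfolding R_def using fin by (simp add: Int_def)
  \<comment> \<open>Every removed edge is counted in both orientations, whereas \<open>P\<close> may
    contain only one of them.\<close>
  also have "card {p \<in> V \<times> V. {fst p, snd p} \<in> snd G - snd H} \<le> card (P \<union> prod.swap ` P)"
  proof (rule card_mono)
    show "{p \<in> V \<times> V. {fst p, snd p} \<in> snd G - snd H} \<subseteq> P \<union> prod.swap ` P"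
    proof
      fix p assume "p \<in> {p \<in> V \<times> V. {fst p, snd p} \<in> snd G - snd H}"
      then obtain a b where "(a, b) \<in> P" "{fst p, snd p} = {a, b}" using P(2) by auto
      then have "p = (a, b) \<or> p = prod.swap (a, b)" by (auto simp: doubleton_eq_iff prod_eq_iff)
      then show "p \<in> P \<union> prod.swap ` P" using \<open>(a, b) \<in> P\<close> by blast
    qed
  qed (use P in auto)
  also have "\<dots> \<le> 2 * card P"
    using card_Un_le[of P "prod.swap ` P"] card_image_le[OF P(1), of prod.swap] by linarith
  finally have "(\<Sum>u\<in>V. \<Sum>v\<in>V. \<bar>lap_kernel G u v - lap_kernel H u v\<bar>) \<le> 4 * real (card P)"
    by simp
  then have "real k * (2 * real d) ^ (k - 1) * (\<Sum>u\<in>V. \<Sum>v\<in>V. \<bar>lap_kernel G u v - lap_kernel H u v\<bar>)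
      \<le> real k * (2 * real d) ^ (k - 1) * (4 * real (card P))"
    by (intro mult_left_mono) auto
  moreover have "\<bar>ker_trace V (lap_kernel G) k - ker_trace V (lap_kernel H) k\<bar>
      \<le> real k * (2 * real d) ^ (k - 1) * (\<Sum>u\<in>V. \<Sum>v\<in>V. \<bar>lap_kernel G u v - lap_kernel H u v\<bar>)"
    by (intro ker_trace_diff_bound fin rowG colH) auto
  ultimately show ?thesis
    unfolding V_def by linarith
qed

section \<open>Graphs with block circulant adjacency\<close>

lemma sum_shift_kernel_row:
  assumes "finite F" "N > 0" "j < N"
  shows "(\<Sum>w\<in>F \<times> {..<N}. shift_kernel N B0 B1 B2 (f, j) w) = (\<Sum>g\<in>F. B0 f g + B1 f g + B2 f g)"
proof -
  have s2: "(\<Sum>l<N. of_bool (j = Suc l mod N)) = (\<Sum>l<N. of_bool (j = l))"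
    by (rule sum.reindex_bij_betw[OF bij_betw_Suc_mod[OF assms(2)]])
  have d: "(\<Sum>l<N. of_bool (l = i)) = 1" "(\<Sum>l<N. of_bool (i = l)) = 1" if "i < N" for i
    using that by (simp_all add: of_bool_def)
  have "(\<Sum>w\<in>F \<times> {..<N}. shift_kernel N B0 B1 B2 (f, j) w)
      = (\<Sum>g\<in>F. \<Sum>l<N. shift_kernel N B0 B1 B2 (f, j) (g, l))"
    by (simp add: sum.cartesian_product case_prod_unfold)
  also have "\<dots> = (\<Sum>g\<in>F. B0 f g * (\<Sum>l<N. of_bool (l = j)) + B1 f g * (\<Sum>l<N. of_bool (l = Suc j mod N))
       + B2 f g * (\<Sum>l<N. of_bool (j = Suc l mod N)))"
    by (rule sum.cong[OF refl])
      (simp only: shift_kernel_def fst_conv snd_conv sum.distrib sum_distrib_left)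
  finally show ?thesis using assms by (simp add: s2 d del: sum_of_bool_eq)
qed

text \<open>The reflection \<open>j \<mapsto> N - 1 - j\<close> of the cyclic coordinate exchanges
  next and previous layer. On the Fourier side this reverses the sign of the angle.\<close>

lemma ker_trace_shift_kernel_reverse:
  assumes "N > 0"
  shows "ker_trace (F \<times> {..<N}) (shift_kernel N B0 B1 B2) k = ker_trace (F \<times> {..<N}) (shift_kernel N B0 B2 B1) k"
proof (rule ker_trace_bij)
  show "bij_betw (\<lambda>(f, j). (f, N - 1 - j)) (F \<times> {..<N}) (F \<times> {..<N})"
    by (rule bij_betwI[where g = "\<lambda>(f, j). (f, N - 1 - j)"]) auto
  have rev: "N - 1 - l = Suc (N - 1 - j) mod N \<longleftrightarrow> j = Suc l mod N" if "j < N" "l < N" for j l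
    using that by (auto simp: mod_Suc)
  have eq: "N - 1 - l = N - 1 - j \<longleftrightarrow> l = j" if "j < N" "l < N" for j l
    using that by auto
  fix u v assume uv: "u \<in> F \<times> {..<N}" "v \<in> F \<times> {..<N}"
  then obtain f j g l where "u = (f, j)" "v = (g, l)" and jl: "j < N" "l < N" by auto
  then show "shift_kernel N B0 B1 B2 (case u of (f, j) \<Rightarrow> (f, N - 1 - j)) (case v of (f, j) \<Rightarrow> (f, N - 1 - j))
      = shift_kernel N B0 B2 B1 u v"
    by (simp only: shift_kernel_def prod.case fst_conv snd_conv rev[OF jl] rev[OF jl(2,1)] eq[OF jl] add_ac)
qed

lemma vertex_degree_shift_kernel:
  assumes G: "simple_graph G" and F: "finite F" "N > 0"
    and bij: "bij_betw \<phi> (fst G) (F \<times> {..<N})"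
    and adj: "\<And>u v. u \<in> fst G \<Longrightarrow> v \<in> fst G \<Longrightarrow>
      of_bool ({u, v} \<in> snd G) = shift_kernel N a0 a1 a2 (\<phi> u) (\<phi> v)"
    and u: "u \<in> fst G"
  shows "real (vertex_degree G u) = (\<Sum>h\<in>F. a0 (fst (\<phi> u)) h + a1 (fst (\<phi> u)) h + a2 (fst (\<phi> u)) h)"
proof -
  have \<phi>u: "snd (\<phi> u) < N"
    using bij_betw_apply[OF bij u] by (auto simp: mem_Times_iff)
  have "real (vertex_degree G u) = (\<Sum>w\<in>fst G. shift_kernel N a0 a1 a2 (\<phi> u) (\<phi> w))"
    using u by (simp add: vertex_degree_eq_sum[OF G] adj)
  also have "\<dots> = (\<Sum>w\<in>F \<times> {..<N}. shift_kernel N a0 a1 a2 (\<phi> u) w)"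
    by (rule sum.reindex_bij_betw[OF bij])
  also have "\<dots> = (\<Sum>h\<in>F. a0 (fst (\<phi> u)) h + a1 (fst (\<phi> u)) h + a2 (fst (\<phi> u)) h)"
    using sum_shift_kernel_row[OF F \<phi>u, of a0 a1 a2 "fst (\<phi> u)"] by simp
  finally show ?thesis .
qed

lemma lap_kernel_shift_kernel:
  assumes G: "simple_graph G" and F: "finite F" "N > 0"
    and bij: "bij_betw \<phi> (fst G) (F \<times> {..<N})"
    and adj: "\<And>u v. u \<in> fst G \<Longrightarrow> v \<in> fst G \<Longrightarrow>
      of_bool ({u, v} \<in> snd G) = shift_kernel N a0 a1 a2 (\<phi> u) (\<phi> v)"
    and uv: "u \<in> fst G" "v \<in> fst G"
  shows "lap_kernel G u v = shift_kernel N (\<lambda>f g. of_bool (f = g) * (\<Sum>h\<in>F. a0 f h + a1 f h + a2 f h) - a0 f g)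
      (\<lambda>f g. - a1 f g) (\<lambda>f g. - a2 f g) (\<phi> u) (\<phi> v)"
proof -
  have alg: "b * S * b' - (x * b' + y * c + z * e) = (b * S - x) * b' + - y * c + - z * e"
    for b S b' x y z c e :: real
    by (simp add: algebra_simps)
  have "u = v \<longleftrightarrow> fst (\<phi> u) = fst (\<phi> v) \<and> snd (\<phi> v) = snd (\<phi> u)"
    using bij uv by (auto simp: bij_betw_def inj_on_def prod_eq_iff)
  then have ite: "(if u = v then r else 0) = of_bool (fst (\<phi> u) = fst (\<phi> v)) * r * of_bool (snd (\<phi> v) = snd (\<phi> u))"
    for r :: real
    by simp
  have deg: "real (vertex_degree G u) = (\<Sum>h\<in>F. a0 (fst (\<phi> u)) h + a1 (fst (\<phi> u)) h + a2 (fst (\<phi> u)) h)"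
    by (rule vertex_degree_shift_kernel[OF assms(1-6)])
  show ?thesis
    unfolding lap_kernel_def adj[OF uv] ite deg shift_kernel_def by (rule alg)
qed

text \<open>Degrees are constant along the cyclic direction, so the degree matrix joins the block
  inside a layer and the Laplacian is block circulant with the adjacency. The statement is complex
  only because of the symbols.\<close>

theorem ker_trace_lap_kernel_shift_kernel:
  assumes "simple_graph G" and F: "finite F" "N > 0"
    and bij: "bij_betw \<phi> (fst G) (F \<times> {..<N})"
    and "\<And>u v. u \<in> fst G \<Longrightarrow> v \<in> fst G \<Longrightarrow>
      of_bool ({u, v} \<in> snd G) = shift_kernel N a0 a1 a2 (\<phi> u) (\<phi> v)"
  shows "complex_of_real (ker_trace (fst G) (lap_kernel G) k)
    = (\<Sum>q<N. ker_trace F (symbol_kernel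
        (\<lambda>f g. of_bool (f = g) * (\<Sum>h\<in>F. of_real (a0 f h + a1 f h + a2 f h)) - of_real (a0 f g))
        (\<lambda>f g. - of_real (a1 f g)) (\<lambda>f g. - of_real (a2 f g)) (2 * pi * real q / real N)) k)"
proof -
  define B0 where "B0 = (\<lambda>f g. of_bool (f = g) * (\<Sum>h\<in>F. of_real (a0 f h + a1 f h + a2 f h)) - complex_of_real (a0 f g))"
  have eq: "shift_kernel N B0 (\<lambda>f g. - of_real (a1 f g)) (\<lambda>f g. - of_real (a2 f g)) (\<phi> u) (\<phi> v)
      = complex_of_real (lap_kernel G u v)" if "u \<in> fst G" "v \<in> fst G" for u v
  proof -
    have "lap_kernel G u v = shift_kernel N (\<lambda>f g. of_bool (f = g) * (\<Sum>h\<in>F. a0 f h + a1 f h + a2 f h) - a0 f g)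
        (\<lambda>f g. - a1 f g) (\<lambda>f g. - a2 f g) (\<phi> u) (\<phi> v)"
      by (rule lap_kernel_shift_kernel[OF assms that])
    moreover have ofb: "complex_of_real (of_bool P) = of_bool P" for P by simp
    ultimately show ?thesis
      by (simp only: shift_kernel_def B0_def of_real_add of_real_mult of_real_diff of_real_minus of_real_sum ofb)
  qed
  have "complex_of_real (ker_trace (fst G) (lap_kernel G) k) = ker_trace (fst G) (\<lambda>u v. complex_of_real (lap_kernel G u v)) k"
    by (simp add: ker_trace_of_real)
  also have "\<dots> = ker_trace (F \<times> {..<N}) (shift_kernel N B0 (\<lambda>f g. - of_real (a1 f g)) (\<lambda>f g. - of_real (a2 f g))) k"
    by (intro ker_trace_bij[OF bij, symmetric] eq)
  finally show ?thesis
    unfolding ker_trace_shift_kernel[OF F] B0_def .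
qed

section \<open>Hexagonal lattices\<close>

text \<open>The coordinate \<open>j\<close> is separated as the cyclic one: it stays periodic on the
  cylinder, and it is the direction whose length \<open>n\<close> grows in the inner limit. The
  other two coordinates form the fiber.\<close>

definition hex_pos :: "hex_vertex \<Rightarrow> (nat \<times> nat) \<times> nat" where
  "hex_pos = (\<lambda>(i, j, s). ((i, s), j))"

definition hex_fiber :: "nat \<Rightarrow> (nat \<times> nat) set" where
  "hex_fiber m = {0..m} \<times> {0, 1}"

text \<open>The edges inside a row, where \<open>r i i'\<close> says that \<open>(i, 0)\<close> is joined to \<open>(i', 1)\<close> in addition
  to \<open>(i, 1)\<close>, and the edges to the next row.\<close>

definition row_adj :: "(nat \<Rightarrow> nat \<Rightarrow> bool) \<Rightarrow> nat \<times> nat \<Rightarrow> nat \<times> nat \<Rightarrow> real" where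
  "row_adj r = (\<lambda>(i, s) (i', s'). of_bool (s = 0 \<and> s' = 1 \<and> (i' = i \<or> r i i') \<or> s = 1 \<and> s' = 0 \<and> (i = i' \<or> r i' i)))"

definition next_row_adj :: "nat \<times> nat \<Rightarrow> nat \<times> nat \<Rightarrow> real" where
  "next_row_adj = (\<lambda>(i, s) (i', s'). of_bool (i = i' \<and> s = 0 \<and> s' = 1))"

lemma fst_hex [simp]:
  "fst (hex_toroidal m n) = hex_vertices m n" "fst (hex_cylindrical m n) = hex_vertices m n"
  "fst (hex_free m n) = hex_vertices m n"
  by (simp_all add: hex_toroidal_def hex_cylindrical_def hex_free_def)

lemma finite_hex_fiber [simp]: "finite (hex_fiber m)"
  by (simp add: hex_fiber_def)

lemma bij_betw_hex_pos: "bij_betw hex_pos (hex_vertices m n) (hex_fiber m \<times> {..<Suc n})"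
  by (rule bij_betwI[where g = "\<lambda>((i, s), j). (i, j, s)"])
    (auto simp: hex_pos_def hex_vertices_def hex_fiber_def)

lemma Suc_mod_neq: "n \<ge> 1 \<Longrightarrow> j \<le> n \<Longrightarrow> Suc j mod Suc n \<noteq> j"
  by (auto simp: mod_Suc)

lemma hex_toroidal_edge:
  assumes "(i, j, s) \<in> hex_vertices m n" "(i', j', s') \<in> hex_vertices m n"
  shows "{(i, j, s), (i', j', s')} \<in> snd (hex_toroidal m n) \<longleftrightarrow>
    (s = 0 \<and> s' = 1 \<and> (j' = j \<and> (i' = i \<or> i' = Suc i mod Suc m) \<or> i' = i \<and> j' = Suc j mod Suc n)) \<or>
    (s = 1 \<and> s' = 0 \<and> (j = j' \<and> (i = i' \<or> i = Suc i' mod Suc m) \<or> i = i' \<and> j = Suc j' mod Suc n))"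
  using assms unfolding hex_toroidal_def snd_conv UN_iff Bex_def
  by (simp add: doubleton_eq_iff conj_disj_distribL ex_disj_distrib hex_vertices_def) auto

text \<open>For \<open>m \<ge> 1\<close> a wrap-around edge joins different columns \<open>m\<close>
  and \<open>0\<close>, so it is not also an edge inside a column, and the deletion turns the cyclic
  successor of \<open>i\<close> into the ordinary one.\<close>

lemma hex_cylindrical_edge:
  assumes "(i, j, s) \<in> hex_vertices m n" "(i', j', s') \<in> hex_vertices m n" "m \<ge> 1"
  shows "{(i, j, s), (i', j', s')} \<in> snd (hex_cylindrical m n) \<longleftrightarrow>
    (s = 0 \<and> s' = 1 \<and> (j' = j \<and> (i' = i \<or> i' = Suc i) \<or> i' = i \<and> j' = Suc j mod Suc n)) \<or>
    (s = 1 \<and> s' = 0 \<and> (j = j' \<and> (i = i' \<or> i = Suc i') \<or> i = i' \<and> j = Suc j' mod Suc n))"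
proof -
  have "{(i, j, s), (i', j', s')} \<in> snd (hex_cylindrical m n) \<longleftrightarrow>
      {(i, j, s), (i', j', s')} \<in> snd (hex_toroidal m n) \<and>
      \<not> (s = 0 \<and> s' = 1 \<and> j = j' \<and> i = m \<and> i' = 0) \<and> \<not> (s = 1 \<and> s' = 0 \<and> j = j' \<and> i' = m \<and> i = 0)"
    using assms(1,2) by (auto simp: hex_cylindrical_def hex_vertices_def doubleton_eq_iff)
  moreover have "Suc i mod Suc m = (if i = m then 0 else Suc i)" "Suc i' mod Suc m = (if i' = m then 0 else Suc i')"
    using assms(1,2) by (auto simp: hex_vertices_def)
  ultimately show ?thesis
    unfolding hex_toroidal_edge[OF assms(1,2)] using assms by (auto simp: hex_vertices_def)
qed

text \<open>The disjunction of edge types becomes a sum, so the types must exclude each other. For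
  \<open>n \<ge> 1\<close> the next row differs from the current one. For \<open>n = 1\<close> the
  next and the previous row coincide, but their blocks are supported on opposite values of
  \<open>s\<close>.\<close>

lemma hex_toroidal_shift_kernel:
  assumes "n \<ge> 1" "u \<in> hex_vertices m n" "v \<in> hex_vertices m n"
  shows "of_bool ({u, v} \<in> snd (hex_toroidal m n))
    = shift_kernel (Suc n) (row_adj (\<lambda>i i'. i' = Suc i mod Suc m)) next_row_adj (\<lambda>f g. next_row_adj g f)
        (hex_pos u) (hex_pos v)"
proof -
  obtain i j s i' j' s' where uv: "u = (i, j, s)" "v = (i', j', s')" by (metis prod_cases3)
  have "j \<le> n" "j' \<le> n" using assms by (auto simp: uv hex_vertices_def)
  then have "Suc j mod Suc n \<noteq> j" "Suc j' mod Suc n \<noteq> j'"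
    using Suc_mod_neq assms by auto
  then show ?thesis
    unfolding uv hex_toroidal_edge[OF assms(2,3)[unfolded uv]]
    by (auto simp: shift_kernel_def hex_pos_def row_adj_def next_row_adj_def simp del: mod_Suc_eq)
qed

lemma hex_cylindrical_shift_kernel:
  assumes "m \<ge> 1" "n \<ge> 1" "u \<in> hex_vertices m n" "v \<in> hex_vertices m n"
  shows "of_bool ({u, v} \<in> snd (hex_cylindrical m n))
    = shift_kernel (Suc n) (row_adj (\<lambda>i i'. i' = Suc i)) next_row_adj (\<lambda>f g. next_row_adj g f)
        (hex_pos u) (hex_pos v)"
proof -
  obtain i j s i' j' s' where uv: "u = (i, j, s)" "v = (i', j', s')" by (metis prod_cases3)
  have "j \<le> n" "j' \<le> n" using assms by (auto simp: uv hex_vertices_def)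
  then have "Suc j mod Suc n \<noteq> j" "Suc j' mod Suc n \<noteq> j'"
    using Suc_mod_neq assms by auto
  then show ?thesis
    unfolding uv hex_cylindrical_edge[OF assms(3,4)[unfolded uv] assms(1)]
    by (auto simp: shift_kernel_def hex_pos_def row_adj_def next_row_adj_def simp del: mod_Suc_eq)
qed

text \<open>The Laplacian after the transform in \<open>j\<close>. The relation \<open>r\<close> is
  the cyclic successor for the torus and the ordinary successor for the cylinder, so one formula
  covers both.\<close>

definition row_symbol :: "(nat \<Rightarrow> nat \<Rightarrow> bool) \<Rightarrow> nat \<Rightarrow> real \<Rightarrow> nat \<times> nat \<Rightarrow> nat \<times> nat \<Rightarrow> complex" where
  "row_symbol r m = symbol_kernel
     (\<lambda>f g. of_bool (f = g) * (\<Sum>h\<in>hex_fiber m. of_real (row_adj r f h + next_row_adj f h + next_row_adj h f))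
        - of_real (row_adj r f g))
     (\<lambda>f g. - of_real (next_row_adj f g)) (\<lambda>f g. - of_real (next_row_adj g f))"

lemma ker_trace_hex_toroidal:
  assumes "n \<ge> 1"
  shows "complex_of_real (ker_trace (hex_vertices m n) (lap_kernel (hex_toroidal m n)) k)
    = (\<Sum>q<Suc n. ker_trace (hex_fiber m) (row_symbol (\<lambda>i i'. i' = Suc i mod Suc m) m (2 * pi * real q / real (Suc n))) k)"
  unfolding row_symbol_def
  using ker_trace_lap_kernel_shift_kernel[OF simple_graph_hex_toroidal finite_hex_fiber zero_less_Suc,
      of hex_pos m n m n "row_adj (\<lambda>i i'. i' = Suc i mod Suc m)" next_row_adj "\<lambda>f g. next_row_adj g f" k]
    bij_betw_hex_pos hex_toroidal_shift_kernel[OF assms] by simp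

lemma ker_trace_hex_cylindrical:
  assumes "m \<ge> 1" "n \<ge> 1"
  shows "complex_of_real (ker_trace (hex_vertices m n) (lap_kernel (hex_cylindrical m n)) k)
    = (\<Sum>q<Suc n. ker_trace (hex_fiber m) (row_symbol (\<lambda>i i'. i' = Suc i) m (2 * pi * real q / real (Suc n))) k)"
  unfolding row_symbol_def
  using ker_trace_lap_kernel_shift_kernel[OF simple_graph_hex_cylindrical finite_hex_fiber zero_less_Suc,
      of hex_pos m n m n "row_adj (\<lambda>i i'. i' = Suc i)" next_row_adj "\<lambda>f g. next_row_adj g f" k]
    bij_betw_hex_pos hex_cylindrical_shift_kernel[OF assms] by simp

lemma continuous_on_ker_pow:
  assumes "\<And>f g. f \<in> F \<Longrightarrow> g \<in> F \<Longrightarrow> continuous_on S (\<lambda>\<theta>. M \<theta> f g)" "f \<in> F" "g \<in> F"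
  shows "continuous_on S (\<lambda>\<theta>. ker_pow F (M \<theta>) k f g :: 'b::{real_normed_algebra,comm_ring_1})"
  using assms(3)
proof (induction k arbitrary: g)
  case (Suc k)
  then show ?case
    unfolding ker_pow.simps using assms by (intro continuous_on_sum continuous_on_mult) auto
qed simp

text \<open>The symbol depends on \<open>\<theta>\<close> only through \<open>cis \<theta>\<close>
  and \<open>cis (- \<theta>)\<close>. Continuity of its traces is all that is required for fixed
  \<open>m\<close>; the eigenvalues of the symbol of the cylinder are never computed.\<close>

lemma continuous_on_ker_trace_row_symbol: "continuous_on S (\<lambda>\<theta>. ker_trace F (row_symbol r m \<theta>) k)"
  unfolding ker_trace_def row_symbol_def symbol_kernel_def
  by (intro continuous_on_sum continuous_on_ker_pow continuous_intros)

text \<open>For fixed \<open>m\<close> the moment is a Riemann average of \<open>h\<close> divided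
  by the size \<open>2 * (m + 1)\<close> of a layer. The real part is taken because \<open>h\<close>
  has complex values although its sum is real.\<close>

lemma spectral_mean_moment_convergent:
  fixes h :: "real \<Rightarrow> complex"
  assumes G: "\<And>n. simple_graph (G n)" "\<And>n. fst (G n) = hex_vertices m n"
    and tr: "\<And>n. n \<ge> 1 \<Longrightarrow> complex_of_real (ker_trace (hex_vertices m n) (lap_kernel (G n)) k)
      = (\<Sum>q<Suc n. h (2 * pi * real q / real (Suc n)))"
    and cont: "continuous_on {0..2 * pi} h"
  shows "convergent (\<lambda>n. spectral_mean (G n) (\<lambda>t. t ^ k))"
proof -
  define A where "A n = (\<Sum>q<Suc n. Re (h (2 * pi * real q / real (Suc n)))) / real (Suc n)" for n
  have "continuous_on {0..2 * pi} (\<lambda>\<theta>. Re (h \<theta>))" by (intro continuous_intros cont)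
  from riemann_average_tendsto[OF this]
  have "A \<longlonglongrightarrow> integral {0..2 * pi} (\<lambda>\<theta>. Re (h \<theta>)) / (2 * pi)"
    by (simp add: A_def[abs_def])
  then have "(\<lambda>n. A n / (2 * real (Suc m))) \<longlonglongrightarrow> integral {0..2 * pi} (\<lambda>\<theta>. Re (h \<theta>)) / (2 * pi) / (2 * real (Suc m))"
    by (intro tendsto_intros) auto
  moreover have "\<forall>\<^sub>F n in sequentially. A n / (2 * real (Suc m)) = spectral_mean (G n) (\<lambda>t. t ^ k)"
    using eventually_ge_at_top[of 1]
  proof eventually_elim
    case (elim n)
    have tr_Re: "ker_trace (hex_vertices m n) (lap_kernel (G n)) k = Re (\<Sum>q<Suc n. h (2 * pi * real q / real (Suc n)))"
      by (subst tr[OF elim, symmetric]) simp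
    have card: "real (2 * (m + 1) * (n + 1)) = real (Suc n) * (2 * real (Suc m))"
      by (simp add: algebra_simps)
    show ?case
      unfolding spectral_mean_power[OF G(1)] G(2) card_hex_vertices A_def Re_sum[symmetric] tr_Re card
      by (simp only: divide_divide_eq_left)
  qed
  ultimately have "(\<lambda>n. spectral_mean (G n) (\<lambda>t. t ^ k)) \<longlonglongrightarrow> integral {0..2 * pi} (\<lambda>\<theta>. Re (h \<theta>)) / (2 * pi) / (2 * real (Suc m))"
    by (rule Lim_transform_eventually)
  then show ?thesis by (rule convergentI)
qed

section \<open>The second transform and the two-band spectrum of the torus\<close>

text \<open>A matrix with equal diagonal entries \<open>c\<close> and off-diagonal product
  \<open>t\<^sup>2\<close> has eigenvalues \<open>c + t\<close> and \<open>c - t\<close>. The common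
  factor \<open>D\<close> of the off-diagonal entries would be a quotient by \<open>2 * t\<close>;
  only \<open>t * D\<close> is prescribed, which allows \<open>t = 0\<close>.\<close>

lemma ker_pow_two:
  fixes M :: "'v \<Rightarrow> 'v \<Rightarrow> 'b::field_char_0"
  assumes ab: "a \<noteq> b" and M: "M a a = c" "M b b = c" and t: "M a b * M b a = t\<^sup>2"
  shows "\<exists>D. ker_pow {a, b} M k a a = ((c + t) ^ k + (c - t) ^ k) / 2 \<and> ker_pow {a, b} M k b b = ((c + t) ^ k + (c - t) ^ k) / 2 \<and>
    ker_pow {a, b} M k a b = M a b * D \<and> ker_pow {a, b} M k b a = M b a * D \<and> t * D = ((c + t) ^ k - (c - t) ^ k) / 2"
proof (induction k)
  case (Suc k)
  then obtain D where D: "ker_pow {a, b} M k a a = ((c + t) ^ k + (c - t) ^ k) / 2"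
    "ker_pow {a, b} M k b b = ((c + t) ^ k + (c - t) ^ k) / 2"
    "ker_pow {a, b} M k a b = M a b * D" "ker_pow {a, b} M k b a = M b a * D" "t * D = ((c + t) ^ k - (c - t) ^ k) / 2"
    by blast
  define P where "P = ((c + t) ^ k + (c - t) ^ k) / 2"
  have P': "((c + t) ^ Suc k + (c - t) ^ Suc k) / 2 = c * P + t * (t * D)"
    unfolding D(5) P_def by (simp add: field_simps)
  have Q': "((c + t) ^ Suc k - (c - t) ^ Suc k) / 2 = c * (t * D) + t * P"
    unfolding D(5) P_def by (simp add: field_simps)
  have t': "M a b * (M b a * x) = t * (t * x)" "M b a * (M a b * x) = t * (t * x)" for x
    by (metis t mult.assoc power2_eq_square, metis t mult.assoc mult.commute power2_eq_square)
  have t2: "M a b * M b a = t * t" "M b a * M a b = t * t"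
    using t by (simp_all add: power2_eq_square mult.commute)
  show ?case
    unfolding P' Q' ker_pow.simps
    \<comment> \<open>The witness is the new off-diagonal factor: the old one times \<open>c\<close>
      plus the old diagonal entry \<open>P\<close>.\<close>
    using ab by (intro exI[of _ "c * D + P"]) (simp add: D(1,2)[folded P_def] D(3,4) M algebra_simps t' t2)
qed (use ab in auto)

lemma ker_trace_two:
  fixes M :: "'v \<Rightarrow> 'v \<Rightarrow> 'b::field_char_0"
  assumes "a \<noteq> b" "M a a = c" "M b b = c" "M a b * M b a = t\<^sup>2"
  shows "ker_trace {a, b} M k = (c + t) ^ k + (c - t) ^ k"
proof -
  have h: "ker_pow {a, b} M k a a = ((c + t) ^ k + (c - t) ^ k) / 2" "ker_pow {a, b} M k b b = ((c + t) ^ k + (c - t) ^ k) / 2"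
    using ker_pow_two[OF assms, of k] by blast+
  have "ker_trace {a, b} M k = ker_pow {a, b} M k a a + ker_pow {a, b} M k b b"
    using assms(1) by (simp add: ker_trace_def)
  moreover have "x / 2 + x / 2 = x" for x :: 'b
    by (simp add: add_divide_distrib[symmetric] mult_2[symmetric])
  ultimately show ?thesis unfolding h by metis
qed

definition hex_rho :: "real \<Rightarrow> real \<Rightarrow> real" where
  "hex_rho x y = 3 + 2 * cos x + 2 * cos y + 2 * cos (x + y)"

text \<open>\<open>hex_rho\<close> is the squared modulus of \<open>1 + cis x + cis (- y)\<close>,
  the negative of an off-diagonal entry of the final \<open>2 \<times> 2\<close> symbol. The signs
  of the two angles must be opposite in order to produce \<open>cos (x + y)\<close>.\<close>

lemma hex_rho_eq: "complex_of_real (hex_rho x y) = (1 + cis x + cis (- y)) * (1 + cis (- x) + cis y)"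
proof (rule complex_eqI)
  have s: "(sin x)\<^sup>2 + (cos x)\<^sup>2 = 1" "(sin y)\<^sup>2 + (cos y)\<^sup>2 = 1" by simp_all
  show "Re (complex_of_real (hex_rho x y)) = Re ((1 + cis x + cis (- y)) * (1 + cis (- x) + cis y))"
    using s by (simp add: hex_rho_def cos_add power2_eq_square algebra_simps)
  show "Im (complex_of_real (hex_rho x y)) = Im ((1 + cis x + cis (- y)) * (1 + cis (- x) + cis y))"
    by (simp add: algebra_simps)
qed

lemma hex_rho_bounds: "0 \<le> hex_rho x y" "hex_rho x y \<le> 9"
proof -
  have "complex_of_real (hex_rho x y) = (1 + cis x + cis (- y)) * cnj (1 + cis x + cis (- y))"
    by (simp add: hex_rho_eq cis_cnj)
  also have "\<dots> = complex_of_real ((cmod (1 + cis x + cis (- y)))\<^sup>2)"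
    by (rule complex_norm_square[symmetric])
  finally have "hex_rho x y = (cmod (1 + cis x + cis (- y)))\<^sup>2"
    by (simp only: of_real_eq_iff)
  then show "0 \<le> hex_rho x y" by simp
  show "hex_rho x y \<le> 9"
    unfolding hex_rho_def
    using cos_le_one[of x] cos_le_one[of y] cos_le_one[of "x + y"] by linarith
qed

lemma sqrt_hex_rho_bounds: "0 \<le> sqrt (hex_rho x y)" "sqrt (hex_rho x y) \<le> 3"
  using hex_rho_bounds[of x y] by (auto intro: real_le_lsqrt)

text \<open>Swapping makes \<open>i\<close> the cyclic coordinate of the second transform and leaves
  the sublattice index \<open>s\<close> as the fiber. The assumption \<open>m \<ge> 1\<close> keeps
  the successor of \<open>i\<close> different from \<open>i\<close>, so that the edge types add
  without overlap.\<close>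

lemma row_adj_toroidal_shift_kernel:
  assumes "m \<ge> 1" "f \<in> hex_fiber m" "g \<in> hex_fiber m"
  shows "complex_of_real (row_adj (\<lambda>i i'. i' = Suc i mod Suc m) f g)
    = shift_kernel (Suc m) (\<lambda>s s'. of_bool (s \<noteq> s')) (\<lambda>s s'. of_bool (s = 0 \<and> s' = 1)) (\<lambda>s s'. of_bool (s' = 0 \<and> s = 1))
        (prod.swap f) (prod.swap g)"
proof -
  obtain i s i' s' where fg: "f = (i, s)" "g = (i', s')" by (metis surj_pair)
  have "i \<le> m" "i' \<le> m" and s: "s = 0 \<or> s = 1" "s' = 0 \<or> s' = 1" using assms by (auto simp: fg hex_fiber_def)
  then have "Suc i mod Suc m \<noteq> i" "Suc i' mod Suc m \<noteq> i'"
    using Suc_mod_neq assms by auto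
  with s show ?thesis
    by (auto simp: fg shift_kernel_def row_adj_def)
qed

lemma next_row_adj_shift_kernel:
  "complex_of_real (next_row_adj f g)
    = shift_kernel (Suc m) (\<lambda>s s'. of_bool (s = 0 \<and> s' = 1)) (\<lambda>_ _. 0) (\<lambda>_ _. 0) (prod.swap f) (prod.swap g)"
  "complex_of_real (next_row_adj g f)
    = shift_kernel (Suc m) (\<lambda>s s'. of_bool (s' = 0 \<and> s = 1)) (\<lambda>_ _. 0) (\<lambda>_ _. 0) (prod.swap f) (prod.swap g)"
  by (auto simp: shift_kernel_def next_row_adj_def split: prod.splits)

lemma bij_betw_swap_hex_fiber: "bij_betw prod.swap (hex_fiber m) ({0, 1} \<times> {..<Suc m})"
  by (rule bij_betwI[where g = prod.swap]) (auto simp: hex_fiber_def)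

lemma hex_toroidal_fiber_degree:
  assumes "m \<ge> 1" "f \<in> hex_fiber m"
  shows "(\<Sum>h\<in>hex_fiber m. complex_of_real (row_adj (\<lambda>i i'. i' = Suc i mod Suc m) f h + next_row_adj f h + next_row_adj h f)) = 3"
proof -
  have "(\<Sum>h\<in>hex_fiber m. complex_of_real (row_adj (\<lambda>i i'. i' = Suc i mod Suc m) f h + next_row_adj f h + next_row_adj h f))
    = (\<Sum>h\<in>hex_fiber m. shift_kernel (Suc m) (\<lambda>s s'. of_bool (s \<noteq> s') + of_bool (s = 0 \<and> s' = 1) + of_bool (s' = 0 \<and> s = 1))
        (\<lambda>s s'. of_bool (s = 0 \<and> s' = 1)) (\<lambda>s s'. of_bool (s' = 0 \<and> s = 1)) (prod.swap f) (prod.swap h))"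
    by (intro sum.cong refl)
      (simp add: row_adj_toroidal_shift_kernel[OF assms] next_row_adj_shift_kernel[where m = m],
       simp add: shift_kernel_def algebra_simps)
  also have "\<dots> = (\<Sum>w\<in>{0, 1} \<times> {..<Suc m}. shift_kernel (Suc m) (\<lambda>s s'. of_bool (s \<noteq> s') + of_bool (s = 0 \<and> s' = 1) + of_bool (s' = 0 \<and> s = 1))
        (\<lambda>s s'. of_bool (s = 0 \<and> s' = 1)) (\<lambda>s s'. of_bool (s' = 0 \<and> s = 1)) (snd f, fst f) w)"
    by (subst sum.reindex_bij_betw[OF bij_betw_swap_hex_fiber, symmetric]) (simp add: prod.swap_def)
  also have "\<dots> = 3"
    using assms(2) by (subst sum_shift_kernel_row) (auto simp: hex_fiber_def)
  finally show ?thesis .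
qed

text \<open>The transform in \<open>i\<close> leaves a \<open>2 \<times> 2\<close> symbol with
  diagonal entries \<open>3\<close>, the common degree, and off-diagonal product
  \<open>hex_rho\<close>.\<close>

lemma ker_trace_toroidal_row_symbol:
  assumes m: "m \<ge> 1"
  shows "ker_trace (hex_fiber m) (row_symbol (\<lambda>i i'. i' = Suc i mod Suc m) m y) k
    = (\<Sum>p<Suc m. complex_of_real ((3 + sqrt (hex_rho (2 * pi * real p / real (Suc m)) y)) ^ k
                               + (3 - sqrt (hex_rho (2 * pi * real p / real (Suc m)) y)) ^ k))"
proof -
  \<comment> \<open>\<open>C\<close> collects what fixes \<open>i\<close>, including the edges to
    neighbouring rows with their phases in \<open>y\<close>; \<open>U\<close> and \<open>D\<close>
    are the steps to the next and the previous \<open>i\<close>.\<close>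
  define C where "C = (\<lambda>(s::nat) (s'::nat). 3 * of_bool (s = s') - of_bool (s \<noteq> s') - of_bool (s = 0 \<and> s' = 1) * cis (- y)
      - of_bool (s' = 0 \<and> s = 1) * cis y)"
  define U where "U = (\<lambda>(s::nat) (s'::nat). - of_bool (s = 0 \<and> s' = 1) :: complex)"
  define D where "D = (\<lambda>(s::nat) (s'::nat). - of_bool (s' = 0 \<and> s = 1) :: complex)"
  have eq: "shift_kernel (Suc m) C U D (prod.swap f) (prod.swap g) = row_symbol (\<lambda>i i'. i' = Suc i mod Suc m) m y f g"
    if "f \<in> hex_fiber m" "g \<in> hex_fiber m" for f g
  proof -
    have "f = g \<longleftrightarrow> snd f = snd g \<and> fst g = fst f" by (auto simp: prod_eq_iff)
    then show ?thesis
      unfolding row_symbol_def symbol_kernel_def hex_toroidal_fiber_degree[OF m that(1)]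
        row_adj_toroidal_shift_kernel[OF m that] next_row_adj_shift_kernel[where m = m]
      by (simp add: shift_kernel_def C_def U_def D_def algebra_simps)
  qed
  have two: "ker_trace {0, 1} (symbol_kernel C D U x) k
      = complex_of_real ((3 + sqrt (hex_rho x y)) ^ k + (3 - sqrt (hex_rho x y)) ^ k)" for x
  proof -
    have "ker_trace {0, 1} (symbol_kernel C D U x) k
        = (3 + complex_of_real (sqrt (hex_rho x y))) ^ k + (3 - complex_of_real (sqrt (hex_rho x y))) ^ k"
    proof (rule ker_trace_two)
      have "symbol_kernel C D U x 0 1 * symbol_kernel C D U x 1 0 = complex_of_real (hex_rho x y)"
        unfolding hex_rho_eq by (simp add: symbol_kernel_def C_def D_def U_def algebra_simps)
      also have "\<dots> = (complex_of_real (sqrt (hex_rho x y)))\<^sup>2"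
        using hex_rho_bounds(1)[of x y] by (metis of_real_power real_sqrt_pow2)
      finally show "symbol_kernel C D U x 0 1 * symbol_kernel C D U x 1 0 = (complex_of_real (sqrt (hex_rho x y)))\<^sup>2" .
    qed (simp_all add: symbol_kernel_def C_def D_def U_def)
    then show ?thesis by simp
  qed
  have "ker_trace (hex_fiber m) (row_symbol (\<lambda>i i'. i' = Suc i mod Suc m) m y) k
      = ker_trace ({0, 1} \<times> {..<Suc m}) (shift_kernel (Suc m) C U D) k"
    by (intro ker_trace_bij[OF bij_betw_swap_hex_fiber, symmetric] eq)
  \<comment> \<open>The direct transform would lead to \<open>cos (x - y)\<close>. Reflecting
    \<open>i\<close> replaces \<open>x\<close> by \<open>- x\<close> and gives the
    \<open>cos (x + y)\<close> of the integrand.\<close>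
  also have "\<dots> = ker_trace ({0, 1} \<times> {..<Suc m}) (shift_kernel (Suc m) C D U) k"
    by (intro ker_trace_shift_kernel_reverse) simp
  also have "\<dots> = (\<Sum>p<Suc m. ker_trace {0, 1} (symbol_kernel C D U (2 * pi * real p / real (Suc m))) k)"
    by (intro ker_trace_shift_kernel) simp_all
  finally show ?thesis unfolding two .
qed

lemma spectral_mean_toroidal_power:
  assumes "m \<ge> 1" "n \<ge> 1"
  shows "spectral_mean (hex_toroidal m n) (\<lambda>t. t ^ k)
    = (\<Sum>q<Suc n. \<Sum>p<Suc m. (3 + sqrt (hex_rho (2 * pi * real p / real (Suc m)) (2 * pi * real q / real (Suc n)))) ^ k
          + (3 - sqrt (hex_rho (2 * pi * real p / real (Suc m)) (2 * pi * real q / real (Suc n)))) ^ k)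
      / (real (Suc m) * real (Suc n)) / 2"
proof -
  have tr: "ker_trace (hex_vertices m n) (lap_kernel (hex_toroidal m n)) k
    = (\<Sum>q<Suc n. \<Sum>p<Suc m. (3 + sqrt (hex_rho (2 * pi * real p / real (Suc m)) (2 * pi * real q / real (Suc n)))) ^ k
          + (3 - sqrt (hex_rho (2 * pi * real p / real (Suc m)) (2 * pi * real q / real (Suc n)))) ^ k)"
    using ker_trace_hex_toroidal[OF assms(2), of m k]
    unfolding ker_trace_toroidal_row_symbol[OF assms(1)] of_real_sum[symmetric] of_real_eq_iff .
  have card: "real (2 * (m + 1) * (n + 1)) = real (Suc m) * real (Suc n) * 2"
    by (simp add: algebra_simps)
  show ?thesis
    unfolding spectral_mean_power[OF simple_graph_hex_toroidal] fst_hex card_hex_vertices card tr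
    by (simp only: divide_divide_eq_left)
qed

section \<open>The limiting spectral distribution\<close>

text \<open>The limit functional of the toroidal spectral means. Each point of the square of area
  \<open>4 * pi\<^sup>2\<close> carries two eigenvalues, hence the normalisation by
  \<open>8 * pi\<^sup>2\<close>.\<close>

definition hex_mean :: "(real \<Rightarrow> real) \<Rightarrow> real" where
  "hex_mean f = 1 / (8 * pi\<^sup>2) * integral {0..2 * pi} (\<lambda>y. integral {0..2 * pi} (\<lambda>x.
     f (3 + sqrt (hex_rho x y)) + f (3 - sqrt (hex_rho x y))))"

lemma hex_constant_eq: "hex_constant = hex_mean sqrt"
  by (simp add: hex_constant_def hex_mean_def hex_rho_def)

lemma continuous_on_hex_integrand:
  fixes f :: "real \<Rightarrow> real"
  assumes "continuous_on {0..6} f"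
  shows "continuous_on S (\<lambda>(x, y). f (3 + sqrt (hex_rho x y)) + f (3 - sqrt (hex_rho x y)))"
proof -
  have rho: "continuous_on S (\<lambda>z. sqrt (hex_rho (fst z) (snd z)))"
    unfolding hex_rho_def by (intro continuous_intros)
  have "3 + sqrt (hex_rho x y) \<in> {0..6}" "3 - sqrt (hex_rho x y) \<in> {0..6}" for x y
    unfolding atLeastAtMost_iff using sqrt_hex_rho_bounds[of x y] by (intro conjI; linarith)+
  then have sub: "(\<lambda>z. 3 + sqrt (hex_rho (fst z) (snd z))) ` S \<subseteq> {0..6}"
    "(\<lambda>z. 3 - sqrt (hex_rho (fst z) (snd z))) ` S \<subseteq> {0..6}"
    by blast+
  have "continuous_on S (\<lambda>z. f (3 + sqrt (hex_rho (fst z) (snd z))))"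
    by (rule continuous_on_compose2[OF assms _ sub(1)]) (intro continuous_on_add continuous_on_const rho)
  moreover have "continuous_on S (\<lambda>z. f (3 - sqrt (hex_rho (fst z) (snd z))))"
    by (rule continuous_on_compose2[OF assms _ sub(2)]) (intro continuous_on_diff continuous_on_const rho)
  ultimately show ?thesis
    unfolding case_prod_unfold by (rule continuous_on_add)
qed

lemma integral2_diff_bound:
  fixes F G :: "real \<times> real \<Rightarrow> real"
  assumes "continuous_on UNIV F" "continuous_on UNIV G" "\<And>z. \<bar>F z - G z\<bar> \<le> c"
  shows "\<bar>integral {0..2 * pi} (\<lambda>y. integral {0..2 * pi} (\<lambda>x. F (x, y)))
     - integral {0..2 * pi} (\<lambda>y. integral {0..2 * pi} (\<lambda>x. G (x, y)))\<bar> \<le> c * (4 * pi\<^sup>2)"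
proof -
  have cont: "continuous_on S (\<lambda>x. H (x, y))" "continuous_on {0..2 * pi} (\<lambda>y. integral {0..2 * pi} (\<lambda>x. H (x, y)))"
    if "continuous_on UNIV H" for H :: "real \<times> real \<Rightarrow> real" and S y
    by (rule continuous_on_compose2[OF that]) (auto intro!: continuous_intros continuous_on_integral_fst continuous_on_subset[OF that])
  have inner: "norm (integral {0..2 * pi} (\<lambda>x. F (x, y)) - integral {0..2 * pi} (\<lambda>x. G (x, y))) \<le> c * (2 * pi)" for y
  proof -
    have "norm (integral {0..2 * pi} (\<lambda>x. F (x, y) - G (x, y))) \<le> c * (2 * pi - 0)"
      by (rule integral_bound) (use assms(3) in \<open>auto intro!: continuous_intros cont assms\<close>)
    then show ?thesis
      by (subst integral_diff[symmetric]) (auto intro!: integrable_continuous_real cont assms)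
  qed
  have "norm (integral {0..2 * pi} (\<lambda>y. integral {0..2 * pi} (\<lambda>x. F (x, y)) - integral {0..2 * pi} (\<lambda>x. G (x, y)))) \<le> (c * (2 * pi)) * (2 * pi - 0)"
    by (rule integral_bound) (use inner in \<open>auto intro!: continuous_intros cont assms\<close>)
  then have "norm (integral {0..2 * pi} (\<lambda>y. integral {0..2 * pi} (\<lambda>x. F (x, y)))
     - integral {0..2 * pi} (\<lambda>y. integral {0..2 * pi} (\<lambda>x. G (x, y)))) \<le> (c * (2 * pi)) * (2 * pi)"
    by (subst integral_diff[symmetric]) (auto intro!: integrable_continuous_real cont assms)
  then show ?thesis by (simp add: power2_eq_square mult_ac)
qed

lemma integral2_add_cmult:
  fixes F G :: "real \<times> real \<Rightarrow> real"
  assumes "continuous_on UNIV F" "continuous_on UNIV G"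
  shows "integral {0..2 * pi} (\<lambda>y. integral {0..2 * pi} (\<lambda>x. F (x, y) + c * G (x, y)))
     = integral {0..2 * pi} (\<lambda>y. integral {0..2 * pi} (\<lambda>x. F (x, y)))
     + c * integral {0..2 * pi} (\<lambda>y. integral {0..2 * pi} (\<lambda>x. G (x, y)))"
proof -
  have cont: "continuous_on S (\<lambda>x. H (x, y))" "continuous_on {0..2 * pi} (\<lambda>y. integral {0..2 * pi} (\<lambda>x. H (x, y)))"
    if "continuous_on UNIV H" for H :: "real \<times> real \<Rightarrow> real" and S y
    by (rule continuous_on_compose2[OF that]) (auto intro!: continuous_intros continuous_on_integral_fst continuous_on_subset[OF that])
  have inner: "integral {0..2 * pi} (\<lambda>x. F (x, y) + c * G (x, y))
      = integral {0..2 * pi} (\<lambda>x. F (x, y)) + c * integral {0..2 * pi} (\<lambda>x. G (x, y))" for y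
    by (subst integral_add) (auto intro!: integrable_continuous_real continuous_intros cont assms)
  show ?thesis
    unfolding inner
    by (subst integral_add) (auto intro!: integrable_continuous_real continuous_intros cont assms)
qed

lemma hex_mean_add_cmult:
  assumes "continuous_on {0..6} f" "continuous_on {0..6} g"
  shows "hex_mean (\<lambda>t. f t + c * g t) = hex_mean f + c * hex_mean g"
  using integral2_add_cmult[OF continuous_on_hex_integrand[OF assms(1)] continuous_on_hex_integrand[OF assms(2)], of c]
  by (simp add: hex_mean_def algebra_simps)

lemma mean_functional_hex_mean: "mean_functional 6 hex_mean"
  unfolding mean_functional_def
proof (intro conjI allI impI)
  fix f g :: "real \<Rightarrow> real" and e
  assume cont: "continuous_on {0..6} f" "continuous_on {0..6} g" and fg: "\<forall>x\<in>{0..6}. \<bar>f x - g x\<bar> \<le> e"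
  define I where "I f = integral {0..2 * pi} (\<lambda>y. integral {0..2 * pi} (\<lambda>x.
     f (3 + sqrt (hex_rho x y)) + f (3 - sqrt (hex_rho x y))))" for f :: "real \<Rightarrow> real"
  \<comment> \<open>The two eigenvalues over each point contribute an error of \<open>e\<close>
    apiece; the factor two disappears in the normalisation.\<close>
  have "\<bar>I f - I g\<bar> \<le> (2 * e) * (4 * pi\<^sup>2)"
    unfolding I_def
  proof (rule integral2_diff_bound[OF continuous_on_hex_integrand[OF cont(1)] continuous_on_hex_integrand[OF cont(2)], unfolded prod.case])
    fix z :: "real \<times> real"
    obtain x y where z: "z = (x, y)" by force
    have "\<bar>f (3 + sqrt (hex_rho x y)) - g (3 + sqrt (hex_rho x y))\<bar> \<le> e"
      "\<bar>f (3 - sqrt (hex_rho x y)) - g (3 - sqrt (hex_rho x y))\<bar> \<le> e"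
      using fg sqrt_hex_rho_bounds[of x y] by (auto simp: diff_le_eq intro: add_increasing)
    then show "\<bar>(case z of (x, y) \<Rightarrow> f (3 + sqrt (hex_rho x y)) + f (3 - sqrt (hex_rho x y))) -
        (case z of (x, y) \<Rightarrow> g (3 + sqrt (hex_rho x y)) + g (3 - sqrt (hex_rho x y)))\<bar> \<le> 2 * e"
      unfolding z prod.case by linarith
  qed
  then have "\<bar>I f - I g\<bar> / (8 * pi\<^sup>2) \<le> e"
    by (simp add: divide_le_eq)
  moreover have "hex_mean f - hex_mean g = (I f - I g) / (8 * pi\<^sup>2)"
    by (simp add: hex_mean_def I_def diff_divide_distrib)
  ultimately show "\<bar>hex_mean f - hex_mean g\<bar> \<le> e"
    by (simp add: abs_divide)
next
  fix a :: "nat \<Rightarrow> real" and n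
  show "hex_mean (\<lambda>x. \<Sum>i\<le>n. a i * x ^ i) = (\<Sum>i\<le>n. a i * hex_mean (\<lambda>x. x ^ i))"
  proof (induction n)
    case 0
    show ?case
      using hex_mean_add_cmult[of "\<lambda>_. 0" "\<lambda>_. 1" "a 0"] by (simp add: hex_mean_def)
  next
    case (Suc n)
    have "hex_mean (\<lambda>x. (\<Sum>i\<le>n. a i * x ^ i) + a (Suc n) * x ^ Suc n)
        = hex_mean (\<lambda>x. \<Sum>i\<le>n. a i * x ^ i) + a (Suc n) * hex_mean (\<lambda>x. x ^ Suc n)"
      by (intro hex_mean_add_cmult continuous_intros)
    then show ?case using Suc by simp
  qed
qed

lemma toroidal_moments_tendsto:
  "((\<lambda>p. spectral_mean (hex_toroidal (fst p) (snd p)) (\<lambda>t. t ^ k) - hex_mean (\<lambda>t. t ^ k)) \<longlongrightarrow> 0)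
    (sequentially \<times>\<^sub>F sequentially)"
proof -
  define h where "h = (\<lambda>(x, y). (3 + sqrt (hex_rho x y)) ^ k + (3 - sqrt (hex_rho x y)) ^ k)"
  define A where "A = (\<lambda>(m, n). (\<Sum>q<Suc n. \<Sum>p<Suc m. h (2 * pi * real p / real (Suc m), 2 * pi * real q / real (Suc n)))
           / (real (Suc m) * real (Suc n)))"
  define I where "I = integral {0..2 * pi} (\<lambda>y. integral {0..2 * pi} (\<lambda>x. h (x, y)))"
  have "continuous_on ({0..2 * pi} \<times> {0..2 * pi}) h"
    unfolding h_def by (intro continuous_on_hex_integrand[of "\<lambda>t. t ^ k"] continuous_intros)
  then have "(A \<longlongrightarrow> I / (4 * pi\<^sup>2)) (sequentially \<times>\<^sub>F sequentially)"
    unfolding A_def I_def by (rule riemann_average2_tendsto)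
  then have "((\<lambda>p. A p / 2 - hex_mean (\<lambda>t. t ^ k)) \<longlongrightarrow> I / (4 * pi\<^sup>2) / 2 - hex_mean (\<lambda>t. t ^ k)) (sequentially \<times>\<^sub>F sequentially)"
    by (intro tendsto_intros) auto
  also have "I / (4 * pi\<^sup>2) / 2 - hex_mean (\<lambda>t. t ^ k) = 0"
    by (simp add: hex_mean_def I_def h_def)
  finally have lim: "((\<lambda>p. A p / 2 - hex_mean (\<lambda>t. t ^ k)) \<longlongrightarrow> 0) (sequentially \<times>\<^sub>F sequentially)" .
  have "\<forall>\<^sub>F p in sequentially \<times>\<^sub>F sequentially. 1 \<le> fst p \<and> 1 \<le> snd p"
    by (intro eventually_prodI eventually_ge_at_top)
  then have "\<forall>\<^sub>F p in sequentially \<times>\<^sub>F sequentially. A p / 2 - hex_mean (\<lambda>t. t ^ k)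
      = spectral_mean (hex_toroidal (fst p) (snd p)) (\<lambda>t. t ^ k) - hex_mean (\<lambda>t. t ^ k)"
    by eventually_elim (simp only: spectral_mean_toroidal_power A_def h_def case_prod_unfold fst_conv snd_conv)
  with lim show ?thesis by (rule Lim_transform_eventually)
qed

section \<open>Comparison of the boundary conditions\<close>

lemma vertex_degree_mono:
  assumes "simple_graph G" "snd H \<subseteq> snd G"
  shows "vertex_degree H v \<le> vertex_degree G v"
proof -
  have "snd G \<subseteq> Pow (fst G)" using assms(1) by (auto simp: simple_graph_def)
  moreover have "finite (fst G)" using assms(1) by (simp add: simple_graph_def)
  ultimately have "finite (snd G)" by (simp add: finite_subset)
  then show ?thesis
    unfolding vertex_degree_def using assms(2) by (intro card_mono) auto
qed

lemma hex_subgraphs: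
  "snd (hex_cylindrical m n) \<subseteq> snd (hex_toroidal m n)" "snd (hex_free m n) \<subseteq> snd (hex_cylindrical m n)"
  by (auto simp: hex_cylindrical_def hex_free_def)

lemma vertex_degree_hex:
  assumes "m \<ge> 1" "n \<ge> 1" "v \<in> hex_vertices m n"
  shows "vertex_degree (hex_toroidal m n) v \<le> 3" "vertex_degree (hex_cylindrical m n) v \<le> 3" "vertex_degree (hex_free m n) v \<le> 3"
proof -
  have fib: "fst (hex_pos v) \<in> hex_fiber m"
    using bij_betw_apply[OF bij_betw_hex_pos assms(3)] by auto
  have "real (vertex_degree (hex_toroidal m n) v) = (\<Sum>h\<in>hex_fiber m. row_adj (\<lambda>i i'. i' = Suc i mod Suc m) (fst (hex_pos v)) h
      + next_row_adj (fst (hex_pos v)) h + next_row_adj h (fst (hex_pos v)))"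
    by (rule vertex_degree_shift_kernel[OF simple_graph_hex_toroidal finite_hex_fiber zero_less_Suc, of hex_pos m n m n])
      (use assms bij_betw_hex_pos hex_toroidal_shift_kernel in auto)
  then have "complex_of_real (real (vertex_degree (hex_toroidal m n) v)) = 3"
    using hex_toroidal_fiber_degree[OF assms(1) fib] by (simp only: of_real_sum)
  then show t: "vertex_degree (hex_toroidal m n) v \<le> 3"
    by (metis of_nat_eq_iff of_nat_numeral of_real_of_nat_eq order_refl)
  show "vertex_degree (hex_cylindrical m n) v \<le> 3"
    by (rule order_trans[OF vertex_degree_mono[OF simple_graph_hex_toroidal hex_subgraphs(1)] t])
  then show "vertex_degree (hex_free m n) v \<le> 3"
    by (rule order_trans[OF vertex_degree_mono[OF simple_graph_hex_cylindrical hex_subgraphs(2)]])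
qed

text \<open>At most \<open>n + 1\<close> edges are removed, each costing \<open>4\<close>, and the
  mean divides by \<open>2 * (m + 1) * (n + 1)\<close>. The quotient is small only for large
  \<open>m\<close>. The base \<open>6\<close> is twice the maximal degree.\<close>

lemma cylindrical_moment_diff:
  assumes "m \<ge> 1" "n \<ge> 1"
  shows "\<bar>spectral_mean (hex_toroidal m n) (\<lambda>t. t ^ k) - spectral_mean (hex_cylindrical m n) (\<lambda>t. t ^ k)\<bar>
    \<le> 2 * (real k * 6 ^ (k - 1)) / real (Suc m)"
proof -
  define P where "P = (\<lambda>j. ((m, j, 0), (0, j, 1)) :: hex_vertex \<times> hex_vertex) ` {0..n}"
  have P: "finite P" "card P \<le> Suc n"
    using card_image_le[of "{0..n}" "\<lambda>j. ((m, j, 0), (0, j, 1)) :: hex_vertex \<times> hex_vertex"] by (auto simp: P_def)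
  have "\<bar>ker_trace (fst (hex_toroidal m n)) (lap_kernel (hex_toroidal m n)) k
       - ker_trace (fst (hex_toroidal m n)) (lap_kernel (hex_cylindrical m n)) k\<bar> \<le> real k * (2 * real 3) ^ (k - 1) * (4 * real (card P))"
    by (rule ker_trace_lap_kernel_edge_removal[OF simple_graph_hex_toroidal simple_graph_hex_cylindrical])
      (use assms P vertex_degree_hex hex_subgraphs in \<open>auto simp: hex_cylindrical_def P_def image_iff\<close>)
  also have "\<dots> \<le> real k * (2 * real 3) ^ (k - 1) * (4 * real (Suc n))"
    using P(2) by (intro mult_left_mono) auto
  finally have "\<bar>ker_trace (hex_vertices m n) (lap_kernel (hex_toroidal m n)) k
       - ker_trace (hex_vertices m n) (lap_kernel (hex_cylindrical m n)) k\<bar> / (2 * real (Suc m) * real (Suc n))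
     \<le> real k * 6 ^ (k - 1) * (4 * real (Suc n)) / (2 * real (Suc m) * real (Suc n))"
    by (intro divide_right_mono) simp_all
  also have "\<dots> = 2 * (real k * 6 ^ (k - 1)) / real (Suc m)"
    by (simp add: field_simps del: of_nat_Suc)
  finally have *: "\<bar>ker_trace (hex_vertices m n) (lap_kernel (hex_toroidal m n)) k
       - ker_trace (hex_vertices m n) (lap_kernel (hex_cylindrical m n)) k\<bar> / (2 * real (Suc m) * real (Suc n))
     \<le> 2 * (real k * 6 ^ (k - 1)) / real (Suc m)" .
  have card: "real (card (hex_vertices m n)) = 2 * real (Suc m) * real (Suc n)"
    unfolding card_hex_vertices by (simp add: algebra_simps)
  show ?thesis
    unfolding spectral_mean_power[OF simple_graph_hex_toroidal] spectral_mean_power[OF simple_graph_hex_cylindrical]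
      fst_hex card diff_divide_distrib[symmetric] abs_divide
    using * by simp
qed

text \<open>Here at most \<open>m + 1\<close> edges are removed, so the difference vanishes as
  \<open>n\<close> grows even for fixed \<open>m\<close>. This carries the inner limit from the
  cylinder to the free lattice.\<close>

lemma free_moment_diff:
  assumes "m \<ge> 1" "n \<ge> 1"
  shows "\<bar>spectral_mean (hex_cylindrical m n) (\<lambda>t. t ^ k) - spectral_mean (hex_free m n) (\<lambda>t. t ^ k)\<bar>
    \<le> 2 * (real k * 6 ^ (k - 1)) / real (Suc n)"
proof -
  define P where "P = (\<lambda>i. ((i, n, 0), (i, 0, 1)) :: hex_vertex \<times> hex_vertex) ` {0..m}"
  have P: "finite P" "card P \<le> Suc m"
    using card_image_le[of "{0..m}" "\<lambda>i. ((i, n, 0), (i, 0, 1)) :: hex_vertex \<times> hex_vertex"] by (auto simp: P_def)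
  have "\<bar>ker_trace (fst (hex_cylindrical m n)) (lap_kernel (hex_cylindrical m n)) k
       - ker_trace (fst (hex_cylindrical m n)) (lap_kernel (hex_free m n)) k\<bar> \<le> real k * (2 * real 3) ^ (k - 1) * (4 * real (card P))"
    by (rule ker_trace_lap_kernel_edge_removal[OF simple_graph_hex_cylindrical simple_graph_hex_free])
      (use assms P vertex_degree_hex hex_subgraphs in \<open>auto simp: hex_free_def P_def image_iff\<close>)
  also have "\<dots> \<le> real k * (2 * real 3) ^ (k - 1) * (4 * real (Suc m))"
    using P(2) by (intro mult_left_mono) auto
  finally have "\<bar>ker_trace (hex_vertices m n) (lap_kernel (hex_cylindrical m n)) k
       - ker_trace (hex_vertices m n) (lap_kernel (hex_free m n)) k\<bar> / (2 * real (Suc m) * real (Suc n))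
     \<le> real k * 6 ^ (k - 1) * (4 * real (Suc m)) / (2 * real (Suc m) * real (Suc n))"
    by (intro divide_right_mono) simp_all
  also have "\<dots> = 2 * (real k * 6 ^ (k - 1)) / real (Suc n)"
    by (simp add: field_simps del: of_nat_Suc)
  finally have *: "\<bar>ker_trace (hex_vertices m n) (lap_kernel (hex_cylindrical m n)) k
       - ker_trace (hex_vertices m n) (lap_kernel (hex_free m n)) k\<bar> / (2 * real (Suc m) * real (Suc n))
     \<le> 2 * (real k * 6 ^ (k - 1)) / real (Suc n)" .
  have card: "real (card (hex_vertices m n)) = 2 * real (Suc m) * real (Suc n)"
    unfolding card_hex_vertices by (simp add: algebra_simps)
  show ?thesis
    unfolding spectral_mean_power[OF simple_graph_hex_cylindrical] spectral_mean_power[OF simple_graph_hex_free]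
      fst_hex card diff_divide_distrib[symmetric] abs_divide
    using * by simp
qed

lemma mean_functional_hex:
  assumes "m \<ge> 1" "n \<ge> 1"
  shows "mean_functional 6 (spectral_mean (hex_toroidal m n))" "mean_functional 6 (spectral_mean (hex_cylindrical m n))"
    "mean_functional 6 (spectral_mean (hex_free m n))"
proof -
  have ne: "hex_vertices m n \<noteq> {}" by (auto simp: hex_vertices_def)
  show "mean_functional 6 (spectral_mean (hex_toroidal m n))"
    using mean_functional_spectral_mean[OF simple_graph_hex_toroidal, of m n 3] vertex_degree_hex[OF assms] ne by simp
  show "mean_functional 6 (spectral_mean (hex_cylindrical m n))"
    using mean_functional_spectral_mean[OF simple_graph_hex_cylindrical, of m n 3] vertex_degree_hex[OF assms] ne by simp
  show "mean_functional 6 (spectral_mean (hex_free m n))"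
    using mean_functional_spectral_mean[OF simple_graph_hex_free, of m n 3] vertex_degree_hex[OF assms] ne by simp
qed

text \<open>The denominator is weakened from the number of vertices to \<open>n + 1\<close> so that
  the same bound serves the joint limit and the limit for fixed \<open>m\<close>.\<close>

lemma LEL_hex_diff:
  assumes "m \<ge> 1" "n \<ge> 1" "H \<in> {hex_toroidal, hex_cylindrical, hex_free}"
  shows "\<bar>LEL (H m n) / (2 * (real m + 1) * (real n + 1)) - spectral_mean (H m n) sqrt\<bar> \<le> sqrt 6 / real (Suc n)"
proof -
  have ne: "hex_vertices m n \<noteq> {}" by (auto simp: hex_vertices_def)
  have card: "real (card (fst (H m n))) = 2 * (real m + 1) * (real n + 1)"
    using assms(3) card_hex_vertices[of m n] by (auto simp: algebra_simps)
  have "\<bar>LEL (H m n) / real (card (fst (H m n))) - spectral_mean (H m n) sqrt\<bar> \<le> sqrt (2 * real 3) / real (card (fst (H m n)))"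
    using assms(3) ne vertex_degree_hex[OF assms(1,2)]
    by (intro LEL_spectral_mean) (auto simp: simple_graph_hex_toroidal simple_graph_hex_cylindrical simple_graph_hex_free)
  also have "\<dots> \<le> sqrt 6 / real (Suc n)"
    unfolding card by (intro frac_le) (auto simp: algebra_simps)
  finally show ?thesis unfolding card .
qed

section \<open>Joint and iterated limits\<close>

text \<open>A joint limit need not imply that the inner limits exist; once they do, the joint
  estimate for large \<open>m\<close> and \<open>n\<close> passes to the limit in \<open>n\<close>
  as a weak inequality.\<close>

lemma has_iterated_limitI:
  assumes joint: "((\<lambda>(m, n). f m n) \<longlongrightarrow> c) (sequentially \<times>\<^sub>F sequentially)"
    and inner: "\<And>m. m \<ge> 1 \<Longrightarrow> convergent (f m)"
  shows "has_iterated_limit f c"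
  unfolding has_iterated_limit_def
proof (intro exI[of _ "\<lambda>m. lim (f m)"] conjI allI impI)
  show lim: "f m \<longlonglongrightarrow> lim (f m)" if "m \<ge> 1" for m
    using inner[OF that] by (simp add: convergent_LIMSEQ_iff)
  show "(\<lambda>m. lim (f m)) \<longlonglongrightarrow> c"
  proof (rule tendstoI)
    fix e :: real assume "e > 0"
    then have "\<forall>\<^sub>F (m, n) in sequentially \<times>\<^sub>F sequentially. dist (f m n) c < e / 2"
      using tendstoD[OF joint, of "e / 2"] by (simp add: case_prod_unfold)
    then obtain N where N: "\<And>m n. m \<ge> N \<Longrightarrow> n \<ge> N \<Longrightarrow> dist (f m n) c < e / 2"
      by (auto simp: eventually_prod_sequentially)
    show "\<forall>\<^sub>F m in sequentially. dist (lim (f m)) c < e"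
      using eventually_ge_at_top[of "max 1 N"]
    proof eventually_elim
      case (elim m)
      have "(\<lambda>n. dist (f m n) c) \<longlonglongrightarrow> dist (lim (f m)) c"
        using lim[of m] elim by (intro tendsto_intros) auto
      moreover have "\<forall>\<^sub>F n in sequentially. dist (f m n) c \<le> e / 2"
        using eventually_ge_at_top[of N] by eventually_elim (use N elim in force)
      ultimately have "dist (lim (f m)) c \<le> e / 2"
        by (intro tendsto_upperbound) auto
      then show ?case using \<open>e > 0\<close> by simp
    qed
  qed
qed

lemma eventually_ge_one_prod: "\<forall>\<^sub>F p in sequentially \<times>\<^sub>F sequentially. 1 \<le> fst p \<and> (1::nat) \<le> snd p"
  by (intro eventually_prodI eventually_ge_at_top)

lemma tendsto_const_over_Suc: "(\<lambda>n. c / real (Suc n)) \<longlonglongrightarrow> (0::real)"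
  by (intro LIMSEQ_Suc lim_const_over_n)

lemma spectral_mean_sqrt_joint:
  assumes H: "H \<in> {hex_toroidal, hex_cylindrical, hex_free}"
  shows "((\<lambda>p. spectral_mean (H (fst p) (snd p)) sqrt) \<longlongrightarrow> hex_constant) (sequentially \<times>\<^sub>F sequentially)"
proof -
  let ?\<Phi> = "sequentially \<times>\<^sub>F sequentially :: (nat \<times> nat) filter"
  have cont: "continuous_on {0..6} sqrt" by (intro continuous_intros)
  have mean: "\<forall>\<^sub>F p in ?\<Phi>. mean_functional 6 (spectral_mean (H (fst p) (snd p)))"
    if "H \<in> {hex_toroidal, hex_cylindrical, hex_free}" for H
    using eventually_ge_one_prod by eventually_elim (use that mean_functional_hex in auto)
  have "((\<lambda>p. spectral_mean (hex_toroidal (fst p) (snd p)) sqrt - hex_mean sqrt) \<longlongrightarrow> 0) ?\<Phi>"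
    by (rule mean_functionals_tendsto[OF eventually_conj[OF mean] toroidal_moments_tendsto cont])
      (auto simp: mean_functional_hex_mean)
  then have tor: "((\<lambda>p. spectral_mean (hex_toroidal (fst p) (snd p)) sqrt) \<longlongrightarrow> hex_constant) ?\<Phi>"
    unfolding hex_constant_eq by (simp add: LIM_zero_iff)
  have "((\<lambda>p. spectral_mean (hex_toroidal (fst p) (snd p)) sqrt - spectral_mean (hex_cylindrical (fst p) (snd p)) sqrt) \<longlongrightarrow> 0) ?\<Phi>"
  proof (rule mean_functionals_tendsto[OF eventually_conj[OF mean mean] _ cont])
    fix k
    show "((\<lambda>p. spectral_mean (hex_toroidal (fst p) (snd p)) (\<lambda>t. t ^ k) - spectral_mean (hex_cylindrical (fst p) (snd p)) (\<lambda>t. t ^ k)) \<longlongrightarrow> 0) ?\<Phi>"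
    proof (rule Lim_null_comparison)
      show "\<forall>\<^sub>F p in ?\<Phi>. norm (spectral_mean (hex_toroidal (fst p) (snd p)) (\<lambda>t. t ^ k) - spectral_mean (hex_cylindrical (fst p) (snd p)) (\<lambda>t. t ^ k))
          \<le> 2 * (real k * 6 ^ (k - 1)) / real (Suc (fst p))"
        using eventually_ge_one_prod by eventually_elim (simp only: real_norm_def cylindrical_moment_diff)
      show "((\<lambda>p. 2 * (real k * 6 ^ (k - 1)) / real (Suc (fst p))) \<longlongrightarrow> 0) ?\<Phi>"
        by (rule filterlim_compose[OF tendsto_const_over_Suc filterlim_fst])
    qed
  qed auto
  from tendsto_diff[OF tor this]
  have cyl: "((\<lambda>p. spectral_mean (hex_cylindrical (fst p) (snd p)) sqrt) \<longlongrightarrow> hex_constant) ?\<Phi>" by simp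
  have "((\<lambda>p. spectral_mean (hex_cylindrical (fst p) (snd p)) sqrt - spectral_mean (hex_free (fst p) (snd p)) sqrt) \<longlongrightarrow> 0) ?\<Phi>"
  proof (rule mean_functionals_tendsto[OF eventually_conj[OF mean mean] _ cont])
    fix k
    show "((\<lambda>p. spectral_mean (hex_cylindrical (fst p) (snd p)) (\<lambda>t. t ^ k) - spectral_mean (hex_free (fst p) (snd p)) (\<lambda>t. t ^ k)) \<longlongrightarrow> 0) ?\<Phi>"
    proof (rule Lim_null_comparison)
      show "\<forall>\<^sub>F p in ?\<Phi>. norm (spectral_mean (hex_cylindrical (fst p) (snd p)) (\<lambda>t. t ^ k) - spectral_mean (hex_free (fst p) (snd p)) (\<lambda>t. t ^ k))
          \<le> 2 * (real k * 6 ^ (k - 1)) / real (Suc (snd p))"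
        using eventually_ge_one_prod by eventually_elim (simp only: real_norm_def free_moment_diff)
      show "((\<lambda>p. 2 * (real k * 6 ^ (k - 1)) / real (Suc (snd p))) \<longlongrightarrow> 0) ?\<Phi>"
        by (rule filterlim_compose[OF tendsto_const_over_Suc filterlim_snd])
    qed
  qed auto
  from tendsto_diff[OF cyl this]
  have "((\<lambda>p. spectral_mean (hex_free (fst p) (snd p)) sqrt) \<longlongrightarrow> hex_constant) ?\<Phi>" by simp
  with tor cyl H show ?thesis by auto
qed

text \<open>Torus and cylinder are periodic in \<open>j\<close>, so their moments are Riemann
  averages in one variable. The free lattice is not, and is reached by its vanishing distance from
  the cylinder.\<close>

lemma spectral_mean_sqrt_convergent:
  assumes m: "m \<ge> 1" and H: "H \<in> {hex_toroidal, hex_cylindrical, hex_free}"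
  shows "convergent (\<lambda>n. spectral_mean (H m n) sqrt)"
proof -
  have cont: "continuous_on {0..6} sqrt" by (intro continuous_intros)
  have mean: "\<forall>\<^sub>F n in sequentially. mean_functional 6 (spectral_mean (H m n))"
    if "H \<in> {hex_toroidal, hex_cylindrical, hex_free}" for H
    using eventually_ge_at_top[of 1] by eventually_elim (use that m mean_functional_hex in auto)
  have tor: "convergent (\<lambda>n. spectral_mean (hex_toroidal m n) sqrt)"
    by (intro mean_functionals_convergent[OF mean _ cont]
        spectral_mean_moment_convergent[OF simple_graph_hex_toroidal fst_hex(1) ker_trace_hex_toroidal continuous_on_ker_trace_row_symbol]) auto
  have cyl: "convergent (\<lambda>n. spectral_mean (hex_cylindrical m n) sqrt)"
    by (intro mean_functionals_convergent[OF mean _ cont]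
        spectral_mean_moment_convergent[OF simple_graph_hex_cylindrical fst_hex(2) ker_trace_hex_cylindrical[OF m] continuous_on_ker_trace_row_symbol]) auto
  have "(\<lambda>n. spectral_mean (hex_cylindrical m n) sqrt - spectral_mean (hex_free m n) sqrt) \<longlonglongrightarrow> 0"
  proof (rule mean_functionals_tendsto[OF eventually_conj[OF mean mean] _ cont])
    fix k
    show "(\<lambda>n. spectral_mean (hex_cylindrical m n) (\<lambda>t. t ^ k) - spectral_mean (hex_free m n) (\<lambda>t. t ^ k)) \<longlonglongrightarrow> 0"
    proof (rule Lim_null_comparison)
      show "\<forall>\<^sub>F n in sequentially. norm (spectral_mean (hex_cylindrical m n) (\<lambda>t. t ^ k) - spectral_mean (hex_free m n) (\<lambda>t. t ^ k))
          \<le> 2 * (real k * 6 ^ (k - 1)) / real (Suc n)"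
        using eventually_ge_at_top[of 1] by eventually_elim (simp only: real_norm_def free_moment_diff[OF m])
    qed (rule tendsto_const_over_Suc)
  qed auto
  then have "convergent (\<lambda>n. spectral_mean (hex_cylindrical m n) sqrt - spectral_mean (hex_free m n) sqrt)"
    by (rule convergentI)
  from convergent_diff[OF cyl this] have "convergent (\<lambda>n. spectral_mean (hex_free m n) sqrt)" by simp
  with tor cyl H show ?thesis by auto
qed

lemma LEL_hex_joint:
  assumes H: "H \<in> {hex_toroidal, hex_cylindrical, hex_free}"
  shows "((\<lambda>(m, n). LEL (H m n) / (2 * (real m + 1) * (real n + 1))) \<longlongrightarrow> hex_constant) (sequentially \<times>\<^sub>F sequentially)"
proof -
  let ?\<Phi> = "sequentially \<times>\<^sub>F sequentially :: (nat \<times> nat) filter"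
  define f where "f = (\<lambda>p. LEL (H (fst p) (snd p)) / (2 * (real (fst p) + 1) * (real (snd p) + 1)))"
  have "((\<lambda>p. f p - spectral_mean (H (fst p) (snd p)) sqrt) \<longlongrightarrow> 0) ?\<Phi>"
  proof (rule Lim_null_comparison)
    show "\<forall>\<^sub>F p in ?\<Phi>. norm (f p - spectral_mean (H (fst p) (snd p)) sqrt) \<le> sqrt 6 / real (Suc (snd p))"
      using eventually_ge_one_prod by eventually_elim (simp only: real_norm_def f_def LEL_hex_diff[OF _ _ H])
    show "((\<lambda>p. sqrt 6 / real (Suc (snd p))) \<longlongrightarrow> 0) ?\<Phi>"
      by (rule filterlim_compose[OF tendsto_const_over_Suc filterlim_snd])
  qed
  from tendsto_add[OF this spectral_mean_sqrt_joint[OF H]] show ?thesis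
    by (simp add: f_def case_prod_unfold)
qed

lemma LEL_hex_iterated:
  assumes H: "H \<in> {hex_toroidal, hex_cylindrical, hex_free}"
  shows "has_iterated_limit (\<lambda>m n. LEL (H m n) / (2 * (real m + 1) * (real n + 1))) hex_constant"
proof (rule has_iterated_limitI[OF LEL_hex_joint[OF H]])
  fix m :: nat assume m: "m \<ge> 1"
  have "(\<lambda>n. LEL (H m n) / (2 * (real m + 1) * (real n + 1)) - spectral_mean (H m n) sqrt) \<longlonglongrightarrow> 0"
  proof (rule Lim_null_comparison)
    show "\<forall>\<^sub>F n in sequentially. norm (LEL (H m n) / (2 * (real m + 1) * (real n + 1)) - spectral_mean (H m n) sqrt) \<le> sqrt 6 / real (Suc n)"
      using eventually_ge_at_top[of 1] by eventually_elim (simp only: real_norm_def LEL_hex_diff[OF m _ H])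
  qed (rule tendsto_const_over_Suc)
  from convergent_add[OF convergentI[OF this] spectral_mean_sqrt_convergent[OF m H]]
  show "convergent (\<lambda>n. LEL (H m n) / (2 * (real m + 1) * (real n + 1)))" by simp
qed

lemma LEL_hex_asymp_equiv:
  assumes H: "H \<in> {hex_toroidal, hex_cylindrical, hex_free}" and "hex_constant \<noteq> 0"
  shows "(\<lambda>(m, n). LEL (H m n)) \<sim>[sequentially \<times>\<^sub>F sequentially] (\<lambda>(m, n). 2 * hex_constant * (real m + 1) * (real n + 1))"
proof (rule asymp_equivI')
  have "((\<lambda>p. (case p of (m, n) \<Rightarrow> LEL (H m n) / (2 * (real m + 1) * (real n + 1))) / hex_constant) \<longlongrightarrow> hex_constant / hex_constant)
      (sequentially \<times>\<^sub>F sequentially)"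
    by (intro tendsto_divide LEL_hex_joint H tendsto_const assms(2))
  then show "((\<lambda>p. (case p of (m, n) \<Rightarrow> LEL (H m n)) / (case p of (m, n) \<Rightarrow> 2 * hex_constant * (real m + 1) * (real n + 1))) \<longlongrightarrow> 1)
      (sequentially \<times>\<^sub>F sequentially)"
    using assms(2) by (simp add: case_prod_unfold mult_ac)
qed

section \<open>Numerical bounds\<close>

text \<open>Legendre's three-term recurrence: with \<open>z = A + P cos x + Q sin x\<close>, integrate the derivative of
  \<open>z' z ^ (l + 1)\<close> over a period.\<close>

lemma trig_linear_power_recurrence:
  fixes A P Q :: real
  defines "I \<equiv> \<lambda>k. integral {0..2 * pi} (\<lambda>x. (A + P * cos x + Q * sin x) ^ k)"
  shows "I 0 = 2 * pi" "I 1 = 2 * pi * A"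
    "real (l + 2) * I (l + 2) = real (2 * l + 3) * A * I (l + 1) - real (l + 1) * (A\<^sup>2 - (P\<^sup>2 + Q\<^sup>2)) * I l"
proof -
  define z where "z x = A + P * cos x + Q * sin x" for x
  define z' where "z' x = Q * cos x - P * sin x" for x
  have dz: "(z has_real_derivative z' x) (at x within S)" "(z' has_real_derivative A - z x) (at x within S)" for x S
    unfolding z_def z'_def by (auto intro!: derivative_eq_intros)
  \<comment> \<open>Together with \<open>z'' = A - z\<close> this makes the derivative of
    \<open>z' * z ^ (l + 1)\<close> a polynomial in \<open>z\<close> alone, so that integration
    gives a relation between the \<open>I k\<close>.\<close>
  have z'2: "(z' x)\<^sup>2 = P\<^sup>2 + Q\<^sup>2 - (z x - A)\<^sup>2" for x
  proof -
    have "(sin x)\<^sup>2 = 1 - (cos x)\<^sup>2" by (simp add: sin_squared_eq)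
    then show ?thesis by (simp add: z_def z'_def) Groebner_Basis.algebra
  qed
  have per: "z (2 * pi) = z 0" "z' (2 * pi) = z' 0" by (simp_all add: z_def z'_def)
  have contz: "continuous_on S z" for S unfolding z_def by (intro continuous_intros)
  have hI: "((\<lambda>x. z x ^ k) has_integral I k) {0..2 * pi}" for k
    unfolding I_def z_def[symmetric]
    by (intro integrable_integral integrable_continuous_real continuous_intros contz)
  show I0: "I 0 = 2 * pi" by (simp add: I_def)
  have "((\<lambda>x. A - z x) has_integral (z' (2 * pi) - z' 0)) {0..2 * pi}"
    by (rule fundamental_theorem_of_calculus)
      (auto intro: dz simp: has_real_derivative_iff_has_vector_derivative[symmetric])
  then have "((\<lambda>x. A * z x ^ 0 - z x ^ 1) has_integral 0) {0..2 * pi}"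
    by (simp add: per)
  moreover have "((\<lambda>x. A * z x ^ 0 - z x ^ 1) has_integral (A * I 0 - I 1)) {0..2 * pi}"
    by (intro has_integral_diff has_integral_mult_right hI)
  ultimately have "A * I 0 - I 1 = 0"
    by (rule has_integral_unique[symmetric])
  then show "I 1 = 2 * pi * A"
    unfolding I0 by (simp add: mult_ac)
  have "((\<lambda>x. (A - z x) * z x ^ (l + 1) + z' x * (real (l + 1) * z x ^ l * z' x))
      has_integral (z' (2 * pi) * z (2 * pi) ^ (l + 1) - z' 0 * z 0 ^ (l + 1))) {0..2 * pi}"
  proof (rule fundamental_theorem_of_calculus)
    fix x assume "x \<in> {0..2 * pi}"
    have "((\<lambda>x. z x ^ (l + 1)) has_real_derivative real (l + 1) * z x ^ l * z' x) (at x within {0..2 * pi})"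
      using DERIV_power[OF dz(1)[of x "{0..2 * pi}"], of "l + 1"] by (simp add: mult_ac)
    from DERIV_mult[OF dz(2) this]
    show "((\<lambda>x. z' x * z x ^ (l + 1)) has_vector_derivative
        (A - z x) * z x ^ (l + 1) + z' x * (real (l + 1) * z x ^ l * z' x)) (at x within {0..2 * pi})"
      unfolding has_real_derivative_iff_has_vector_derivative by (simp add: mult_ac)
  qed simp
  moreover have "(A - z x) * z x ^ (l + 1) + z' x * (real (l + 1) * z x ^ l * z' x)
     = real (2 * l + 3) * A * z x ^ (l + 1) - real (l + 2) * z x ^ (l + 2) - real (l + 1) * (A\<^sup>2 - (P\<^sup>2 + Q\<^sup>2)) * z x ^ l" for x
  proof -
    have "z' x * (real (l + 1) * z x ^ l * z' x) = real (l + 1) * z x ^ l * (z' x)\<^sup>2"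
      by (simp add: power2_eq_square)
    then show ?thesis
      unfolding z'2 by (simp add: algebra_simps power2_eq_square)
  qed
  ultimately have "((\<lambda>x. real (2 * l + 3) * A * z x ^ (l + 1) - real (l + 2) * z x ^ (l + 2)
      - real (l + 1) * (A\<^sup>2 - (P\<^sup>2 + Q\<^sup>2)) * z x ^ l) has_integral 0) {0..2 * pi}"
    by (simp add: per)
  moreover have "((\<lambda>x. real (2 * l + 3) * A * z x ^ (l + 1) - real (l + 2) * z x ^ (l + 2)
      - real (l + 1) * (A\<^sup>2 - (P\<^sup>2 + Q\<^sup>2)) * z x ^ l)
      has_integral (real (2 * l + 3) * A * I (l + 1) - real (l + 2) * I (l + 2) - real (l + 1) * (A\<^sup>2 - (P\<^sup>2 + Q\<^sup>2)) * I l)) {0..2 * pi}"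
    by (intro has_integral_diff has_integral_mult_right hI)
  ultimately have "real (2 * l + 3) * A * I (l + 1) - real (l + 2) * I (l + 2) - real (l + 1) * (A\<^sup>2 - (P\<^sup>2 + Q\<^sup>2)) * I l = 0"
    by (rule has_integral_unique[symmetric])
  then show "real (l + 2) * I (l + 2) = real (2 * l + 3) * A * I (l + 1) - real (l + 1) * (A\<^sup>2 - (P\<^sup>2 + Q\<^sup>2)) * I l"
    by simp
qed

section \<open>Exact moments of \<open>9 - hex_rho\<close>\<close>

definition cpoly :: "real \<Rightarrow> real \<Rightarrow> real \<Rightarrow> real \<Rightarrow> real \<Rightarrow> real \<Rightarrow> real \<Rightarrow> real \<Rightarrow> real \<Rightarrow> real \<Rightarrow> real" where
  "cpoly a0 a1 a2 a3 a4 a5 a6 a7 a8 c =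
     a0 * c ^ 0 + a1 * c ^ 1 + a2 * c ^ 2 + a3 * c ^ 3 + a4 * c ^ 4 + a5 * c ^ 5 + a6 * c ^ 6 + a7 * c ^ 7 + a8 * c ^ 8"

text \<open>The mean of an odd power of the cosine vanishes, and that of the power
  \<open>2 * k\<close> is the central binomial coefficient over \<open>4 ^ k\<close>.\<close>

lemma integral_cpoly_cos:
  "integral {0..2 * pi} (\<lambda>y. 2 * pi * cpoly a0 a1 a2 a3 a4 a5 a6 a7 a8 (cos y))
    = 4 * pi\<^sup>2 * (a0 + a2 / 2 + 3 / 8 * a4 + 5 / 16 * a6 + 35 / 128 * a8)"
proof -
  define J where "J k = integral {0..2 * pi} (\<lambda>y. cos y ^ k)" for k
  have hJ: "((\<lambda>y. cos y ^ k) has_integral J k) {0..2 * pi}" for k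
    unfolding J_def by (intro integrable_integral integrable_continuous_real continuous_intros)
  have J01: "J 0 = 2 * pi" "J 1 = 0"
    using trig_linear_power_recurrence(1,2)[of 0 1 0] by (simp_all add: J_def)
  have rec: "real (l + 2) * J (l + 2) = real (l + 1) * J l" for l
    using trig_linear_power_recurrence(3)[of l 0 1 0] by (simp add: J_def algebra_simps)
  have J: "J 2 = pi" "J 3 = 0" "J 4 = 3 / 4 * pi" "J 5 = 0" "J 6 = 5 / 8 * pi" "J 7 = 0" "J 8 = 35 / 64 * pi"
    using rec[of 0] rec[of 1] rec[of 2] rec[of 3] rec[of 4] rec[of 5] rec[of 6] J01
    by (simp_all add: numeral_eq_Suc field_simps)
  have "((\<lambda>y. 2 * pi * cpoly a0 a1 a2 a3 a4 a5 a6 a7 a8 (cos y)) has_integral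
      2 * pi * (a0 * J 0 + a1 * J 1 + a2 * J 2 + a3 * J 3 + a4 * J 4 + a5 * J 5 + a6 * J 6 + a7 * J 7 + a8 * J 8)) {0..2 * pi}"
    unfolding cpoly_def by (intro has_integral_mult_right has_integral_add hJ)
  then have "integral {0..2 * pi} (\<lambda>y. 2 * pi * cpoly a0 a1 a2 a3 a4 a5 a6 a7 a8 (cos y))
      = 2 * pi * (a0 * J 0 + a1 * J 1 + a2 * J 2 + a3 * J 3 + a4 * J 4 + a5 * J 5 + a6 * J 6 + a7 * J 7 + a8 * J 8)"
    by (rule integral_unique)
  also have "\<dots> = 4 * pi\<^sup>2 * (a0 + a2 / 2 + 3 / 8 * a4 + 5 / 16 * a6 + 35 / 128 * a8)"
    unfolding J01 J by (simp add: field_simps power2_eq_square)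
  finally show ?thesis .
qed

text \<open>For fixed \<open>y\<close> the base is linear in \<open>cos x\<close> and
  \<open>sin x\<close>. Both parameters of the recurrence, the constant term \<open>A\<close> and
  \<open>A\<^sup>2 - (P\<^sup>2 + Q\<^sup>2)\<close>, are polynomials in \<open>cos y\<close>, and
  hence so are all the inner moments up to the factor \<open>2 * pi\<close>.\<close>

lemma hex_rho_inner_moments:
  shows
    "integral {0..2 * pi} (\<lambda>x. (9 - hex_rho x y) ^ 0) = 2 * pi * cpoly 1 0 0 0 0 0 0 0 0 (cos y)" 
    "integral {0..2 * pi} (\<lambda>x. (9 - hex_rho x y) ^ 1) = 2 * pi * cpoly 6 (- 2) 0 0 0 0 0 0 0 (cos y)" 
    "integral {0..2 * pi} (\<lambda>x. (9 - hex_rho x y) ^ 2) = 2 * pi * cpoly 40 (- 20) 4 0 0 0 0 0 0 (cos y)" 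
    "integral {0..2 * pi} (\<lambda>x. (9 - hex_rho x y) ^ 3) = 2 * pi * cpoly 288 (- 168) 48 (- 8) 0 0 0 0 0 (cos y)" 
    "integral {0..2 * pi} (\<lambda>x. (9 - hex_rho x y) ^ 4) = 2 * pi * cpoly 2184 (- 1392) 408 (- 96) 16 0 0 0 0 (cos y)" 
    "integral {0..2 * pi} (\<lambda>x. (9 - hex_rho x y) ^ 5) = 2 * pi * cpoly 17136 (- 11760) 3120 (- 560) 160 (- 32) 0 0 0 (cos y)" 
    "integral {0..2 * pi} (\<lambda>x. (9 - hex_rho x y) ^ 6) = 2 * pi * cpoly 137536 (- 101472) 23520 160 (- 480) (- 192) 64 0 0 (cos y)" 
    "integral {0..2 * pi} (\<lambda>x. (9 - hex_rho x y) ^ 7) = 2 * pi * cpoly 1121280 (- 889280) 182784 53760 (- 35840) 6720 0 (- 128) 0 (cos y)" 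
    "integral {0..2 * pi} (\<lambda>x. (9 - hex_rho x y) ^ 8) = 2 * pi * cpoly 9244768 (- 7872128) 1492288 929152 (- 670880) 200704 (- 30464) 1024 256 (cos y)"
proof -
  define A where "A = 6 - 2 * cos y"
  define I where "I k = integral {0..2 * pi} (\<lambda>x. (9 - hex_rho x y) ^ k)" for k
  have rho: "9 - hex_rho x y = A + (- 2 - 2 * cos y) * cos x + (2 * sin y) * sin x" for x
    by (simp add: hex_rho_def A_def cos_add algebra_simps)
  have AR: "A\<^sup>2 - ((- 2 - 2 * cos y)\<^sup>2 + (2 * sin y)\<^sup>2) = 28 - 32 * cos y + 4 * (cos y)\<^sup>2"
    unfolding power_mult_distrib sin_squared_eq A_def by Groebner_Basis.algebra
  \<comment> \<open>The indices \<open>k1\<close> and \<open>k2\<close> are separate variables so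
    that the instances carry plain numerals.\<close>
  have rec: "real k2 * I k2 = real (2 * l + 3) * A * I k1 - real k1 * (28 - 32 * cos y + 4 * (cos y)\<^sup>2) * I l"
    if "k1 = l + 1" "k2 = l + 2" for l k1 k2
    unfolding I_def rho that AR[symmetric] by (rule trig_linear_power_recurrence(3))
  have i0: "I 0 = 2 * pi * cpoly 1 0 0 0 0 0 0 0 0 (cos y)"
    unfolding I_def rho trig_linear_power_recurrence(1) by (simp add: cpoly_def)
  have i1: "I 1 = 2 * pi * cpoly 6 (- 2) 0 0 0 0 0 0 0 (cos y)"
    unfolding I_def rho trig_linear_power_recurrence(2) by (simp add: cpoly_def A_def)
  have "real 2 * I 2 = real (2 * 0 + 3) * A * I 1 - real 1 * (28 - 32 * cos y + 4 * (cos y)\<^sup>2) * I 0"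
    by (rule rec) simp_all
  then have i2: "I 2 = 2 * pi * cpoly 40 (- 20) 4 0 0 0 0 0 0 (cos y)"
    unfolding i1 i0 cpoly_def A_def by simp Groebner_Basis.algebra
  have "real 3 * I 3 = real (2 * 1 + 3) * A * I 2 - real 2 * (28 - 32 * cos y + 4 * (cos y)\<^sup>2) * I 1"
    by (rule rec) simp_all
  then have i3: "I 3 = 2 * pi * cpoly 288 (- 168) 48 (- 8) 0 0 0 0 0 (cos y)"
    unfolding i2 i1 cpoly_def A_def by simp Groebner_Basis.algebra
  have "real 4 * I 4 = real (2 * 2 + 3) * A * I 3 - real 3 * (28 - 32 * cos y + 4 * (cos y)\<^sup>2) * I 2"
    by (rule rec) simp_all
  then have i4: "I 4 = 2 * pi * cpoly 2184 (- 1392) 408 (- 96) 16 0 0 0 0 (cos y)"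
    unfolding i3 i2 cpoly_def A_def by simp Groebner_Basis.algebra
  have "real 5 * I 5 = real (2 * 3 + 3) * A * I 4 - real 4 * (28 - 32 * cos y + 4 * (cos y)\<^sup>2) * I 3"
    by (rule rec) simp_all
  then have i5: "I 5 = 2 * pi * cpoly 17136 (- 11760) 3120 (- 560) 160 (- 32) 0 0 0 (cos y)"
    unfolding i4 i3 cpoly_def A_def by simp Groebner_Basis.algebra
  have "real 6 * I 6 = real (2 * 4 + 3) * A * I 5 - real 5 * (28 - 32 * cos y + 4 * (cos y)\<^sup>2) * I 4"
    by (rule rec) simp_all
  then have i6: "I 6 = 2 * pi * cpoly 137536 (- 101472) 23520 160 (- 480) (- 192) 64 0 0 (cos y)"
    unfolding i5 i4 cpoly_def A_def by simp Groebner_Basis.algebra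
  have "real 7 * I 7 = real (2 * 5 + 3) * A * I 6 - real 6 * (28 - 32 * cos y + 4 * (cos y)\<^sup>2) * I 5"
    by (rule rec) simp_all
  then have i7: "I 7 = 2 * pi * cpoly 1121280 (- 889280) 182784 53760 (- 35840) 6720 0 (- 128) 0 (cos y)"
    unfolding i6 i5 cpoly_def A_def by simp Groebner_Basis.algebra
  have "real 8 * I 8 = real (2 * 6 + 3) * A * I 7 - real 7 * (28 - 32 * cos y + 4 * (cos y)\<^sup>2) * I 6"
    by (rule rec) simp_all
  then have i8: "I 8 = 2 * pi * cpoly 9244768 (- 7872128) 1492288 929152 (- 670880) 200704 (- 30464) 1024 256 (cos y)"
    unfolding i7 i6 cpoly_def A_def by simp Groebner_Basis.algebra
  show 
    "integral {0..2 * pi} (\<lambda>x. (9 - hex_rho x y) ^ 0) = 2 * pi * cpoly 1 0 0 0 0 0 0 0 0 (cos y)" 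
    "integral {0..2 * pi} (\<lambda>x. (9 - hex_rho x y) ^ 1) = 2 * pi * cpoly 6 (- 2) 0 0 0 0 0 0 0 (cos y)" 
    "integral {0..2 * pi} (\<lambda>x. (9 - hex_rho x y) ^ 2) = 2 * pi * cpoly 40 (- 20) 4 0 0 0 0 0 0 (cos y)" 
    "integral {0..2 * pi} (\<lambda>x. (9 - hex_rho x y) ^ 3) = 2 * pi * cpoly 288 (- 168) 48 (- 8) 0 0 0 0 0 (cos y)" 
    "integral {0..2 * pi} (\<lambda>x. (9 - hex_rho x y) ^ 4) = 2 * pi * cpoly 2184 (- 1392) 408 (- 96) 16 0 0 0 0 (cos y)" 
    "integral {0..2 * pi} (\<lambda>x. (9 - hex_rho x y) ^ 5) = 2 * pi * cpoly 17136 (- 11760) 3120 (- 560) 160 (- 32) 0 0 0 (cos y)" 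
    "integral {0..2 * pi} (\<lambda>x. (9 - hex_rho x y) ^ 6) = 2 * pi * cpoly 137536 (- 101472) 23520 160 (- 480) (- 192) 64 0 0 (cos y)" 
    "integral {0..2 * pi} (\<lambda>x. (9 - hex_rho x y) ^ 7) = 2 * pi * cpoly 1121280 (- 889280) 182784 53760 (- 35840) 6720 0 (- 128) 0 (cos y)" 
    "integral {0..2 * pi} (\<lambda>x. (9 - hex_rho x y) ^ 8) = 2 * pi * cpoly 9244768 (- 7872128) 1492288 929152 (- 670880) 200704 (- 30464) 1024 256 (cos y)"
    using i0 i1 i2 i3 i4 i5 i6 i7 i8 unfolding I_def by blast+
qed

text \<open>\<open>9 - hex_rho x y\<close> is the Laplacian symbol of the triangular lattice,
  \<open>6\<close> minus six exponentials. Its normalised moments are constant terms of powers of a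
  Laurent polynomial with integer coefficients.\<close>

lemma hex_rho_moments:
  shows
    "integral {0..2 * pi} (\<lambda>y. integral {0..2 * pi} (\<lambda>x. (9 - hex_rho x y) ^ 0)) = 4 * pi\<^sup>2 * 1" 
    "integral {0..2 * pi} (\<lambda>y. integral {0..2 * pi} (\<lambda>x. (9 - hex_rho x y) ^ 1)) = 4 * pi\<^sup>2 * 6" 
    "integral {0..2 * pi} (\<lambda>y. integral {0..2 * pi} (\<lambda>x. (9 - hex_rho x y) ^ 2)) = 4 * pi\<^sup>2 * 42" 
    "integral {0..2 * pi} (\<lambda>y. integral {0..2 * pi} (\<lambda>x. (9 - hex_rho x y) ^ 3)) = 4 * pi\<^sup>2 * 312" 
    "integral {0..2 * pi} (\<lambda>y. integral {0..2 * pi} (\<lambda>x. (9 - hex_rho x y) ^ 4)) = 4 * pi\<^sup>2 * 2394" 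
    "integral {0..2 * pi} (\<lambda>y. integral {0..2 * pi} (\<lambda>x. (9 - hex_rho x y) ^ 5)) = 4 * pi\<^sup>2 * 18756" 
    "integral {0..2 * pi} (\<lambda>y. integral {0..2 * pi} (\<lambda>x. (9 - hex_rho x y) ^ 6)) = 4 * pi\<^sup>2 * 149136" 
    "integral {0..2 * pi} (\<lambda>y. integral {0..2 * pi} (\<lambda>x. (9 - hex_rho x y) ^ 7)) = 4 * pi\<^sup>2 * 1199232" 
    "integral {0..2 * pi} (\<lambda>y. integral {0..2 * pi} (\<lambda>x. (9 - hex_rho x y) ^ 8)) = 4 * pi\<^sup>2 * 9729882"
  unfolding hex_rho_inner_moments integral_cpoly_cos by simp_all

text \<open>Up to the scaling factor, the left-hand side interpolates \<open>w\<close> as a polynomial in \<open>w\<^sup>2\<close> at \<open>0\<close> and, with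
  multiplicity two, at \<open>1\<close>, \<open>2\<close>, \<open>5 / 2\<close> and \<open>29 / 10\<close>. These are close to the Gauss-Radau nodes of the
  distribution of \<open>sqrt (9 - hex_rho x y)\<close>.\<close>

lemma square_root_polynomial_bound:
  fixes w :: real
  assumes "w \<ge> 0"
  shows "347218349033233703485300 * (w\<^sup>2) - 272959271778462905923591 * (w\<^sup>2) ^ 2 + 144222273730509476566890 * (w\<^sup>2) ^ 3 - 45181256563715023395383 * (w\<^sup>2) ^ 4 + 8496678834922555714160 * (w\<^sup>2) ^ 5 - 942826978026675516576 * (w\<^sup>2) ^ 6 + 56880951252106067200 * (w\<^sup>2) ^ 7 - 1438101778276960000 * (w\<^sup>2) ^ 8 \<le> 180909389127934960038000 * w"
proof -
  \<comment> \<open>As a polynomial in \<open>w\<close> the difference has eight sign changes, so by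
    Descartes' rule the four prescribed double roots are all its positive roots. The remaining
    factor has positive coefficients.\<close>
  have "180909389127934960038000 * w - (347218349033233703485300 * (w\<^sup>2) - 272959271778462905923591 * (w\<^sup>2) ^ 2 + 144222273730509476566890 * (w\<^sup>2) ^ 3 - 45181256563715023395383 * (w\<^sup>2) ^ 4 + 8496678834922555714160 * (w\<^sup>2) ^ 5 - 942826978026675516576 * (w\<^sup>2) ^ 6 + 56880951252106067200 * (w\<^sup>2) ^ 7 - 1438101778276960000 * (w\<^sup>2) ^ 8)
    = w * ((10 * w - 29) * (2 * w - 5) * (w - 2) * (w - 1))\<^sup>2 * (2151122343970689180 + 5529160827624484151 * w + 6432799124973886098 * w ^ 2 + 4298046096251958927 * w ^ 3 + 1757176903344065784 * w ^ 4 + 435842631648158904 * w ^ 5 + 60400274687632320 * w ^ 6 + 3595254445692400 * w ^ 7)"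
    by Groebner_Basis.algebra
  also have "\<dots> \<ge> 0"
    using assms by (intro mult_nonneg_nonneg add_nonneg_nonneg) auto
  finally show ?thesis by simp
qed

lemma sqrt_plus_sqrt_minus:
  assumes "0 \<le> r" "r \<le> 9"
  shows "sqrt (3 + sqrt r) + sqrt (3 - sqrt r) = sqrt (6 + 2 * sqrt (9 - r))"
proof (rule real_sqrt_unique[symmetric])
  have "sqrt r \<le> 3" using assms by (intro real_le_lsqrt) auto
  then have nn: "0 \<le> 3 + sqrt r" "0 \<le> 3 - sqrt r" using assms by auto
  have "sqrt (3 + sqrt r) * sqrt (3 - sqrt r) = sqrt (9 - r)"
    using assms by (simp add: real_sqrt_mult[symmetric] algebra_simps)
  then show "(sqrt (3 + sqrt r) + sqrt (3 - sqrt r))\<^sup>2 = 6 + 2 * sqrt (9 - r)"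
    using nn by (simp add: power2_sum)
  show "0 \<le> sqrt (3 + sqrt r) + sqrt (3 - sqrt r)" using nn by simp
qed

lemma integral2_mono:
  fixes F G :: "real \<times> real \<Rightarrow> real"
  assumes "continuous_on UNIV F" "continuous_on UNIV G" "\<And>z. F z \<le> G z"
  shows "integral {0..2 * pi} (\<lambda>y. integral {0..2 * pi} (\<lambda>x. F (x, y)))
    \<le> integral {0..2 * pi} (\<lambda>y. integral {0..2 * pi} (\<lambda>x. G (x, y)))"
proof -
  have cont: "continuous_on S (\<lambda>x. H (x, y))" "continuous_on {0..2 * pi} (\<lambda>y. integral {0..2 * pi} (\<lambda>x. H (x, y)))"
    if "continuous_on UNIV H" for H :: "real \<times> real \<Rightarrow> real" and S y
    by (rule continuous_on_compose2[OF that]) (auto intro!: continuous_intros continuous_on_integral_fst continuous_on_subset[OF that])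
  show ?thesis
    by (intro integral_le integrable_continuous_real cont assms)
qed

lemma integral2_sum:
  fixes F :: "nat \<Rightarrow> real \<times> real \<Rightarrow> real"
  assumes "\<And>i. continuous_on UNIV (F i)"
  shows "integral {0..2 * pi} (\<lambda>y. integral {0..2 * pi} (\<lambda>x. \<Sum>i<n. a i * F i (x, y)))
    = (\<Sum>i<n. a i * integral {0..2 * pi} (\<lambda>y. integral {0..2 * pi} (\<lambda>x. F i (x, y))))"
proof (induction n)
  case (Suc n)
  have "continuous_on UNIV (\<lambda>z. \<Sum>i<n. a i * F i z)"
    by (intro continuous_intros assms)
  from integral2_add_cmult[OF this assms[of n], of "a n"] Suc show ?case by simp
qed simp

lemma sum_lessThan_9: "(\<Sum>i<9::nat. f i) = f 0 + f 1 + f 2 + f 3 + f 4 + f 5 + f 6 + f 7 + (f 8 :: real)"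
  by (simp add: numeral_eq_Suc)

lemma sum_lessThan_3: "(\<Sum>i<3::nat. f i) = f 0 + f 1 + (f 2 :: real)"
  by (simp add: numeral_eq_Suc)

text \<open>A quadratic in \<open>w\<close>, tangent to \<open>sqrt (6 + 2 * w)\<close> where this root is \<open>10 / 3\<close>.\<close>

lemma sqrt_quadratic_lower_bound:
  fixes w :: real
  assumes "0 \<le> w"
  shows "99343 / 40560 + 2649 / 6760 * w - 243 / 13520 * w\<^sup>2 \<le> sqrt (6 + 2 * w)"
proof -
  define s where "s = sqrt (6 + 2 * w)"
  have "s\<^sup>2 = 6 + 2 * w" using assms by (simp add: s_def)
  then have w: "w = (s\<^sup>2 - 6) / 2" by simp
  have "22 / 9 \<le> s"
    unfolding s_def using assms by (intro real_le_rsqrt) (simp add: power2_eq_square)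
  \<comment> \<open>The quadratic also agrees with the root at \<open>s = 22 / 9\<close>, just below
    the minimum \<open>sqrt 6\<close> of \<open>s\<close>. As a quartic in \<open>s\<close> without
    cubic term, the difference has root sum \<open>0\<close>, so the fourth root is
    \<open>- 82 / 9\<close> and the last factor is positive.\<close>
  moreover have "s - (99343 / 40560 + 2649 / 6760 * w - 243 / 13520 * w\<^sup>2)
      = (s - 22 / 9) * (s - 10 / 3)\<^sup>2 * (243 / 54080 * s + 1107 / 27040)"
    unfolding w by (simp add: power2_eq_square field_simps)
  ultimately have "0 \<le> s - (99343 / 40560 + 2649 / 6760 * w - 243 / 13520 * w\<^sup>2)"
    by (simp only:) (intro mult_nonneg_nonneg; simp)
  then show ?thesis by (simp add: s_def)
qed

lemma sqrt_tangent_bound: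
  fixes a h :: real
  assumes "0 \<le> a" "h > 0"
  shows "sqrt a \<le> (a + h\<^sup>2) / (2 * h)"
proof -
  have "0 \<le> (sqrt a - h)\<^sup>2" by simp
  then have "2 * h * sqrt a \<le> a + h\<^sup>2" using assms by (simp add: power2_diff algebra_simps)
  then show ?thesis using assms by (simp add: field_simps)
qed

text \<open>The bounds are the ends of the interval of radius \<open>0.01\<close> around
  \<open>1.6437\<close>. All integrands are squeezed between combinations of \<open>1\<close>,
  \<open>w\<close> and powers of \<open>u = w\<^sup>2\<close>, so the mean of \<open>w\<close> is
  the only quantity to be estimated.\<close>

lemma hex_constant_bounds: "16337 / 10000 < hex_constant" "hex_constant < 16537 / 10000"
proof -
  define I where "I F = integral {0..2 * pi} (\<lambda>y. integral {0..2 * pi} (\<lambda>x. F (x, y)))" for F :: "real \<times> real \<Rightarrow> real"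
  define u where "u = (\<lambda>(x, y). 9 - hex_rho x y)"
  define w where "w = (\<lambda>z. sqrt (u z))"
  have u0: "0 \<le> u z" for z
    using hex_rho_bounds by (simp add: u_def case_prod_unfold)
  have w0: "0 \<le> w z" "(w z)\<^sup>2 = u z" for z
    using u0 by (simp_all add: w_def)
  have contu: "continuous_on UNIV u"
    unfolding u_def case_prod_unfold hex_rho_def by (intro continuous_intros)
  have contw: "continuous_on UNIV w"
    unfolding w_def by (intro continuous_intros contu)
  have conts: "continuous_on UNIV (\<lambda>z. sqrt (6 + 2 * w z))"
    by (intro continuous_intros contw)
  have Iu: "I (\<lambda>z. u z ^ 0) = 4 * pi\<^sup>2 * 1" "I (\<lambda>z. u z ^ 1) = 4 * pi\<^sup>2 * 6" "I (\<lambda>z. u z ^ 2) = 4 * pi\<^sup>2 * 42"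
    "I (\<lambda>z. u z ^ 3) = 4 * pi\<^sup>2 * 312" "I (\<lambda>z. u z ^ 4) = 4 * pi\<^sup>2 * 2394" "I (\<lambda>z. u z ^ 5) = 4 * pi\<^sup>2 * 18756"
    "I (\<lambda>z. u z ^ 6) = 4 * pi\<^sup>2 * 149136" "I (\<lambda>z. u z ^ 7) = 4 * pi\<^sup>2 * 1199232" "I (\<lambda>z. u z ^ 8) = 4 * pi\<^sup>2 * 9729882"
    unfolding I_def u_def prod.case by (rule hex_rho_moments)+
  have I_sum: "I (\<lambda>z. \<Sum>i<n. a i * F i z) = (\<Sum>i<n. a i * I (F i))" if "\<And>i. continuous_on UNIV (F i)"
    for a :: "nat \<Rightarrow> real" and F n
    unfolding I_def using integral2_sum[OF that] .
  have I_mono: "I F \<le> I G" if "continuous_on UNIV F" "continuous_on UNIV G" "\<And>z. F z \<le> G z" for F G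
    unfolding I_def using integral2_mono[OF that] .
  have I_lin: "I (\<lambda>z. a * u z ^ 0 + b * w z + c * u z ^ 1) = a * (4 * pi\<^sup>2) + b * I w + c * (24 * pi\<^sup>2)" for a b c
  proof -
    define F where "F i = (if i = 0 then (\<lambda>z. u z ^ 0) else if i = 1 then w else (\<lambda>z. u z ^ 1))" for i :: nat
    define d where "d i = (if i = 0 then a else if i = 1 then b else c)" for i :: nat
    have "I (\<lambda>z. \<Sum>i<3. d i * F i z) = (\<Sum>i<3. d i * I (F i))"
      by (rule I_sum) (auto simp: F_def intro!: continuous_intros contu contw)
    then show ?thesis
      unfolding sum_lessThan_3 using Iu(1,2) by (simp add: F_def d_def)
  qed
  have c: "hex_constant = I (\<lambda>z. sqrt (6 + 2 * w z)) / (8 * pi\<^sup>2)"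
    unfolding hex_constant_eq hex_mean_def I_def w_def u_def prod.case
    by (simp add: sqrt_plus_sqrt_minus hex_rho_bounds)
  have pi0: "0 < pi\<^sup>2" by simp
  define a :: "nat \<Rightarrow> real" where "a i = [0, 347218349033233703485300, - 272959271778462905923591, 144222273730509476566890, - 45181256563715023395383, 8496678834922555714160, - 942826978026675516576, 56880951252106067200, - 1438101778276960000] ! i" for i
  have "I (\<lambda>z. \<Sum>i<9. a i * u z ^ i) \<le> I (\<lambda>z. 0 * u z ^ 0 + 180909389127934960038000 * w z + 0 * u z ^ 1)"
  proof (rule I_mono)
    fix z
    show "(\<Sum>i<9. a i * u z ^ i) \<le> 0 * u z ^ 0 + 180909389127934960038000 * w z + 0 * u z ^ 1"
      unfolding sum_lessThan_9 using square_root_polynomial_bound[OF w0(1)[of z]]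
      unfolding w0(2) by (simp add: a_def)
  qed (intro continuous_intros contu contw)+
  also have "\<dots> = 180909389127934960038000 * I w"
    unfolding I_lin by simp
  also have "I (\<lambda>z. \<Sum>i<9. a i * u z ^ i) = (\<Sum>i<9. a i * I (\<lambda>z. u z ^ i))"
    by (intro I_sum continuous_intros contu)
  also have "\<dots> = 4 * pi\<^sup>2 * 427602228051005048820780"
    unfolding sum_lessThan_9 Iu by (simp add: a_def)
  finally have "4 * pi\<^sup>2 * 427602228051005048820780 \<le> 180909389127934960038000 * I w" .
  \<comment> \<open>The quotient of the two large integers, \<open>2.36362...\<close>, is rounded
    down.\<close>
  then have Iw: "4 * pi\<^sup>2 * (23636 / 10000) \<le> I w"
    using pi0 by linarith
  have "I (\<lambda>z. 99343 / 40560 * u z ^ 0 + 2649 / 6760 * w z + (- 243 / 13520) * u z ^ 1) \<le> I (\<lambda>z. sqrt (6 + 2 * w z))"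
  proof (rule I_mono)
    fix z
    show "99343 / 40560 * u z ^ 0 + 2649 / 6760 * w z + (- 243 / 13520) * u z ^ 1 \<le> sqrt (6 + 2 * w z)"
      using sqrt_quadratic_lower_bound[OF w0(1)[of z]] by (simp add: w0(2))
  qed (intro continuous_intros contu contw)+
  then have lower: "99343 / 40560 * (4 * pi\<^sup>2) + 2649 / 6760 * I w - 243 / 13520 * (24 * pi\<^sup>2) \<le> I (\<lambda>z. sqrt (6 + 2 * w z))"
    unfolding I_lin by simp
  have "16337 / 10000 * (8 * pi\<^sup>2) < I (\<lambda>z. sqrt (6 + 2 * w z))"
    using lower Iw pi0 by linarith
  then show "16337 / 10000 < hex_constant"
    unfolding c by (simp add: less_divide_eq)
  have "I w \<le> I (\<lambda>z. 5 / 4 * u z ^ 0 + 0 * w z + 1 / 5 * u z ^ 1)"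
  proof (rule I_mono)
    show "w z \<le> 5 / 4 * u z ^ 0 + 0 * w z + 1 / 5 * u z ^ 1" for z
      \<comment> \<open>The tangent touches at \<open>w = 5 / 2\<close>, near the mean of
        \<open>w\<close>.\<close>
      using sqrt_tangent_bound[OF u0[of z], of "5 / 2"] by (simp add: w_def power2_eq_square field_simps)
  qed (intro continuous_intros contu contw)+
  then have Iw': "I w \<le> 5 / 4 * (4 * pi\<^sup>2) + 1 / 5 * (24 * pi\<^sup>2)"
    unfolding I_lin by simp
  have "I (\<lambda>z. sqrt (6 + 2 * w z)) \<le> I (\<lambda>z. 1689 / 660 * u z ^ 0 + 10 / 33 * w z + 0 * u z ^ 1)"
  proof (rule I_mono)
    show "sqrt (6 + 2 * w z) \<le> 1689 / 660 * u z ^ 0 + 10 / 33 * w z + 0 * u z ^ 1" for z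
      \<comment> \<open>The tangent touches where the outer root equals \<open>33 / 10\<close>,
        close to its value at the mean of \<open>w\<close>.\<close>
      using sqrt_tangent_bound[of "6 + 2 * w z" "33 / 10"] w0(1)[of z] by (simp add: power2_eq_square field_simps)
  qed (intro continuous_intros contu contw)+
  then have "I (\<lambda>z. sqrt (6 + 2 * w z)) \<le> 1689 / 660 * (4 * pi\<^sup>2) + 10 / 33 * I w"
    unfolding I_lin by simp
  then have "I (\<lambda>z. sqrt (6 + 2 * w z)) < 16537 / 10000 * (8 * pi\<^sup>2)"
    using Iw' pi0 by linarith
  then show "hex_constant < 16537 / 10000"
    unfolding c by (simp add: divide_less_eq)
qed

theorem theorem4p1:
  shows "has_iterated_limit (\<lambda>m n. LEL (hex_toroidal m n) / (2 * (real m + 1) * (real n + 1))) hex_constant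
    \<and> has_iterated_limit (\<lambda>m n. LEL (hex_cylindrical m n) / (2 * (real m + 1) * (real n + 1))) hex_constant
    \<and> has_iterated_limit (\<lambda>m n. LEL (hex_free m n) / (2 * (real m + 1) * (real n + 1))) hex_constant
    \<and> \<bar>hex_constant - 1.6437\<bar> < 0.01
    \<and> (\<lambda>(m, n). LEL (hex_toroidal m n)) \<sim>[sequentially \<times>\<^sub>F sequentially]
        (\<lambda>(m, n). 2 * hex_constant * (real m + 1) * (real n + 1))
    \<and> (\<lambda>(m, n). LEL (hex_cylindrical m n)) \<sim>[sequentially \<times>\<^sub>F sequentially]
        (\<lambda>(m, n). 2 * hex_constant * (real m + 1) * (real n + 1))
    \<and> (\<lambda>(m, n). LEL (hex_free m n)) \<sim>[sequentially \<times>\<^sub>F sequentially]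
        (\<lambda>(m, n). 2 * hex_constant * (real m + 1) * (real n + 1))
    \<and> \<bar>2 * hex_constant - 3.2874\<bar> < 0.02"
proof -
  have c: "\<bar>hex_constant - 1.6437\<bar> < 0.01" "\<bar>2 * hex_constant - 3.2874\<bar> < 0.02" "hex_constant \<noteq> 0"
  proof -
    have "\<bar>hex_constant - 16437 / 10000\<bar> < 1 / 100" "\<bar>2 * hex_constant - 32874 / 10000\<bar> < 2 / 100"
      using hex_constant_bounds by linarith+
    then show "\<bar>hex_constant - 1.6437\<bar> < 0.01" "\<bar>2 * hex_constant - 3.2874\<bar> < 0.02"
      by simp_all
    \<comment> \<open>The asymptotic equivalences divide by the constant, so its positivity is taken
      from the numerical lower bound.\<close>
    show "hex_constant \<noteq> 0" using hex_constant_bounds by linarith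
  qed
  show ?thesis
    by (intro conjI c LEL_hex_iterated LEL_hex_asymp_equiv) simp_all
qed

end
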